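(* Let $F:\mathrm{Br}_{Ar}\to\mathbb R$ be a potential on a Bratteli diagram $\mathrm{Br}$. The map $$T(\mathrm{AF}(\mathrm{Br}^+))\ni\tau\ \mapsto\ \tau\circ Q_F$$ is an affine homeomorphism of $T(\mathrm{AF}(\mathrm{Br}^+))$ onto the set of local $\mathrm{KMS}_\infty$-states for $\alpha^F$.
   Context: A Bratteli diagram $\mathrm{Br}$ is a directed graph with vertex set $\mathrm{Br}_V$, arrow set $\mathrm{Br}_{Ar}$, source and range maps $s,r$, such that $\mathrm{Br}_V=\bigsqcup_{n\ge 0}\mathrm{Br}_n$ with each level set $\mathrm{Br}_n$ finite, $\mathrm{Br}_0=\{v_0\}$, every vertex emits at least one and at most finitely many arrows, arrows emitted from $\mathrm{Br}_n$ end in $\mathrm{Br}_{n+1}$, and $v_0$ is the only vertex that is not the range of an arrow. Let $\mathcal P_n$ be the set of paths of length $n$ starting at $v_0$. $\mathrm{AF}(\mathrm{Br})$ is the unital $C^*$-algebra which is the closure of the increasing union of finite-dimensional unital subalgebras $\mathrm{AF}_n(\mathrm{Br})$, where $\mathrm{AF}_n(\mathrm{Br})$ has as linear basis matrix units $E^n_{\mu,\mu'}$, $\mu,\mu'\in\mathcal P_n$, $r(\mu)=r(\mu')$, with $E^n_{\mu,\mu'}E^n_{\nu,\nu'}=\delta_{\mu',\nu}E^n_{\mu,\nu'}$, $(E^n_{\mu,\mu'})^*=E^n_{\mu',\mu}$, $\sum_\mu E^n_{\mu,\mu}=1$, and $E^n_{\mu,\mu'}=\sum_{a\in s^{-1}(r(\mu))}E^{n+1}_{\mu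 a,\mu' a}$. A potential $F:\mathrm{Br}_{Ar}\to\mathbb R$ is extended to paths by $F(a_1\cdots a_n)=\sum_i F(a_i)$ and defines a flow $\alpha^F$ on $\mathrm{AF}(\mathrm{Br})$ by $\alpha^F_t(E^n_{\mu,\mu'})=e^{it(F(\mu)-F(\mu'))}E^n_{\mu,\mu'}$; it leaves each $\mathrm{AF}_n(\mathrm{Br})$ globally invariant. For a flow $\alpha$ on a unital $C^*$-algebra $A$ and $\beta\in\mathbb R$, a $\beta$-KMS state is a state $\omega$ with $\omega(ab)=\omega(b\alpha_{i\beta}(a))$ for all $\alpha$-analytic $a,b$. A state $\omega$ on $A$ is a $\mathrm{KMS}_\infty$-state for $\alpha$ if there are real numbers $\beta_k\to\infty$ and $\beta_k$-KMS states $\omega_k$ for $\alpha$ with $\omega_k\to\omega$ in the weak* topology. A state $\omega$ of $\mathrm{AF}(\mathrm{Br})$ is a local $\mathrm{KMS}_\infty$-state for $\alpha^F$ if for all $j$ the restriction $\omega|_{\mathrm{AF}_j(\mathrm{Br})}$ is a $\mathrm{KMS}_\infty$-state for the restriction of $\alpha^F$ to $\mathrm{AF}_j(\mathrm{Br})$. $T(A)$ denotes the set of trace states of $A$; sets of states carry the weak* topology. Let $P(\mathrm{Br})$ be the set of infinite paths $p=p_1p_2\cdots$ starting at $v_0$, and $p[1,n]=p_1\cdots p_n$. $p\in P(\mathrm{Br})$ is an ($F$-)geodesic if $F(p[1,n])\le F(\mu)$ for all $n\ge1$ and all $\mu\in\mathcal P_n$ with $r(\mu)=r(p_n)$. $\mathrm{Br}^+$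 is the Bratteli sub-diagram of $\mathrm{Br}$ with $\mathrm{Br}^+_0=\{v_0\}$, $\mathrm{Br}^+_n=\{r(p[1,n]): p \text{ a geodesic}\}$ for $n\ge1$, and whose arrows are the $a\in\mathrm{Br}_{Ar}$ such that $a=p_n$ for some geodesic $p$ and some $n$. Let $\mathcal G_n\subseteq\mathcal P_n$ be the set of paths in $\mathrm{Br}^+$ of length $n$ starting at $v_0$ and $Q_n=\sum_{\mu\in\mathcal G_n}E^n_{\mu,\mu}$. For each $n$, $\mathrm{AF}_n(\mathrm{Br}^+)$ is identified (via matrix units) with the corner $Q_n\mathrm{AF}_n(\mathrm{Br})Q_n$ of $\mathrm{AF}_n(\mathrm{Br})$. Let $\mathrm{AF}(\mathrm{Br})^{\alpha^F}$ be the fixed point algebra, $R:\mathrm{AF}(\mathrm{Br})\to\mathrm{AF}(\mathrm{Br})^{\alpha^F}$ the conditional expectation $R(a)=\lim_{T\to\infty}\frac1T\int_0^T\alpha^F_t(a)\,dt$, and $q_F:\mathrm{AF}(\mathrm{Br})^{\alpha^F}\to\mathrm{AF}(\mathrm{Br}^+)$ the unital surjective $*$-homomorphism determined by $q_F(a)=Q_naQ_n\in\mathrm{AF}_n(\mathrm{Br}^+)$ for $a\in\mathrm{AF}_n(\mathrm{Br})\cap\mathrm{AF}(\mathrm{Br})^{\alpha^F}$. Set $Q_F=q_F\circ R:\mathrm{AF}(\mathrm{Br})\to\mathrm{AF}(\mathrm{Br}^+)$. *)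

theory Defs
  imports "HOL-Analysis.Analysis" "Graph_Theory.Arc_Walk"
begin

section \<open>Unital C*-algebras\<close>

text \<open>
  The class \<^class>\<open>real_normed_algebra_1\<close> requires \<open>norm 1 = 1\<close>, so the zero algebra is excluded.
\<close>

class cstar_algebra = real_normed_algebra_1 + banach +
  fixes scaleC :: "complex \<Rightarrow> 'a \<Rightarrow> 'a" (infixr "*\<^sub>C" 75)
    and star :: "'a \<Rightarrow> 'a"
  assumes scaleC_add_right: "c *\<^sub>C (a + b) = c *\<^sub>C a + c *\<^sub>C b"
    and scaleC_add_left: "(c + d) *\<^sub>C a = c *\<^sub>C a + d *\<^sub>C a"
    and scaleC_scaleC: "c *\<^sub>C d *\<^sub>C a = (c * d) *\<^sub>C a"
    and scaleC_of_real: "complex_of_real r *\<^sub>C a = r *\<^sub>R a"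
    and mult_scaleC_left: "(c *\<^sub>C a) * b = c *\<^sub>C (a * b)"
    and mult_scaleC_right: "a * (c *\<^sub>C b) = c *\<^sub>C (a * b)"
    and norm_scaleC: "norm (c *\<^sub>C a) = cmod c * norm a"
    and star_add: "star (a + b) = star a + star b"
    and star_scaleC: "star (c *\<^sub>C a) = cnj c *\<^sub>C star a"
    and star_mult: "star (a * b) = star b * star a"
    and star_star: "star (star a) = a"
    and cstar_identity: "norm (star a * a) = (norm a)\<^sup>2"

global_interpretation complex_vector:
  vector_space "scaleC :: complex \<Rightarrow> 'a \<Rightarrow> 'a::cstar_algebra"
  defines cspan = complex_vector.span
    and cdependent = complex_vector.dependent
  using scaleC_of_real[of 1]
  by unfold_locales (auto simp: scaleC_add_right scaleC_add_left scaleC_scaleC)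

definition star_hom_on :: "'a::cstar_algebra set \<Rightarrow> ('a \<Rightarrow> 'b::cstar_algebra) \<Rightarrow> bool" where
  "star_hom_on B \<phi> \<longleftrightarrow>
     (\<forall>a\<in>B. \<forall>b\<in>B. \<phi> (a + b) = \<phi> a + \<phi> b \<and> \<phi> (a * b) = \<phi> a * \<phi> b) \<and>
     (\<forall>c. \<forall>a\<in>B. \<phi> (c *\<^sub>C a) = c *\<^sub>C \<phi> a) \<and>
     (\<forall>a\<in>B. \<phi> (star a) = star (\<phi> a))"

section \<open>States, flows and KMS states\<close>

text \<open>
  States of a unital C*-subalgebra \<open>B\<close> of the ambient algebra. They are represented by functions on
  the whole type of which only the values on \<open>B\<close> matter.
\<close>

definition state_on :: "'a::cstar_algebra set \<Rightarrow> ('a \<Rightarrow> complex) \<Rightarrow> bool" where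
  "state_on B \<omega> \<longleftrightarrow>
     (\<forall>a\<in>B. \<forall>b\<in>B. \<omega> (a + b) = \<omega> a + \<omega> b) \<and>
     (\<forall>c. \<forall>a\<in>B. \<omega> (c *\<^sub>C a) = c * \<omega> a) \<and>
     (\<forall>a\<in>B. \<omega> (star a * a) \<in> \<real>\<^sub>\<ge>\<^sub>0) \<and>
     \<omega> 1 = 1"

definition trace_states :: "('a::cstar_algebra \<Rightarrow> complex) set" where
  "trace_states = {\<tau>. state_on UNIV \<tau> \<and> (\<forall>a b. \<tau> (a * b) = \<tau> (b * a))}"

definition flow :: "(real \<Rightarrow> 'a::cstar_algebra \<Rightarrow> 'a) \<Rightarrow> bool" where
  "flow \<alpha> \<longleftrightarrow>
     (\<forall>t. bij (\<alpha> t) \<and> star_hom_on UNIV (\<alpha> t)) \<and>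
     (\<forall>s t. \<alpha> (s + t) = \<alpha> s \<circ> \<alpha> t) \<and>
     (\<forall>a. continuous_on UNIV (\<lambda>t. \<alpha> t a))"

definition entire :: "(complex \<Rightarrow> 'a::cstar_algebra) \<Rightarrow> bool" where
  "entire f \<longleftrightarrow> (\<forall>z. \<exists>d. (f has_derivative (\<lambda>h. h *\<^sub>C d)) (at z))"

text \<open>
  \<open>f\<close> is the entire extension \<open>z \<mapsto> \<alpha>\<^sub>z(a)\<close> of the orbit map \<open>t \<mapsto> \<alpha>\<^sub>t(a)\<close>, taken within
  an \<open>\<alpha>\<close>-invariant subalgebra \<open>B\<close>. It is unique if it exists.
\<close>

definition analytic_extension ::
  "'a::cstar_algebra set \<Rightarrow> (real \<Rightarrow> 'a \<Rightarrow> 'a) \<Rightarrow> 'a \<Rightarrow> (complex \<Rightarrow> 'a) \<Rightarrow> bool" where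
  "analytic_extension B \<alpha> a f \<longleftrightarrow>
     range f \<subseteq> B \<and> entire f \<and> (\<forall>t. f (complex_of_real t) = \<alpha> t a)"

definition analytic_elements ::
  "'a::cstar_algebra set \<Rightarrow> (real \<Rightarrow> 'a \<Rightarrow> 'a) \<Rightarrow> 'a set" where
  "analytic_elements B \<alpha> = {a \<in> B. \<exists>f. analytic_extension B \<alpha> a f}"

text \<open>
  The next two definitions concern the restriction of the flow \<open>\<alpha>\<close> to the \<open>\<alpha>\<close>-invariant unital
  C*-subalgebra \<open>B\<close>; for \<open>B = UNIV\<close> they concern \<open>\<alpha>\<close> itself.
\<close>

definition KMS_state_on ::
  "'a::cstar_algebra set \<Rightarrow> (real \<Rightarrow> 'a \<Rightarrow> 'a) \<Rightarrow> real \<Rightarrow> ('a \<Rightarrow> complex) \<Rightarrow> bool" where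
  "KMS_state_on B \<alpha> \<beta> \<omega> \<longleftrightarrow> state_on B \<omega> \<and>
     (\<forall>a \<in> analytic_elements B \<alpha>. \<forall>b \<in> analytic_elements B \<alpha>. \<forall>f.
        analytic_extension B \<alpha> a f \<longrightarrow> \<omega> (a * b) = \<omega> (b * f (\<i> * complex_of_real \<beta>)))"

definition KMS_infinity_state_on ::
  "'a::cstar_algebra set \<Rightarrow> (real \<Rightarrow> 'a \<Rightarrow> 'a) \<Rightarrow> ('a \<Rightarrow> complex) \<Rightarrow> bool" where
  "KMS_infinity_state_on B \<alpha> \<omega> \<longleftrightarrow> state_on B \<omega> \<and>
     (\<exists>(\<beta> :: nat \<Rightarrow> real) (\<psi> :: nat \<Rightarrow> 'a \<Rightarrow> complex).
        filterlim \<beta> at_top sequentially \<and>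
        (\<forall>k. KMS_state_on B \<alpha> (\<beta> k) (\<psi> k)) \<and>
        (\<forall>a\<in>B. (\<lambda>k. \<psi> k a) \<longlonglongrightarrow> \<omega> a))"

definition fixed_point_algebra :: "(real \<Rightarrow> 'a::cstar_algebra \<Rightarrow> 'a) \<Rightarrow> 'a set" where
  "fixed_point_algebra \<alpha> = {a. \<forall>t. \<alpha> t a = a}"

definition fixed_point_expectation ::
  "(real \<Rightarrow> 'a::cstar_algebra \<Rightarrow> 'a) \<Rightarrow> 'a \<Rightarrow> 'a" where
  "fixed_point_expectation \<alpha> a =
     Lim at_top (\<lambda>T. (1 / T) *\<^sub>R integral {0..T} (\<lambda>t. \<alpha> t a))"

text \<open>
  The topology of the function type \<open>'a \<Rightarrow> complex\<close> is that of pointwise convergence, so it induces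
  the weak* topology on sets of states.
\<close>

definition affine_homeomorphism ::
  "('b \<Rightarrow> complex) set \<Rightarrow> ('a \<Rightarrow> complex) set \<Rightarrow>
   (('b \<Rightarrow> complex) \<Rightarrow> 'a \<Rightarrow> complex) \<Rightarrow> bool" where
  "affine_homeomorphism S S' \<Phi> \<longleftrightarrow>
     homeomorphic_map (top_of_set S) (top_of_set S') \<Phi> \<and>
     (\<forall>\<sigma>\<in>S. \<forall>\<tau>\<in>S. \<forall>t\<in>{0..1}.
        \<Phi> (\<lambda>b. of_real t * \<sigma> b + of_real (1 - t) * \<tau> b) =
        (\<lambda>a. of_real t * \<Phi> \<sigma> a + of_real (1 - t) * \<Phi> \<tau> a))"

section \<open>Bratteli diagrams\<close>

locale bratteli_diagram = wf_digraph Br for Br :: "('v, 'e) pre_digraph" +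
  fixes lvl :: "nat \<Rightarrow> 'v set" and v0 :: 'v
  assumes verts_eq: "verts Br = (\<Union>n. lvl n)"
    and disjoint_levels: "disjoint_family lvl"
    and finite_level: "finite (lvl n)"
    and level_0: "lvl 0 = {v0}"
    and emits: "v \<in> verts Br \<Longrightarrow> out_arcs Br v \<noteq> {} \<and> finite (out_arcs Br v)"
    and level_Suc: "a \<in> arcs Br \<Longrightarrow> tail Br a \<in> lvl n \<Longrightarrow> head Br a \<in> lvl (Suc n)"
    and unique_source: "v \<in> verts Br \<Longrightarrow> in_arcs Br v = {} \<longleftrightarrow> v = v0"

definition paths :: "('v, 'e) pre_digraph \<Rightarrow> 'v \<Rightarrow> nat \<Rightarrow> 'e list set" where
  "paths Br v0 n = {\<mu>. length \<mu> = n \<and> (\<exists>v. pre_digraph.awalk Br v0 \<mu> v)}"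

abbreviation path_range :: "('v, 'e) pre_digraph \<Rightarrow> 'v \<Rightarrow> 'e list \<Rightarrow> 'v" where
  "path_range Br v0 \<mu> \<equiv> pre_digraph.awlast Br v0 \<mu>"

definition path_pairs ::
  "('v, 'e) pre_digraph \<Rightarrow> 'v \<Rightarrow> nat \<Rightarrow> ('e list \<times> 'e list) set" where
  "path_pairs Br v0 n =
     {(\<mu>, \<mu>'). \<mu> \<in> paths Br v0 n \<and> \<mu>' \<in> paths Br v0 n \<and> path_range Br v0 \<mu> = path_range Br v0 \<mu>'}"

definition path_potential :: "('e \<Rightarrow> real) \<Rightarrow> 'e list \<Rightarrow> real" where
  "path_potential F \<mu> = sum_list (map F \<mu>)"

text \<open>
  An infinite path \<open>p\<^sub>1 p\<^sub>2 \<dots>\<close> is represented by the function \<open>p\<close> with \<open>p i = p\<^sub>i\<^sub>+\<^sub>1\<close>.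
\<close>

definition infinite_paths :: "('v, 'e) pre_digraph \<Rightarrow> 'v \<Rightarrow> (nat \<Rightarrow> 'e) set" where
  "infinite_paths Br v0 =
     {p. range p \<subseteq> arcs Br \<and> tail Br (p 0) = v0 \<and> (\<forall>i. head Br (p i) = tail Br (p (Suc i)))}"

definition initial_path :: "(nat \<Rightarrow> 'e) \<Rightarrow> nat \<Rightarrow> 'e list" where
  "initial_path p n = map p [0..<n]"

definition geodesics ::
  "('v, 'e) pre_digraph \<Rightarrow> 'v \<Rightarrow> ('e \<Rightarrow> real) \<Rightarrow> (nat \<Rightarrow> 'e) set" where
  "geodesics Br v0 F =
     {p \<in> infinite_paths Br v0.
        \<forall>n\<ge>1. \<forall>\<mu>\<in>paths Br v0 n. path_range Br v0 \<mu> = head Br (p (n - 1)) \<longrightarrow>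
          path_potential F (initial_path p n) \<le> path_potential F \<mu>}"

definition geodesic_level ::
  "('v, 'e) pre_digraph \<Rightarrow> 'v \<Rightarrow> ('e \<Rightarrow> real) \<Rightarrow> nat \<Rightarrow> 'v set" where
  "geodesic_level Br v0 F n =
     (if n = 0 then {v0} else {path_range Br v0 (initial_path p n) | p. p \<in> geodesics Br v0 F})"

definition geodesic_subdiagram ::
  "('v, 'e) pre_digraph \<Rightarrow> 'v \<Rightarrow> ('e \<Rightarrow> real) \<Rightarrow> ('v, 'e) pre_digraph" where
  "geodesic_subdiagram Br v0 F =
     \<lparr>verts = (\<Union>n. geodesic_level Br v0 F n),
      arcs = {a \<in> arcs Br. \<exists>p \<in> geodesics Br v0 F. \<exists>i. a = p i},
      tail = tail Br,
      head = head Br\<rparr>"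

section \<open>The AF algebra of a Bratteli diagram\<close>

definition AF_alg ::
  "('v, 'e) pre_digraph \<Rightarrow> 'v \<Rightarrow> (nat \<Rightarrow> 'e list \<Rightarrow> 'e list \<Rightarrow> 'a::cstar_algebra) \<Rightarrow> nat \<Rightarrow> 'a set"
where
  "AF_alg Br v0 E n = cspan ((\<lambda>(\<mu>, \<mu>'). E n \<mu> \<mu>') ` path_pairs Br v0 n)"

text \<open>
  The algebra \<open>'a\<close>, with the matrix units \<open>E\<close>, is the AF algebra of the diagram. This determines the
  pair up to isomorphism.
\<close>

locale AF_algebra =
  fixes Br :: "('v, 'e) pre_digraph" and v0 :: 'v
    and E :: "nat \<Rightarrow> 'e list \<Rightarrow> 'e list \<Rightarrow> 'a::cstar_algebra"
  assumes inj_E: "inj_on (\<lambda>(\<mu>, \<mu>'). E n \<mu> \<mu>') (path_pairs Br v0 n)"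
    and independent_E: "\<not> cdependent ((\<lambda>(\<mu>, \<mu>'). E n \<mu> \<mu>') ` path_pairs Br v0 n)"
    and mult_E: "(\<mu>, \<mu>') \<in> path_pairs Br v0 n \<Longrightarrow> (\<nu>, \<nu>') \<in> path_pairs Br v0 n \<Longrightarrow>
          E n \<mu> \<mu>' * E n \<nu> \<nu>' = (if \<mu>' = \<nu> then E n \<mu> \<nu>' else 0)"
    and star_E: "(\<mu>, \<mu>') \<in> path_pairs Br v0 n \<Longrightarrow> star (E n \<mu> \<mu>') = E n \<mu>' \<mu>"
    and sum_E: "(\<Sum>\<mu>\<in>paths Br v0 n. E n \<mu> \<mu>) = 1"
    and refine_E: "(\<mu>, \<mu>') \<in> path_pairs Br v0 n \<Longrightarrow>
          E n \<mu> \<mu>' = (\<Sum>a\<in>out_arcs Br (path_range Br v0 \<mu>). E (Suc n) (\<mu> @ [a]) (\<mu>' @ [a]))"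
    and dense: "closure (\<Union>n. AF_alg Br v0 E n) = UNIV"

definition AF_flow ::
  "('v, 'e) pre_digraph \<Rightarrow> 'v \<Rightarrow> (nat \<Rightarrow> 'e list \<Rightarrow> 'e list \<Rightarrow> 'a::cstar_algebra) \<Rightarrow>
   ('e \<Rightarrow> real) \<Rightarrow> real \<Rightarrow> 'a \<Rightarrow> 'a" where
  "AF_flow Br v0 E F =
     (THE \<alpha>. flow \<alpha> \<and>
        (\<forall>n. \<forall>(\<mu>, \<mu>')\<in>path_pairs Br v0 n. \<forall>t.
           \<alpha> t (E n \<mu> \<mu>') =
             exp (\<i> * complex_of_real (t * (path_potential F \<mu> - path_potential F \<mu>'))) *\<^sub>C E n \<mu> \<mu>'))"

definition local_KMS_infinity_states ::
  "('v, 'e) pre_digraph \<Rightarrow> 'v \<Rightarrow> (nat \<Rightarrow> 'e list \<Rightarrow> 'e list \<Rightarrow> 'a::cstar_algebra) \<Rightarrow>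
   ('e \<Rightarrow> real) \<Rightarrow> ('a \<Rightarrow> complex) set" where
  "local_KMS_infinity_states Br v0 E F =
     {\<omega>. state_on UNIV \<omega> \<and>
          (\<forall>j. KMS_infinity_state_on (AF_alg Br v0 E j) (AF_flow Br v0 E F) \<omega>)}"

definition geodesic_projection ::
  "('v, 'e) pre_digraph \<Rightarrow> 'v \<Rightarrow> (nat \<Rightarrow> 'e list \<Rightarrow> 'e list \<Rightarrow> 'a::cstar_algebra) \<Rightarrow>
   ('e \<Rightarrow> real) \<Rightarrow> nat \<Rightarrow> 'a" where
  "geodesic_projection Br v0 E F n =
     (\<Sum>\<mu>\<in>paths (geodesic_subdiagram Br v0 F) v0 n. E n \<mu> \<mu>)"

text \<open>
  Identification, via matrix units, of the corner \<open>Q\<^sub>n AF\<^sub>n(Br) Q\<^sub>n\<close> of the algebra with matrix units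
  \<open>E\<close> with the \<open>n\<close>-th algebra of the geodesic subdiagram, whose matrix units are \<open>E'\<close>: the elements
  \<open>x\<close> and \<open>y\<close> have the same coefficients.
\<close>

definition corner_identified ::
  "('v, 'e) pre_digraph \<Rightarrow> 'v \<Rightarrow> (nat \<Rightarrow> 'e list \<Rightarrow> 'e list \<Rightarrow> 'a::cstar_algebra) \<Rightarrow>
   (nat \<Rightarrow> 'e list \<Rightarrow> 'e list \<Rightarrow> 'b::cstar_algebra) \<Rightarrow> ('e \<Rightarrow> real) \<Rightarrow> nat \<Rightarrow> 'a \<Rightarrow> 'b \<Rightarrow> bool" where
  "corner_identified Br v0 E E' F n x y \<longleftrightarrow>
     (\<exists>c. x = (\<Sum>(\<mu>, \<mu>')\<in>path_pairs (geodesic_subdiagram Br v0 F) v0 n. c \<mu> \<mu>' *\<^sub>C E n \<mu> \<mu>') \<and>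
          y = (\<Sum>(\<mu>, \<mu>')\<in>path_pairs (geodesic_subdiagram Br v0 F) v0 n. c \<mu> \<mu>' *\<^sub>C E' n \<mu> \<mu>'))"

text \<open>
  The conditions determine \<open>q\<close> on the fixed point algebra; its values elsewhere are arbitrary and
  are never used.
\<close>

definition geodesic_quotient ::
  "('v, 'e) pre_digraph \<Rightarrow> 'v \<Rightarrow> (nat \<Rightarrow> 'e list \<Rightarrow> 'e list \<Rightarrow> 'a::cstar_algebra) \<Rightarrow>
   (nat \<Rightarrow> 'e list \<Rightarrow> 'e list \<Rightarrow> 'b::cstar_algebra) \<Rightarrow> ('e \<Rightarrow> real) \<Rightarrow> 'a \<Rightarrow> 'b" where
  "geodesic_quotient Br v0 E E' F =
     (SOME q. star_hom_on (fixed_point_algebra (AF_flow Br v0 E F)) q \<and> q 1 = 1 \<and>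
        q ` fixed_point_algebra (AF_flow Br v0 E F) = UNIV \<and>
        (\<forall>n. \<forall>a \<in> AF_alg Br v0 E n \<inter> fixed_point_algebra (AF_flow Br v0 E F).
           corner_identified Br v0 E E' F n
             (geodesic_projection Br v0 E F n * a * geodesic_projection Br v0 E F n) (q a)))"

definition geodesic_compression ::
  "('v, 'e) pre_digraph \<Rightarrow> 'v \<Rightarrow> (nat \<Rightarrow> 'e list \<Rightarrow> 'e list \<Rightarrow> 'a::cstar_algebra) \<Rightarrow>
   (nat \<Rightarrow> 'e list \<Rightarrow> 'e list \<Rightarrow> 'b::cstar_algebra) \<Rightarrow> ('e \<Rightarrow> real) \<Rightarrow> 'a \<Rightarrow> 'b" where
  "geodesic_compression Br v0 E E' F =
     geodesic_quotient Br v0 E E' F \<circ> fixed_point_expectation (AF_flow Br v0 E F)"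

end

theory Submission
  imports Defs "HOL-Complex_Analysis.Conformal_Mappings"
begin

text \<open>
  The proof describes both sides of the correspondence by their values on matrix units.

  On the stage \<open>AF\<^sub>n(Br)\<close> a KMS state at inverse temperature \<open>\<beta>\<close> vanishes on the matrix units off the
  diagonal, and its values at the diagonal units of two paths \<open>\<mu>\<close>, \<open>\<mu>'\<close> to the same vertex have the
  Boltzmann ratio \<open>exp (- \<beta> (F(\<mu>) - F(\<mu>')))\<close>. In the limit \<open>\<beta> \<rightarrow> \<infinity>\<close> the weight at each vertex is therefore
  spread uniformly over the paths to it that minimise \<open>F\<close>. Imposing this on all stages at once moves
  the weight onto the geodesics: a path that does not begin any geodesic has, by Koenig's lemma, some
  length at which all of its prolongations fail to be minimal, and its diagonal unit is the sum of
  those of its prolongations. So a local ground state is diagonal, vanishes outside the paths of the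
  geodesic subdiagram, and takes equal values on the geodesic paths to a common vertex
  (\<open>local_imp_geodesic_state\<close>). Conversely, such a state is on each stage the limit of Gibbs states
  (\<open>geodesic_state_imp_local\<close>).

  A trace state of \<open>AF(Br\<^sup>+)\<close> is likewise diagonal with equal values on paths to a common vertex, so its
  composition with the compression \<open>Q\<^sub>F\<close> has these properties (\<open>trace_imp_geodesic_state\<close>). For the
  way back, a geodesic state \<open>\<omega>\<close> satisfies \<open>|\<omega>(a)| \<le> \<parallel>Q\<^sub>F(a)\<parallel>\<close> (\<open>geodesic_state_le_norm_C\<close>), hence
  factors through \<open>Q\<^sub>F\<close>, and it is tracial on the fixed point algebra
  (\<open>geodesic_state_trace_on_Fix\<close>). As \<open>Q\<^sub>F\<close> maps the fixed point algebra onto \<open>AF(Br\<^sup>+)\<close>, the inverse of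
  \<open>\<tau> \<mapsto> \<tau> \<circ> Q\<^sub>F\<close> is composition with any section \<open>s\<close> of the quotient map. Both directions are
  compositions with a fixed map, and are thus continuous for pointwise convergence.

  The flow, the expectation and the quotient map have to be constructed before they can be used,
  since they are specified by a description or a limit. Each is explicit on the stages and contractive
  there, and extends by continuity. On the stages the flow is conjugation by unitaries, and on
  their fixed points the quotient map is a *-homomorphism; contractivity of *-homomorphisms and boundedness of states are
  derived from the C*-identity with square roots given by the binomial series. The quotient map is
  surjective because the stages of \<open>AF(Br\<^sup>+)\<close> embed as corners without increase of norms, so that a
  convergent series can be lifted term by term.
\<close>

section \<open>C*-algebra preliminaries\<close>

interpretation scaleC: bounded_bilinear "scaleC :: complex \<Rightarrow> 'a::cstar_algebra \<Rightarrow> 'a"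
proof
  fix r :: real and c :: complex and a :: 'a
  show "(r *\<^sub>R c) *\<^sub>C a = r *\<^sub>R (c *\<^sub>C a)"
    by (simp add: scaleC_of_real[symmetric] scaleC_scaleC scaleR_conv_of_real)
  show "c *\<^sub>C (r *\<^sub>R a) = r *\<^sub>R (c *\<^sub>C a)"
    by (simp add: scaleC_of_real[symmetric] scaleC_scaleC mult.commute)
  show "\<exists>K. \<forall>c (a::'a). norm (c *\<^sub>C a) \<le> norm c * norm a * K"
    by (rule exI[of _ 1]) (simp add: norm_scaleC)
qed (simp_all add: scaleC_add_left scaleC_add_right)

lemma scaleC_one [simp]: "1 *\<^sub>C a = (a::'a::cstar_algebra)"
  using scaleC_of_real[of 1 a] by simp

lemma norm_star [simp]: "norm (star a) = norm (a::'a::cstar_algebra)"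
proof -
  have le: "norm b \<le> norm (star b)" for b :: 'a
  proof (cases "b = 0")
    case False
    have "norm b * norm b \<le> norm (star b) * norm b"
      using cstar_identity[of b] norm_mult_ineq[of "star b" b] by (simp add: power2_eq_square)
    with False show ?thesis by simp
  qed simp
  show ?thesis using le[of a] le[of "star a"] by (simp add: star_star)
qed

lemma bounded_linear_star: "bounded_linear (star :: 'a::cstar_algebra \<Rightarrow> 'a)"
proof
  show "star (r *\<^sub>R a) = r *\<^sub>R star a" for r and a :: 'a
    using star_scaleC[of "complex_of_real r" a] by (simp add: scaleC_of_real)
  show "\<exists>K. \<forall>a::'a. norm (star a) \<le> norm a * K"
    by (rule exI[of _ 1]) simp
qed (rule star_add)

lemmas star_scaleR = linear_cmul[OF bounded_linear.linear[OF bounded_linear_star]]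
  and star_diff = linear_diff[OF bounded_linear.linear[OF bounded_linear_star]]
  and star_zero = linear_0[OF bounded_linear.linear[OF bounded_linear_star]]
  and star_sum = linear_sum[OF bounded_linear.linear[OF bounded_linear_star]]
  and tendsto_star = bounded_linear.tendsto[OF bounded_linear_star]

lemma star_one [simp]: "star 1 = (1::'a::cstar_algebra)"
  using star_mult[of "1::'a" "star 1"] by (simp add: star_star)

lemma star_power: "star (a ^ n) = star a ^ n" for a :: "'a::cstar_algebra"
  by (induction n) (simp_all add: star_mult power_commutes)

lemma norm_unitary: "star u * u = 1 \<Longrightarrow> norm (u::'a::cstar_algebra) = 1"
  using cstar_identity[of u] norm_ge_zero[of u] by (auto simp: power2_eq_1_iff)

text \<open>
  A projection that is not zero has norm one, by the C*-identity; this is what makes matrix units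
  have norm one.
\<close>

lemma norm_projection:
  assumes "star e * e = e" "e \<noteq> 0"
  shows "norm (e::'a::cstar_algebra) = 1"
  using cstar_identity[of e] assms by (simp add: power2_eq_square)

definition cstar_subalgebra :: "'a::cstar_algebra set \<Rightarrow> bool" where
  "cstar_subalgebra B \<longleftrightarrow> closed B \<and> 1 \<in> B \<and>
     (\<forall>a\<in>B. \<forall>b\<in>B. a + b \<in> B \<and> a * b \<in> B) \<and> (\<forall>c. \<forall>a\<in>B. c *\<^sub>C a \<in> B) \<and> (\<forall>a\<in>B. star a \<in> B)"

lemma cstar_subalgebraD:
  assumes "cstar_subalgebra B"
  shows "closed B" "1 \<in> B" "a \<in> B \<Longrightarrow> b \<in> B \<Longrightarrow> a + b \<in> B" "a \<in> B \<Longrightarrow> b \<in> B \<Longrightarrow> a * b \<in> B"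
    "a \<in> B \<Longrightarrow> c *\<^sub>C a \<in> B" "a \<in> B \<Longrightarrow> star a \<in> B" "a \<in> B \<Longrightarrow> r *\<^sub>R a \<in> B"
    "a \<in> B \<Longrightarrow> b \<in> B \<Longrightarrow> a - b \<in> B" "0 \<in> B"
proof -
  show *: "closed B" "1 \<in> B" "\<And>a b. a \<in> B \<Longrightarrow> b \<in> B \<Longrightarrow> a + b \<in> B"
    "\<And>a b. a \<in> B \<Longrightarrow> b \<in> B \<Longrightarrow> a * b \<in> B"
    "\<And>a c. a \<in> B \<Longrightarrow> c *\<^sub>C a \<in> B" "\<And>a. a \<in> B \<Longrightarrow> star a \<in> B"
    using assms by (auto simp: cstar_subalgebra_def)
  show R: "a \<in> B \<Longrightarrow> r *\<^sub>R a \<in> B" for a r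
    using *(5)[of a "complex_of_real r"] by (simp add: scaleC_of_real)
  show "a \<in> B \<Longrightarrow> b \<in> B \<Longrightarrow> a - b \<in> B"
    using *(3)[of a "(-1) *\<^sub>R b"] R[of b "-1"] by simp
  show "0 \<in> B" using R[OF *(2), of 0] by simp
qed

lemma cstar_subalgebra_UNIV: "cstar_subalgebra UNIV"
  by (simp add: cstar_subalgebra_def)

lemma abs_gchoose_half_le_one: "\<bar>(1/2::real) gchoose n\<bar> \<le> 1"
proof (induction n)
  case (Suc n)
  have "(1/2::real) gchoose (Suc n) = (1/2 gchoose n) * ((1/2 - real n) / real (Suc n))"
    using gbinomial_mult_1[of "1/2::real" n] by (simp add: field_simps)
  moreover have "\<bar>(1/2 - real n) / real (Suc n)\<bar> \<le> 1"
    by (simp add: field_simps abs_le_iff)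
  ultimately show ?case
    using mult_mono[OF Suc.IH, of "\<bar>(1/2 - real n) / real (Suc n)\<bar>" 1] by (simp only: abs_mult) simp
qed simp

text \<open>
  Square roots of \<open>1 - h\<close> come from the binomial series of exponent \<open>1/2\<close>, whose square collapses to
  \<open>1 - h\<close> by Vandermonde's identity. They stand in for the functional calculus in the two automatic
  continuity results that follow.
\<close>

lemma sqrt_one_minus:
  fixes h :: "'a::cstar_algebra"
  assumes B: "cstar_subalgebra B" and h: "h \<in> B" "star h = h" "norm h < 1"
  obtains s where "s \<in> B" "star s = s" "s * s = 1 - h" "\<And>x. x * h = h * x \<Longrightarrow> x * s = s * x"
proof -
  define c where "c n = ((1/2::real) gchoose n) * (-1) ^ n" for n
  define f where "f n = c n *\<^sub>R h ^ n" for n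
  define s where "s = (\<Sum>n. f n)"
  have c_le: "\<bar>c n\<bar> \<le> 1" for n
    using abs_gchoose_half_le_one[of n] by (simp add: c_def abs_mult power_abs)
  have f_le: "norm (f n) \<le> norm h ^ n" for n
  proof -
    have "norm (f n) = \<bar>c n\<bar> * norm (h ^ n)" by (simp add: f_def)
    also have "\<dots> \<le> 1 * norm h ^ n"
      by (intro mult_mono c_le norm_power_ineq) auto
    finally show ?thesis by simp
  qed
  have sumn: "summable (\<lambda>n. norm (f n))"
    by (rule summable_comparison_test'[where g = "\<lambda>n. norm h ^ n" and N = 0])
      (use f_le h(3) in \<open>auto intro!: summable_geometric\<close>)
  then have sum: "summable f" by (rule summable_norm_cancel)
  have hB: "h ^ n \<in> B" for n
    by (induction n) (auto intro: cstar_subalgebraD[OF B] h)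
  have "(\<Sum>i<n. f i) \<in> B" for n
    by (induction n) (auto simp: f_def intro: cstar_subalgebraD[OF B] hB)
  moreover have "(\<lambda>n. \<Sum>i<n. f i) \<longlonglongrightarrow> s"
    using sum unfolding s_def by (rule summable_LIMSEQ)
  ultimately have sB: "s \<in> B"
    by (rule closed_sequentially[OF cstar_subalgebraD(1)[OF B]])
  have "star s = (\<Sum>n. star (f n))"
    unfolding s_def by (rule bounded_linear.suminf[OF bounded_linear_star sum])
  then have ss: "star s = s" by (simp add: f_def star_scaleR star_power h(2) s_def)
  have comm: "x * s = s * x" if x: "x * h = h * x" for x
  proof -
    have "x * h ^ n = h ^ n * x" for n
    proof (induction n)
      case (Suc n)
      have "x * h ^ Suc n = h * (x * h ^ n)" by (simp add: x flip: mult.assoc)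
      then show ?case using Suc.IH by (simp add: mult.assoc)
    qed simp
    then show ?thesis
      unfolding s_def using suminf_mult2[OF sum, of x] suminf_mult[OF sum, of x] by (simp add: f_def)
  qed
  have "(\<lambda>k. \<Sum>i\<le>k. f i * f (k - i)) sums (s * s)"
    unfolding s_def by (rule Cauchy_product_sums[OF sumn sumn])
  moreover have "(\<Sum>i\<le>k. f i * f (k - i)) = (((1::real) gchoose k) * (-1) ^ k) *\<^sub>R h ^ k" for k
  proof -
    have "(\<Sum>i\<le>k. f i * f (k - i)) =
        (\<Sum>i\<le>k. ((((1/2::real) gchoose i) * (1/2 gchoose (k - i))) * (-1) ^ k) *\<^sub>R h ^ k)"
    proof (rule sum.cong[OF refl])
      fix i assume "i \<in> {..k}"
      then have "h ^ i * h ^ (k - i) = h ^ k" "(-1::real) ^ i * (-1) ^ (k - i) = (-1) ^ k"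
        by (simp_all flip: power_add)
      then have "f i * f (k - i) = (c i * c (k - i)) *\<^sub>R h ^ k"
        by (simp add: f_def mult.commute)
      also have "c i * c (k - i) =
          ((1/2::real) gchoose i) * (1/2 gchoose (k - i)) * ((-1) ^ i * (-1) ^ (k - i))"
        by (simp add: c_def algebra_simps)
      finally show "f i * f (k - i) =
          ((((1/2::real) gchoose i) * (1/2 gchoose (k - i))) * (-1) ^ k) *\<^sub>R h ^ k"
        using \<open>(-1::real) ^ i * (-1) ^ (k - i) = (-1) ^ k\<close> by simp
    qed
    also have "\<dots> = ((\<Sum>i\<le>k. ((1/2::real) gchoose i) * (1/2 gchoose (k - i))) * (-1) ^ k) *\<^sub>R h ^ k"
      by (simp add: scaleR_sum_left sum_distrib_right)
    also have "(\<Sum>i\<le>k. ((1/2::real) gchoose i) * (1/2 gchoose (k - i))) = (1/2 + 1/2) gchoose k"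
      using gbinomial_Vandermonde[of "1/2::real" "1/2" k] by (simp add: atMost_atLeast0)
    finally show ?thesis by simp
  qed
  ultimately have *: "(\<lambda>k. (((1::real) gchoose k) * (-1) ^ k) *\<^sub>R h ^ k) sums (s * s)"
    by simp
  have "(1::real) gchoose k = 0" if "k \<notin> {0, 1}" for k
    using binomial_gbinomial[of 1 k, where ?'a = real] that by (cases k; cases "k - 1") simp_all
  then have "(\<lambda>k. (((1::real) gchoose k) * (-1) ^ k) *\<^sub>R h ^ k) sums
      (\<Sum>k\<in>{0,1}. (((1::real) gchoose k) * (-1) ^ k) *\<^sub>R h ^ k)"
    by (intro sums_finite) auto
  with * have "s * s = (\<Sum>k\<in>{0,1}. (((1::real) gchoose k) * (-1) ^ k) *\<^sub>R h ^ k)"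
    by (rule sums_unique2)
  then have "s * s = 1 - h" by simp
  then show ?thesis using that sB ss comm by metis
qed

text \<open>
  A self-adjoint \<open>h\<close> of norm less than one is the real part of the unitary \<open>h + i sqrt (1 - h\<^sup>2)\<close>.
  A *-homomorphism sends this unitary to some \<open>w\<close> for which \<open>star w * w\<close> is the projection \<open>\<phi> 1\<close>, so
  that \<open>\<phi> h\<close>, the real part of \<open>w\<close>, has norm at most one. The C*-identity reduces the general case
  to this one.
\<close>

lemma star_hom_contractive:
  fixes \<phi> :: "'a::cstar_algebra \<Rightarrow> 'b::cstar_algebra"
  assumes B: "cstar_subalgebra B" and \<phi>: "star_hom_on B \<phi>" and a: "a \<in> B"
  shows "norm (\<phi> a) \<le> norm a"
proof -
  have add: "\<phi> (x + y) = \<phi> x + \<phi> y" and mult: "\<phi> (x * y) = \<phi> x * \<phi> y" if "x \<in> B" "y \<in> B" for x y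
    using \<phi> that by (auto simp: star_hom_on_def)
  have scal: "\<phi> (c *\<^sub>C x) = c *\<^sub>C \<phi> x" and st: "\<phi> (star x) = star (\<phi> x)" if "x \<in> B" for x c
    using \<phi> that by (auto simp: star_hom_on_def)
  have scalR: "\<phi> (r *\<^sub>R x) = r *\<^sub>R \<phi> x" if "x \<in> B" for x r
    using scal[OF that, of "complex_of_real r"] by (simp add: scaleC_of_real)
  note BD = cstar_subalgebraD[OF B]
  have "star (\<phi> 1) * \<phi> 1 = \<phi> 1" using st[OF BD(2)] mult[OF BD(2) BD(2)] by simp
  then have norm_unit: "norm (\<phi> 1) \<le> 1" using norm_projection[of "\<phi> 1"] by (cases "\<phi> 1 = 0") auto
  have one: "norm (\<phi> h) \<le> 1" if h: "h \<in> B" "star h = h" "norm h < 1" for h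
  proof -
    have "norm (h * h) \<le> norm h * norm h" by (rule norm_mult_ineq)
    also have "\<dots> < 1" using h(3) mult_strict_mono[of "norm h" 1 "norm h" 1] by simp
    finally have "norm (h * h) < 1" .
    moreover have "star (h * h) = h * h" using h(2) by (simp add: star_mult)
    ultimately obtain s where s: "s \<in> B" "star s = s" "s * s = 1 - h * h" "h * s = s * h"
      using sqrt_one_minus[OF B BD(4)[OF h(1) h(1)]] by (metis mult.assoc)
    define x y where "x = \<phi> h" and "y = \<phi> s"
    have xy: "star x = x" "star y = y" "x * y = y * x"
      using st[OF h(1)] st[OF s(1)] mult[OF h(1) s(1)] mult[OF s(1) h(1)] h(2) s(2,4)
      by (simp_all add: x_def y_def)
    have "\<phi> (s * s + h * h) = y * y + x * x"
      unfolding x_def y_def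
      by (subst add) (simp_all only: mult s(1) h(1) BD(4))
    then have sq: "x * x + y * y = \<phi> 1" using s(3) by (simp add: add.commute)
    define w where "w = x + \<i> *\<^sub>C y"
    have sw: "star w = x + (- \<i>) *\<^sub>C y" by (simp add: w_def star_add star_scaleC xy)
    have "star w * w = x * x + y * y"
      unfolding sw unfolding w_def
      by (simp add: ring_distribs mult_scaleC_left mult_scaleC_right scaleC_scaleC
          scaleC_add_right scaleC.diff_right xy(3) scaleC.minus_left)
    then have "(norm w)\<^sup>2 \<le> 1" using sq norm_unit cstar_identity[of w] by simp
    then have "norm w \<le> 1" by (simp add: power_le_one_iff)
    moreover have "2 *\<^sub>R x = w + star w"
      unfolding sw unfolding w_def by (simp add: scaleR_2 scaleC.minus_left)
    moreover have "norm (w + star w) \<le> norm w + norm w"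
      using norm_triangle_ineq[of w "star w"] by simp
    ultimately have "norm (2 *\<^sub>R x) \<le> 2" by simp
    then show ?thesis by (simp add: x_def)
  qed
  have sa: "norm (\<phi> h) \<le> norm h" if h: "h \<in> B" "star h = h" for h
  proof (rule dense_ge)
    fix r assume r: "norm h < r"
    then have "r > 0" using norm_ge_zero[of h] by linarith
    have "norm (\<phi> ((1 / r) *\<^sub>R h)) \<le> 1"
      using h r \<open>r > 0\<close> by (intro one BD) (auto simp: star_scaleR)
    then show "norm (\<phi> h) \<le> r" using \<open>r > 0\<close> h by (simp add: scalR field_simps)
  qed
  have "(norm (\<phi> a))\<^sup>2 = norm (\<phi> (star a * a))"
    by (simp add: mult st a BD cstar_identity)
  also have "\<dots> \<le> norm (star a * a)"
    by (intro sa BD a) (simp add: star_mult star_star)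
  also have "\<dots> = (norm a)\<^sup>2" by (rule cstar_identity)
  finally show ?thesis by simp
qed

text \<open>
  For a self-adjoint \<open>h\<close> of norm less than one, \<open>1 - h\<close> and \<open>1 + h\<close> are squares of self-adjoint
  elements, so a state maps \<open>h\<close> into \<open>[-1, 1]\<close>. Rotating \<open>\<omega> a\<close> onto the positive half-line reduces the
  general case to the self-adjoint part of \<open>a\<close>.
\<close>

lemma state_bounded:
  fixes \<omega> :: "'a::cstar_algebra \<Rightarrow> complex"
  assumes \<omega>: "state_on UNIV \<omega>"
  shows "cmod (\<omega> a) \<le> norm a"
proof -
  have add: "\<omega> (x + y) = \<omega> x + \<omega> y" and scal: "\<omega> (c *\<^sub>C x) = c * \<omega> x"
    and pos: "\<omega> (star x * x) \<in> \<real>\<^sub>\<ge>\<^sub>0" and unit: "\<omega> 1 = 1" for x y c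
    using \<omega> by (auto simp: state_on_def)
  have scalR: "\<omega> (r *\<^sub>R x) = of_real r * \<omega> x" for r x
    using scal[of "complex_of_real r" x] by (simp add: scaleC_of_real)
  have diff: "\<omega> (x - y) = \<omega> x - \<omega> y" for x y
    using add[of "x - y" y] by simp
  have one: "\<omega> h \<in> \<real> \<and> Re (\<omega> h) \<le> 1" if h: "star h = h" "norm h < 1" for h
  proof -
    obtain s where "star s = s" "s * s = 1 - h"
      using sqrt_one_minus[OF cstar_subalgebra_UNIV UNIV_I h] by metis
    then have "1 - \<omega> h \<in> \<real>\<^sub>\<ge>\<^sub>0" using pos[of s] by (simp add: diff unit)
    then show ?thesis by (auto simp: complex_nonneg_Reals_iff complex_is_Real_iff)
  qed
  have sa: "\<omega> h \<in> \<real> \<and> Re (\<omega> h) \<le> norm h" if h: "star h = h" for h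
  proof -
    have *: "\<omega> h \<in> \<real> \<and> Re (\<omega> h) \<le> r" if r: "norm h < r" for r
    proof -
      have "r > 0" using r norm_ge_zero[of h] by linarith
      have "\<omega> ((1 / r) *\<^sub>R h) \<in> \<real> \<and> Re (\<omega> ((1 / r) *\<^sub>R h)) \<le> 1"
        using h r \<open>r > 0\<close> by (intro one) (auto simp: star_scaleR)
      then show ?thesis using \<open>r > 0\<close> by (simp add: scalR complex_is_Real_iff field_simps)
    qed
    then show ?thesis using dense_ge gt_ex by metis
  qed
  obtain u where u: "cmod u = 1" "u * \<omega> a = of_real (cmod (\<omega> a))"
  proof (cases "\<omega> a = 0")
    case False
    show ?thesis
      by (rule that[of "cnj (\<omega> a) / of_real (cmod (\<omega> a))"])
        (use False complex_norm_square[of "\<omega> a"] in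
          \<open>simp_all add: norm_divide power2_eq_square field_simps\<close>)
  qed (use that[of 1] in simp)
  define b where "b = u *\<^sub>C a"
  have b: "\<omega> b = of_real (cmod (\<omega> a))" "norm b = norm a"
    by (simp_all add: b_def scal u norm_scaleC)
  have "Im (\<i> * (\<omega> b - \<omega> (star b))) = 0"
    using sa[of "\<i> *\<^sub>C (b - star b)"]
    by (simp add: star_scaleC star_diff star_star scal diff scaleC.minus_left scaleC.diff_right
        complex_is_Real_iff)
  then have "2 * cmod (\<omega> a) = Re (\<omega> (b + star b))" using b by (simp add: add)
  also have "Re (\<omega> (b + star b)) \<le> norm (b + star b)"
    using sa[of "b + star b"] by (simp add: star_add star_star add.commute)
  also have "\<dots> \<le> 2 * norm a" using norm_triangle_ineq[of b "star b"] b by simp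
  finally show ?thesis by simp
qed

section \<open>Extension by continuity\<close>

text \<open>
  The maps on the stages of an increasing chain fit together to a map on the union that is
  contractive, hence uniformly continuous, and so extends to the closure.
\<close>

lemma extend_from_chain:
  fixes f :: "nat \<Rightarrow> 'a::real_normed_vector \<Rightarrow> 'b::banach"
  assumes mono: "\<And>n. S n \<subseteq> S (Suc n)"
    and agree: "\<And>n x. x \<in> S n \<Longrightarrow> f (Suc n) x = f n x"
    and contr: "\<And>n x y. x \<in> S n \<Longrightarrow> y \<in> S n \<Longrightarrow> norm (f n x - f n y) \<le> norm (x - y)"
  obtains g where "continuous_on (closure (\<Union>n. S n)) g" "\<And>n x. x \<in> S n \<Longrightarrow> g x = f n x"
proof -
  have le: "S m \<subseteq> S n" if "m \<le> n" for m n
    using lift_Suc_mono_le[of S, OF mono that] .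
  have ext: "f n x = f m x" if "m \<le> n" "x \<in> S m" for m n x
    using that(1)
  proof (induction rule: dec_induct)
    case (step k)
    then show ?case using agree[of x k] le[of m k] that by auto
  qed simp
  define h where "h x = f (LEAST n. x \<in> S n) x" for x
  have h: "h x = f n x" if "x \<in> S n" for n x
    unfolding h_def
    using ext[OF Least_le[of "\<lambda>n. x \<in> S n", OF that] LeastI[of "\<lambda>n. x \<in> S n", OF that]] by simp
  have "dist (h x) (h y) \<le> dist x y" if xy: "x \<in> (\<Union>n. S n)" "y \<in> (\<Union>n. S n)" for x y
  proof -
    obtain m n where mn: "x \<in> S m" "y \<in> S n" using xy by blast
    then have "x \<in> S (max m n)" "y \<in> S (max m n)" using le[of m "max m n"] le[of n "max m n"] by auto
    then show ?thesis using contr h by (simp add: dist_norm)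
  qed
  then have "uniformly_continuous_on (\<Union>n. S n) h"
    unfolding uniformly_continuous_on_def by (meson dist_commute le_less_trans)
  then obtain g where "uniformly_continuous_on (closure (\<Union>n. S n)) g"
    "\<And>x. x \<in> (\<Union>n. S n) \<Longrightarrow> h x = g x"
    by (rule uniformly_continuous_on_extension_on_closure) blast
  then show ?thesis
    using that[of g] h uniformly_continuous_imp_continuous by (metis UN_I UNIV_I)
qed

lemma star_hom_on_closure:
  fixes g :: "'a::cstar_algebra \<Rightarrow> 'b::cstar_algebra"
  assumes cont: "continuous_on (closure D) g" and hom: "star_hom_on D g"
    and D: "\<And>a b. a \<in> D \<Longrightarrow> b \<in> D \<Longrightarrow> a + b \<in> D \<and> a * b \<in> D"
      "\<And>c a. a \<in> D \<Longrightarrow> c *\<^sub>C a \<in> D" "\<And>a. a \<in> D \<Longrightarrow> star a \<in> D"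
  shows "star_hom_on (closure D) g"
proof -
  have lim: "(\<lambda>k. g (x k)) \<longlonglongrightarrow> g l" if "\<And>k. x k \<in> D" "x \<longlonglongrightarrow> l" for x l
    using continuous_on_tendsto_compose[OF cont that(2)] that closure_subset closure_sequential
    by (metis (mono_tags, lifting) always_eventually subsetD)
  have two: "g (a + b) = g a + g b \<and> g (a * b) = g a * g b" if ab: "a \<in> closure D" "b \<in> closure D" for a b
  proof -
    obtain x y where x: "\<And>k. x k \<in> D" "x \<longlonglongrightarrow> a" and y: "\<And>k. y k \<in> D" "y \<longlonglongrightarrow> b"
      using ab unfolding closure_sequential by metis
    have "(\<lambda>k. g (x k + y k)) \<longlonglongrightarrow> g (a + b)" "(\<lambda>k. g (x k * y k)) \<longlonglongrightarrow> g (a * b)"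
      using x y D by (auto intro!: lim tendsto_add tendsto_mult)
    moreover have "(\<lambda>k. g (x k) + g (y k)) \<longlonglongrightarrow> g a + g b" "(\<lambda>k. g (x k) * g (y k)) \<longlonglongrightarrow> g a * g b"
      using x y by (auto intro!: lim tendsto_add tendsto_mult)
    moreover have "g (x k + y k) = g (x k) + g (y k)" "g (x k * y k) = g (x k) * g (y k)" for k
      using hom x y by (auto simp: star_hom_on_def)
    ultimately show ?thesis by (auto dest: LIMSEQ_unique)
  qed
  have one: "g (c *\<^sub>C a) = c *\<^sub>C g a \<and> g (star a) = star (g a)" if a: "a \<in> closure D" for a c
  proof -
    obtain x where x: "\<And>k. x k \<in> D" "x \<longlonglongrightarrow> a" using a unfolding closure_sequential by metis
    have "(\<lambda>k. g (c *\<^sub>C x k)) \<longlonglongrightarrow> g (c *\<^sub>C a)" "(\<lambda>k. g (star (x k))) \<longlonglongrightarrow> g (star a)"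
      using x D by (auto intro!: lim scaleC.tendsto tendsto_star)
    moreover have "(\<lambda>k. c *\<^sub>C g (x k)) \<longlonglongrightarrow> c *\<^sub>C g a" "(\<lambda>k. star (g (x k))) \<longlonglongrightarrow> star (g a)"
      using x by (auto intro!: lim scaleC.tendsto tendsto_star)
    moreover have "g (c *\<^sub>C x k) = c *\<^sub>C g (x k)" "g (star (x k)) = star (g (x k))" for k
      using hom x by (auto simp: star_hom_on_def)
    ultimately show ?thesis by (auto dest: LIMSEQ_unique)
  qed
  show ?thesis using one two by (auto simp: star_hom_on_def)
qed

lemma continuous_eq_on_dense:
  fixes f g :: "'a::topological_space \<Rightarrow> 'b::t2_space"
  assumes "closure D = UNIV" "continuous_on UNIV f" "continuous_on UNIV g" "\<And>x. x \<in> D \<Longrightarrow> f x = g x"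
  shows "f = g"
proof -
  have "closure D \<subseteq> {x. f x = g x}"
    by (rule closure_minimal) (use assms(4) closed_Collect_eq[OF assms(2,3)] in auto)
  then show ?thesis using assms(1) by auto
qed

lemma contraction_continuous_on:
  fixes f :: "'a::real_normed_vector \<Rightarrow> 'b::real_normed_vector"
  assumes "\<And>x y. x \<in> S \<Longrightarrow> y \<in> S \<Longrightarrow> norm (f x - f y) \<le> norm (x - y)"
  shows "continuous_on S f"
  unfolding continuous_on_iff dist_norm using assms by (meson le_less_trans)

lemma star_hom_diff:
  assumes "cstar_subalgebra B" "star_hom_on B \<phi>" "x \<in> B" "y \<in> B"
  shows "\<phi> (x - y) = \<phi> x - \<phi> y"
proof -
  have "\<phi> (x - y + y) = \<phi> (x - y) + \<phi> y"
    using assms cstar_subalgebraD(8)[OF assms(1,3,4)] unfolding star_hom_on_def by blast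
  then show ?thesis by simp
qed

lemma star_hom_continuous_on:
  assumes "cstar_subalgebra B" "star_hom_on B \<phi>"
  shows "continuous_on B \<phi>"
  by (rule contraction_continuous_on)
    (metis assms cstar_subalgebraD(8) star_hom_contractive star_hom_diff)

section \<open>Elementary properties of states\<close>

lemma sum_nonneg_Reals: "(\<And>i. i \<in> I \<Longrightarrow> f i \<in> \<real>\<^sub>\<ge>\<^sub>0) \<Longrightarrow> sum f I \<in> (\<real>\<^sub>\<ge>\<^sub>0 :: complex set)"
  by (induction I rule: infinite_finite_induct) (auto intro: nonneg_Reals_add_I)

lemma state_add: "state_on UNIV \<omega> \<Longrightarrow> \<omega> (a + b) = \<omega> a + \<omega> b"
  and state_scaleC: "state_on UNIV \<omega> \<Longrightarrow> \<omega> (c *\<^sub>C a) = c * \<omega> a"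
  and state_positive: "state_on UNIV \<omega> \<Longrightarrow> \<omega> (star a * a) \<in> \<real>\<^sub>\<ge>\<^sub>0"
  and state_one: "state_on UNIV \<omega> \<Longrightarrow> \<omega> 1 = 1"
  by (auto simp: state_on_def)

lemma state_diff: "state_on UNIV \<omega> \<Longrightarrow> \<omega> (a - b) = \<omega> a - \<omega> b"
  using state_add[of \<omega> "a - b" b] by simp

lemma state_zero: "state_on UNIV \<omega> \<Longrightarrow> \<omega> 0 = 0"
  using state_diff[of \<omega> 0 0] by simp

lemma state_sum: "state_on UNIV \<omega> \<Longrightarrow> \<omega> (sum f I) = (\<Sum>i\<in>I. \<omega> (f i))"
  by (induction I rule: infinite_finite_induct) (simp_all add: state_zero state_add)

lemma state_continuous: "state_on UNIV \<omega> \<Longrightarrow> continuous_on S \<omega>"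
  by (rule contraction_continuous_on) (metis state_bounded state_diff)

section \<open>Finite systems of matrix units\<close>

lemma complex_line_closed: "closed (range (\<lambda>c. c *\<^sub>C (e::'a::cstar_algebra)))"
proof (cases "e = 0")
  case False
  have "complete (range (\<lambda>c. c *\<^sub>C e))"
    by (rule complete_isometric_image[where e = "norm e"])
      (use False in \<open>auto simp: norm_scaleC intro: scaleC.bounded_linear_left\<close>)
  then show ?thesis by (rule complete_imp_closed)
qed simp

text \<open>
  The matrix units of a finite-dimensional C*-algebra with one full matrix block for every value of
  \<open>r\<close>: two indices label a matrix unit iff they have the same value under \<open>r\<close>.
\<close>

locale matrix_units =
  fixes P :: "'p set" and r :: "'p \<Rightarrow> 'q" and E :: "'p \<Rightarrow> 'p \<Rightarrow> 'a::cstar_algebra"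
  assumes finite_P: "finite P"
    and mult_E: "\<lbrakk>\<mu> \<in> P; \<mu>' \<in> P; r \<mu> = r \<mu>'; \<nu> \<in> P; \<nu>' \<in> P; r \<nu> = r \<nu>'\<rbrakk> \<Longrightarrow>
      E \<mu> \<mu>' * E \<nu> \<nu>' = (if \<mu>' = \<nu> then E \<mu> \<nu>' else 0)"
    and star_E: "\<lbrakk>\<mu> \<in> P; \<mu>' \<in> P; r \<mu> = r \<mu>'\<rbrakk> \<Longrightarrow> star (E \<mu> \<mu>') = E \<mu>' \<mu>"
    and sum_E: "(\<Sum>\<mu>\<in>P. E \<mu> \<mu>) = 1"
    and nonzero_E: "\<mu> \<in> P \<Longrightarrow> E \<mu> \<mu> \<noteq> 0"
begin

lemma norm_E:
  assumes "\<mu> \<in> P" "\<mu>' \<in> P" "r \<mu> = r \<mu>'"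
  shows "norm (E \<mu> \<mu>') = 1"
proof -
  have "norm (E \<mu>' \<mu>') = 1"
    by (rule norm_projection) (use assms in \<open>simp_all add: star_E mult_E nonzero_E\<close>)
  moreover have "star (E \<mu> \<mu>') * E \<mu> \<mu>' = E \<mu>' \<mu>'" using assms by (simp add: star_E mult_E)
  ultimately have "(norm (E \<mu> \<mu>'))\<^sup>2 = 1" using cstar_identity[of "E \<mu> \<mu>'"] by simp
  then show ?thesis using norm_ge_zero[of "E \<mu> \<mu>'"] by (auto simp: power2_eq_1_iff)
qed

text \<open>
  The span of the matrix units is described by its corners rather than by linear combinations,
  because in this form it is visibly closed.
\<close>

definition line :: "'p \<Rightarrow> 'p \<Rightarrow> 'a set" where
  "line \<mu> \<mu>' = (if r \<mu> = r \<mu>' then range (\<lambda>c. c *\<^sub>C E \<mu> \<mu>') else {0})"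

definition alg :: "'a set" where
  "alg = {x. \<forall>\<mu>\<in>P. \<forall>\<mu>'\<in>P. E \<mu> \<mu> * x * E \<mu>' \<mu>' \<in> line \<mu> \<mu>'}"

definition coef :: "'a \<Rightarrow> 'p \<Rightarrow> 'p \<Rightarrow> complex" where
  "coef x \<mu> \<mu>' =
     (if r \<mu> = r \<mu>' then THE c. E \<mu> \<mu> * x * E \<mu>' \<mu>' = c *\<^sub>C E \<mu> \<mu>' else 0)"

lemma coefI:
  assumes "\<mu> \<in> P" "\<mu>' \<in> P" "r \<mu> = r \<mu>'" "E \<mu> \<mu> * x * E \<mu>' \<mu>' = c *\<^sub>C E \<mu> \<mu>'"
  shows "coef x \<mu> \<mu>' = c"
proof -
  have "d = c" if "d *\<^sub>C E \<mu> \<mu>' = c *\<^sub>C E \<mu> \<mu>'" for d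
  proof -
    have "norm ((d - c) *\<^sub>C E \<mu> \<mu>') = 0" using that by (simp add: scaleC.diff_left)
    then have "cmod (d - c) * norm (E \<mu> \<mu>') = 0" by (simp only: norm_scaleC)
    then show ?thesis by (simp add: norm_E[OF assms(1-3)])
  qed
  then show ?thesis unfolding coef_def using assms by (auto intro: the_equality)
qed

lemma coef_unrelated: "r \<mu> \<noteq> r \<mu>' \<Longrightarrow> coef x \<mu> \<mu>' = 0"
  by (simp add: coef_def)

lemma corner_eq:
  assumes "x \<in> alg" "\<mu> \<in> P" "\<mu>' \<in> P"
  shows "E \<mu> \<mu> * x * E \<mu>' \<mu>' = coef x \<mu> \<mu>' *\<^sub>C E \<mu> \<mu>'"
proof (cases "r \<mu> = r \<mu>'")
  case True
  have "E \<mu> \<mu> * x * E \<mu>' \<mu>' \<in> line \<mu> \<mu>'" using assms by (simp add: alg_def)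
  with True obtain c where c: "E \<mu> \<mu> * x * E \<mu>' \<mu>' = c *\<^sub>C E \<mu> \<mu>'"
    unfolding line_def by auto
  then show ?thesis using coefI[OF assms(2,3) True c] by simp
next
  case False
  have "E \<mu> \<mu> * x * E \<mu>' \<mu>' \<in> line \<mu> \<mu>'" using assms by (simp add: alg_def)
  with False show ?thesis by (simp add: line_def coef_unrelated)
qed

lemma algI:
  assumes "\<And>\<mu> \<mu>'. \<mu> \<in> P \<Longrightarrow> \<mu>' \<in> P \<Longrightarrow> r \<mu> = r \<mu>' \<Longrightarrow> \<exists>c. E \<mu> \<mu> * x * E \<mu>' \<mu>' = c *\<^sub>C E \<mu> \<mu>'"
    and "\<And>\<mu> \<mu>'. \<mu> \<in> P \<Longrightarrow> \<mu>' \<in> P \<Longrightarrow> r \<mu> \<noteq> r \<mu>' \<Longrightarrow> E \<mu> \<mu> * x * E \<mu>' \<mu>' = 0"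
  shows "x \<in> alg"
  using assms by (auto simp: alg_def line_def image_iff)

lemma corners_sum: "x = (\<Sum>\<mu>\<in>P. \<Sum>\<mu>'\<in>P. E \<mu> \<mu> * x * E \<mu>' \<mu>')"
proof -
  have "x = (\<Sum>\<mu>\<in>P. E \<mu> \<mu>) * x * (\<Sum>\<mu>'\<in>P. E \<mu>' \<mu>')" by (simp add: sum_E)
  then show ?thesis unfolding sum_distrib_right unfolding sum_distrib_left .
qed

lemma expansion: "x \<in> alg \<Longrightarrow> x = (\<Sum>\<mu>\<in>P. \<Sum>\<mu>'\<in>P. coef x \<mu> \<mu>' *\<^sub>C E \<mu> \<mu>')"
  using corners_sum[of x] by (simp add: corner_eq)

lemma alg_eqI:
  assumes "x \<in> alg" "y \<in> alg"
    and "\<And>\<mu> \<mu>'. \<mu> \<in> P \<Longrightarrow> \<mu>' \<in> P \<Longrightarrow> r \<mu> = r \<mu>' \<Longrightarrow> coef x \<mu> \<mu>' = coef y \<mu> \<mu>'"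
  shows "x = y"
proof -
  have "coef x \<mu> \<mu>' = coef y \<mu> \<mu>'" if "\<mu> \<in> P" "\<mu>' \<in> P" for \<mu> \<mu>'
    using assms(3) that by (cases "r \<mu> = r \<mu>'") (auto simp: coef_unrelated)
  then show ?thesis
    by (subst expansion[OF assms(1)], subst expansion[OF assms(2)]) simp
qed

lemma norm_coef_le:
  assumes "x \<in> alg" "\<mu> \<in> P" "\<mu>' \<in> P"
  shows "cmod (coef x \<mu> \<mu>') \<le> norm x"
proof (cases "r \<mu> = r \<mu>'")
  case True
  have "cmod (coef x \<mu> \<mu>') = norm (E \<mu> \<mu> * x * E \<mu>' \<mu>')"
    using corner_eq[OF assms] norm_E[OF assms(2,3) True] by (simp add: norm_scaleC)
  also have "\<dots> \<le> norm (E \<mu> \<mu>) * norm x * norm (E \<mu>' \<mu>')"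
    by (meson norm_mult_ineq mult_right_mono norm_ge_zero order_trans)
  finally show ?thesis using assms by (simp add: norm_E)
qed (simp add: coef_unrelated)

lemma corner_E:
  assumes "\<nu> \<in> P" "\<nu>' \<in> P" "r \<nu> = r \<nu>'" "\<mu> \<in> P" "\<mu>' \<in> P"
  shows "E \<mu> \<mu> * E \<nu> \<nu>' * E \<mu>' \<mu>' = (if \<mu> = \<nu> \<and> \<mu>' = \<nu>' then E \<nu> \<nu>' else 0)"
  using assms by (auto simp: mult_E)

lemma E_in_alg:
  assumes "\<nu> \<in> P" "\<nu>' \<in> P" "r \<nu> = r \<nu>'"
  shows "E \<nu> \<nu>' \<in> alg"
proof (rule algI)
  fix \<mu> \<mu>' assume "\<mu> \<in> P" "\<mu>' \<in> P" "r \<mu> = r \<mu>'"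
  then show "\<exists>c. E \<mu> \<mu> * E \<nu> \<nu>' * E \<mu>' \<mu>' = c *\<^sub>C E \<mu> \<mu>'"
    using corner_E[OF assms] scaleC_one scaleC.zero_left by metis
next
  fix \<mu> \<mu>' assume "\<mu> \<in> P" "\<mu>' \<in> P" "r \<mu> \<noteq> r \<mu>'"
  then show "E \<mu> \<mu> * E \<nu> \<nu>' * E \<mu>' \<mu>' = 0"
    using corner_E[OF assms] assms(3) by auto
qed

lemma coef_E:
  assumes "\<nu> \<in> P" "\<nu>' \<in> P" "r \<nu> = r \<nu>'" "\<mu> \<in> P" "\<mu>' \<in> P"
  shows "coef (E \<nu> \<nu>') \<mu> \<mu>' = (if \<mu> = \<nu> \<and> \<mu>' = \<nu>' then 1 else 0)"
proof (cases "r \<mu> = r \<mu>'")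
  case True
  show ?thesis
    by (rule coefI) (use assms True in \<open>simp_all add: corner_E scaleC.zero_left\<close>)
qed (use assms in \<open>auto simp: coef_unrelated\<close>)

lemma
  assumes "x \<in> alg" "y \<in> alg"
  shows add_in_alg: "x + y \<in> alg"
    and coef_add: "\<mu> \<in> P \<Longrightarrow> \<mu>' \<in> P \<Longrightarrow> coef (x + y) \<mu> \<mu>' = coef x \<mu> \<mu>' + coef y \<mu> \<mu>'"
proof -
  have *: "E \<mu> \<mu> * (x + y) * E \<mu>' \<mu>' = (coef x \<mu> \<mu>' + coef y \<mu> \<mu>') *\<^sub>C E \<mu> \<mu>'"
    if "\<mu> \<in> P" "\<mu>' \<in> P" for \<mu> \<mu>'
    using corner_eq[OF assms(1) that] corner_eq[OF assms(2) that]
    by (simp add: ring_distribs scaleC_add_left)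
  show "x + y \<in> alg" by (rule algI) (auto simp: * coef_unrelated scaleC.zero_left)
  show "coef (x + y) \<mu> \<mu>' = coef x \<mu> \<mu>' + coef y \<mu> \<mu>'" if "\<mu> \<in> P" "\<mu>' \<in> P"
    using coefI[OF that _ *[OF that]] coef_unrelated by (cases "r \<mu> = r \<mu>'") auto
qed

lemma
  assumes "x \<in> alg"
  shows scaleC_in_alg: "c *\<^sub>C x \<in> alg"
    and coef_scaleC: "\<mu> \<in> P \<Longrightarrow> \<mu>' \<in> P \<Longrightarrow> coef (c *\<^sub>C x) \<mu> \<mu>' = c * coef x \<mu> \<mu>'"
proof -
  have *: "E \<mu> \<mu> * (c *\<^sub>C x) * E \<mu>' \<mu>' = (c * coef x \<mu> \<mu>') *\<^sub>C E \<mu> \<mu>'"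
    if "\<mu> \<in> P" "\<mu>' \<in> P" for \<mu> \<mu>'
    using corner_eq[OF assms(1) that]
    by (simp add: mult_scaleC_left mult_scaleC_right)
  show "c *\<^sub>C x \<in> alg" by (rule algI) (auto simp: * coef_unrelated scaleC.zero_left)
  show "coef (c *\<^sub>C x) \<mu> \<mu>' = c * coef x \<mu> \<mu>'" if "\<mu> \<in> P" "\<mu>' \<in> P"
    using coefI[OF that _ *[OF that]] coef_unrelated by (cases "r \<mu> = r \<mu>'") auto
qed

lemma
  assumes "x \<in> alg"
  shows star_in_alg: "star x \<in> alg"
    and coef_star: "\<mu> \<in> P \<Longrightarrow> \<mu>' \<in> P \<Longrightarrow> coef (star x) \<mu> \<mu>' = cnj (coef x \<mu>' \<mu>)"
proof -
  have *: "E \<mu> \<mu> * star x * E \<mu>' \<mu>' = cnj (coef x \<mu>' \<mu>) *\<^sub>C star (E \<mu>' \<mu>)"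
    if "\<mu> \<in> P" "\<mu>' \<in> P" for \<mu> \<mu>'
    using arg_cong[OF corner_eq[OF assms that(2,1)], of star] that
    by (simp add: star_scaleC star_mult star_E mult.assoc)
  have **: "E \<mu> \<mu> * star x * E \<mu>' \<mu>' = cnj (coef x \<mu>' \<mu>) *\<^sub>C E \<mu> \<mu>'"
    if "\<mu> \<in> P" "\<mu>' \<in> P" for \<mu> \<mu>'
    using *[OF that] that by (cases "r \<mu> = r \<mu>'") (auto simp: star_E coef_unrelated scaleC.zero_left)
  show "star x \<in> alg" by (rule algI) (auto simp: ** coef_unrelated scaleC.zero_left)
  show "coef (star x) \<mu> \<mu>' = cnj (coef x \<mu>' \<mu>)" if "\<mu> \<in> P" "\<mu>' \<in> P"
    using coefI[OF that _ **[OF that]] coef_unrelated by (cases "r \<mu> = r \<mu>'") auto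
qed

lemma
  assumes "x \<in> alg" "y \<in> alg"
  shows mult_in_alg: "x * y \<in> alg"
    and coef_mult:
      "\<mu> \<in> P \<Longrightarrow> \<mu>' \<in> P \<Longrightarrow> coef (x * y) \<mu> \<mu>' = (\<Sum>\<nu>\<in>P. coef x \<mu> \<nu> * coef y \<nu> \<mu>')"
proof -
  have *: "E \<mu> \<mu> * (x * y) * E \<mu>' \<mu>' = (\<Sum>\<nu>\<in>P. coef x \<mu> \<nu> * coef y \<nu> \<mu>') *\<^sub>C E \<mu> \<mu>'"
    if \<mu>: "\<mu> \<in> P" "\<mu>' \<in> P" for \<mu> \<mu>'
  proof -
    have "E \<mu> \<mu> * (x * y) * E \<mu>' \<mu>' = E \<mu> \<mu> * x * (\<Sum>\<nu>\<in>P. E \<nu> \<nu> * E \<nu> \<nu>) * y * E \<mu>' \<mu>'"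
      by (simp add: mult_E sum_E mult.assoc)
    also have "\<dots> = (\<Sum>\<nu>\<in>P. (E \<mu> \<mu> * x * E \<nu> \<nu>) * (E \<nu> \<nu> * y * E \<mu>' \<mu>'))"
      by (simp add: sum_distrib_left sum_distrib_right mult.assoc)
    also have "\<dots> = (\<Sum>\<nu>\<in>P. (coef x \<mu> \<nu> * coef y \<nu> \<mu>') *\<^sub>C E \<mu> \<mu>')"
    proof (rule sum.cong[OF refl])
      fix \<nu> assume \<nu>: "\<nu> \<in> P"
      show "E \<mu> \<mu> * x * E \<nu> \<nu> * (E \<nu> \<nu> * y * E \<mu>' \<mu>') = (coef x \<mu> \<nu> * coef y \<nu> \<mu>') *\<^sub>C E \<mu> \<mu>'"
      proof (cases "r \<mu> = r \<nu> \<and> r \<nu> = r \<mu>'")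
        case True
        then show ?thesis
          using \<mu> \<nu> by (simp add: corner_eq[OF assms(1)] corner_eq[OF assms(2)] mult_scaleC_left
              mult_scaleC_right scaleC_scaleC mult_E mult.commute)
      qed (use \<mu> \<nu> in \<open>auto simp: corner_eq[OF assms(1)] corner_eq[OF assms(2)] coef_unrelated
          scaleC.zero_left\<close>)
    qed
    finally show ?thesis by (simp add: scaleC.sum_left)
  qed
  have 0: "(\<Sum>\<nu>\<in>P. coef x \<mu> \<nu> * coef y \<nu> \<mu>') = 0" if "r \<mu> \<noteq> r \<mu>'" for \<mu> \<mu>'
  proof (rule sum.neutral, rule ballI)
    show "coef x \<mu> \<nu> * coef y \<nu> \<mu>' = 0" for \<nu>
      using that coef_unrelated[of \<mu> \<nu> x] coef_unrelated[of \<nu> \<mu>' y] by (cases "r \<mu> = r \<nu>") auto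
  qed
  show "x * y \<in> alg" by (rule algI) (auto simp: * 0 scaleC.zero_left)
  show "coef (x * y) \<mu> \<mu>' = (\<Sum>\<nu>\<in>P. coef x \<mu> \<nu> * coef y \<nu> \<mu>')" if "\<mu> \<in> P" "\<mu>' \<in> P"
    using coefI[OF that _ *[OF that]] coef_unrelated 0 by (cases "r \<mu> = r \<mu>'") auto
qed

lemma zero_in_alg: "0 \<in> alg"
  by (rule algI) (auto intro: exI[of _ 0] simp: scaleC.zero_left)

lemma sum_in_alg: "(\<And>i. i \<in> I \<Longrightarrow> f i \<in> alg) \<Longrightarrow> sum f I \<in> alg"
  by (induction I rule: infinite_finite_induct) (auto intro: add_in_alg zero_in_alg)

lemma closed_alg: "closed alg"
proof -
  have "closed {x. E \<mu> \<mu> * x * E \<mu>' \<mu>' \<in> line \<mu> \<mu>'}" for \<mu> \<mu>'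
  proof -
    have "closed ((\<lambda>x. E \<mu> \<mu> * x * E \<mu>' \<mu>') -` line \<mu> \<mu>')"
      by (intro closed_vimage) (auto simp: line_def complex_line_closed intro!: continuous_intros)
    then show ?thesis by (simp add: vimage_def)
  qed
  then have "closed (\<Inter>\<mu>\<in>P. \<Inter>\<mu>'\<in>P. {x. E \<mu> \<mu> * x * E \<mu>' \<mu>' \<in> line \<mu> \<mu>'})"
    by (intro closed_INT ballI)
  moreover have "(\<Inter>\<mu>\<in>P. \<Inter>\<mu>'\<in>P. {x. E \<mu> \<mu> * x * E \<mu>' \<mu>' \<in> line \<mu> \<mu>'}) = alg"
    by (auto simp: alg_def)
  ultimately show ?thesis by simp
qed

lemma one_in_alg: "1 \<in> alg"
  unfolding sum_E[symmetric] by (intro sum_in_alg E_in_alg) auto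

lemma coef_one: "\<mu> \<in> P \<Longrightarrow> \<mu>' \<in> P \<Longrightarrow> coef 1 \<mu> \<mu>' = (if \<mu> = \<mu>' then 1 else 0)"
proof (cases "r \<mu> = r \<mu>'")
  case True
  assume "\<mu> \<in> P" "\<mu>' \<in> P"
  with True show ?thesis by (intro coefI) (auto simp: mult_E scaleC.zero_left)
qed (auto simp: coef_unrelated)

lemma cstar_subalgebra_alg: "cstar_subalgebra alg"
  by (auto simp: cstar_subalgebra_def closed_alg one_in_alg add_in_alg mult_in_alg scaleC_in_alg
      star_in_alg)

lemma
  assumes "\<And>\<mu> \<mu>'. \<mu> \<in> P \<Longrightarrow> \<mu>' \<in> P \<Longrightarrow> r \<mu> \<noteq> r \<mu>' \<Longrightarrow> c \<mu> \<mu>' = 0"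
  shows combination_in_alg: "(\<Sum>\<mu>\<in>P. \<Sum>\<mu>'\<in>P. c \<mu> \<mu>' *\<^sub>C E \<mu> \<mu>') \<in> alg"
    and coef_combination: "\<nu> \<in> P \<Longrightarrow> \<nu>' \<in> P \<Longrightarrow>
      coef (\<Sum>\<mu>\<in>P. \<Sum>\<mu>'\<in>P. c \<mu> \<mu>' *\<^sub>C E \<mu> \<mu>') \<nu> \<nu>' = c \<nu> \<nu>'"
proof -
  define x where "x = (\<Sum>\<mu>\<in>P. \<Sum>\<mu>'\<in>P. c \<mu> \<mu>' *\<^sub>C E \<mu> \<mu>')"
  have summand: "c \<mu> \<mu>' *\<^sub>C E \<mu> \<mu>' \<in> alg" if "\<mu> \<in> P" "\<mu>' \<in> P" for \<mu> \<mu>'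
  proof (cases "r \<mu> = r \<mu>'")
    case True
    then show ?thesis using that by (intro scaleC_in_alg E_in_alg)
  qed (use that assms[OF that] zero_in_alg in simp)
  show alg: "(\<Sum>\<mu>\<in>P. \<Sum>\<mu>'\<in>P. c \<mu> \<mu>' *\<^sub>C E \<mu> \<mu>') \<in> alg"
    by (intro sum_in_alg summand)
  assume \<nu>: "\<nu> \<in> P" "\<nu>' \<in> P"
  show "coef (\<Sum>\<mu>\<in>P. \<Sum>\<mu>'\<in>P. c \<mu> \<mu>' *\<^sub>C E \<mu> \<mu>') \<nu> \<nu>' = c \<nu> \<nu>'"
  proof (cases "r \<nu> = r \<nu>'")
    case True
    have "E \<nu> \<nu> * x * E \<nu>' \<nu>' = (\<Sum>\<mu>\<in>P. \<Sum>\<mu>'\<in>P. c \<mu> \<mu>' *\<^sub>C (E \<nu> \<nu> * E \<mu> \<mu>' * E \<nu>' \<nu>'))"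
      by (simp add: x_def sum_distrib_left sum_distrib_right mult_scaleC_left mult_scaleC_right)
    also have "\<dots> = (\<Sum>\<mu>\<in>P. \<Sum>\<mu>'\<in>P. if \<mu> = \<nu> \<and> \<mu>' = \<nu>' then c \<nu> \<nu>' *\<^sub>C E \<nu> \<nu>' else 0)"
    proof (intro sum.cong refl)
      fix \<mu> \<mu>' assume \<mu>: "\<mu> \<in> P" "\<mu>' \<in> P"
      show "c \<mu> \<mu>' *\<^sub>C (E \<nu> \<nu> * E \<mu> \<mu>' * E \<nu>' \<nu>') =
          (if \<mu> = \<nu> \<and> \<mu>' = \<nu>' then c \<nu> \<nu>' *\<^sub>C E \<nu> \<nu>' else 0)"
        using \<mu> \<nu> assms[OF \<mu>] True
        by (cases "r \<mu> = r \<mu>'") (auto simp: corner_E scaleC.zero_left scaleC.zero_right)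
    qed
    also have "\<dots> = (\<Sum>\<mu>\<in>P. if \<mu> = \<nu> then c \<nu> \<nu>' *\<^sub>C E \<nu> \<nu>' else 0)"
      using \<nu> finite_P by (intro sum.cong) (auto simp: sum.delta)
    also have "\<dots> = c \<nu> \<nu>' *\<^sub>C E \<nu> \<nu>'" using \<nu> finite_P by (simp add: sum.delta)
    finally show ?thesis unfolding x_def by (intro coefI \<nu> True)
  qed (use assms \<nu> in \<open>auto simp: coef_unrelated\<close>)
qed

lemma cspan_eq_alg: "cspan ((\<lambda>(\<mu>, \<mu>'). E \<mu> \<mu>') ` {(\<mu>, \<mu>'). \<mu> \<in> P \<and> \<mu>' \<in> P \<and> r \<mu> = r \<mu>'}) = alg"
  (is "cspan ?S = _")
proof
  show "cspan ?S \<subseteq> alg"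
    by (rule complex_vector.span_minimal)
      (auto simp: complex_vector.subspace_def E_in_alg zero_in_alg add_in_alg scaleC_in_alg)
  show "alg \<subseteq> cspan ?S"
  proof
    fix x assume x: "x \<in> alg"
    have "coef x \<mu> \<mu>' *\<^sub>C E \<mu> \<mu>' \<in> cspan ?S" if "\<mu> \<in> P" "\<mu>' \<in> P" for \<mu> \<mu>'
    proof (cases "r \<mu> = r \<mu>'")
      case True
      then show ?thesis
        using that by (intro complex_vector.span_scale complex_vector.span_base) auto
    qed (simp add: coef_unrelated scaleC.zero_left complex_vector.span_zero)
    then have "(\<Sum>\<mu>\<in>P. \<Sum>\<mu>'\<in>P. coef x \<mu> \<mu>' *\<^sub>C E \<mu> \<mu>') \<in> cspan ?S"
      by (intro complex_vector.span_sum)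
    then show "x \<in> cspan ?S" using expansion[OF x] by simp
  qed
qed

lemma linear_expansion:
  assumes add: "\<And>a b. a \<in> alg \<Longrightarrow> b \<in> alg \<Longrightarrow> f (a + b) = f a + f b"
    and scal: "\<And>c a. a \<in> alg \<Longrightarrow> f (c *\<^sub>C a) = c * f a"
    and x: "x \<in> alg"
  shows "f x = (\<Sum>\<mu>\<in>P. \<Sum>\<mu>'\<in>P. coef x \<mu> \<mu>' * f (E \<mu> \<mu>'))"
proof -
  have f0: "f 0 = 0" using scal[OF zero_in_alg, of 0] by (simp add: scaleC.zero_left)
  have fsum: "f (sum g I) = (\<Sum>i\<in>I. f (g i))" if "\<And>i. i \<in> I \<Longrightarrow> g i \<in> alg" for g and I :: "'p set"
    using that by (induction I rule: infinite_finite_induct) (auto simp: add f0 sum_in_alg)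
  have summand: "coef x \<mu> \<mu>' *\<^sub>C E \<mu> \<mu>' \<in> alg \<and> f (coef x \<mu> \<mu>' *\<^sub>C E \<mu> \<mu>') = coef x \<mu> \<mu>' * f (E \<mu> \<mu>')"
    if "\<mu> \<in> P" "\<mu>' \<in> P" for \<mu> \<mu>'
    using that by (cases "r \<mu> = r \<mu>'")
      (auto simp: scal E_in_alg scaleC_in_alg coef_unrelated scaleC.zero_left f0 zero_in_alg)
  have "f x = f (\<Sum>\<mu>\<in>P. \<Sum>\<mu>'\<in>P. coef x \<mu> \<mu>' *\<^sub>C E \<mu> \<mu>')" using expansion[OF x] by simp
  also have "\<dots> = (\<Sum>\<mu>\<in>P. \<Sum>\<mu>'\<in>P. coef x \<mu> \<mu>' * f (E \<mu> \<mu>'))"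
    using summand by (simp add: fsum sum_in_alg)
  finally show ?thesis .
qed

lemma alg_induct [consumes 1, case_names unit add scale]:
  assumes x: "x \<in> alg"
    and unit: "\<And>\<mu> \<mu>'. \<mu> \<in> P \<Longrightarrow> \<mu>' \<in> P \<Longrightarrow> r \<mu> = r \<mu>' \<Longrightarrow> Q (E \<mu> \<mu>')"
    and add: "\<And>x y. x \<in> alg \<Longrightarrow> y \<in> alg \<Longrightarrow> Q x \<Longrightarrow> Q y \<Longrightarrow> Q (x + y)"
    and scale: "\<And>c x. x \<in> alg \<Longrightarrow> Q x \<Longrightarrow> Q (c *\<^sub>C x)"
  shows "Q x"
proof -
  have "P \<noteq> {}" using sum_E by auto
  then obtain \<mu> where "\<mu> \<in> P" by blast
  then have "Q (0 *\<^sub>C E \<mu> \<mu>)" by (intro scale unit E_in_alg) auto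
  then have 0: "Q 0" by simp
  let ?S = "(\<lambda>(\<mu>, \<mu>'). E \<mu> \<mu>') ` {(\<mu>, \<mu>'). \<mu> \<in> P \<and> \<mu>' \<in> P \<and> r \<mu> = r \<mu>'}"
  have "cspan ?S \<subseteq> {x \<in> alg. Q x}"
    by (rule complex_vector.span_minimal)
      (auto simp: complex_vector.subspace_def E_in_alg zero_in_alg add_in_alg scaleC_in_alg 0
        intro: unit add scale)
  then show ?thesis using x cspan_eq_alg by auto
qed

lemma hom_on_algI:
  fixes f :: "'a \<Rightarrow> 'b::cstar_algebra"
  assumes "\<And>x y. x \<in> alg \<Longrightarrow> y \<in> alg \<Longrightarrow> f (x + y) = f x + f y"
    and "\<And>x y. x \<in> alg \<Longrightarrow> y \<in> alg \<Longrightarrow> g (x + y) = g x + g y"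
    and "\<And>c x. x \<in> alg \<Longrightarrow> f (c *\<^sub>C x) = c *\<^sub>C f x"
    and "\<And>c x. x \<in> alg \<Longrightarrow> g (c *\<^sub>C x) = c *\<^sub>C g x"
    and "\<And>\<mu> \<mu>'. \<mu> \<in> P \<Longrightarrow> \<mu>' \<in> P \<Longrightarrow> r \<mu> = r \<mu>' \<Longrightarrow> f (E \<mu> \<mu>') = g (E \<mu> \<mu>')"
    and x: "x \<in> alg"
  shows "f x = g x"
  using x by (induction rule: alg_induct) (simp_all add: assms)

lemma coef_star_mult_self:
  assumes "x \<in> alg" "\<mu> \<in> P"
  shows "coef (star x * x) \<mu> \<mu> \<in> \<real>\<^sub>\<ge>\<^sub>0"
proof -
  have "coef (star x * x) \<mu> \<mu> = (\<Sum>\<nu>\<in>P. cnj (coef x \<nu> \<mu>) * coef x \<nu> \<mu>)"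
    using assms by (simp add: coef_mult star_in_alg coef_star)
  also have "\<dots> = (\<Sum>\<nu>\<in>P. complex_of_real ((cmod (coef x \<nu> \<mu>))\<^sup>2))"
    by (intro sum.cong refl) (simp only: complex_norm_square mult.commute)
  also have "\<dots> \<in> \<real>\<^sub>\<ge>\<^sub>0" by (intro sum_nonneg_Reals) simp
  finally show ?thesis .
qed

lemma state_E_nonneg:
  assumes "state_on UNIV \<omega>" "\<mu> \<in> P"
  shows "\<omega> (E \<mu> \<mu>) \<in> \<real>\<^sub>\<ge>\<^sub>0"
  using state_positive[OF assms(1), of "E \<mu> \<mu>"] assms(2) by (simp add: star_E mult_E)

lemma diagonal_state:
  assumes \<omega>: "state_on UNIV \<omega>"
    and off: "\<And>\<mu> \<mu>'. \<mu> \<in> P \<Longrightarrow> \<mu>' \<in> P \<Longrightarrow> r \<mu> = r \<mu>' \<Longrightarrow> \<mu> \<noteq> \<mu>' \<Longrightarrow> \<omega> (E \<mu> \<mu>') = 0"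
    and x: "x \<in> alg"
  shows "\<omega> x = (\<Sum>\<mu>\<in>P. coef x \<mu> \<mu> * \<omega> (E \<mu> \<mu>))"
proof -
  have "\<omega> x = (\<Sum>\<mu>\<in>P. \<Sum>\<mu>'\<in>P. coef x \<mu> \<mu>' * \<omega> (E \<mu> \<mu>'))"
    by (rule linear_expansion) (use \<omega> x in \<open>auto simp: state_add state_scaleC\<close>)
  also have "\<dots> = (\<Sum>\<mu>\<in>P. \<Sum>\<mu>'\<in>P. if \<mu>' = \<mu> then coef x \<mu> \<mu> * \<omega> (E \<mu> \<mu>) else 0)"
  proof (intro sum.cong refl)
    fix \<mu> \<mu>' assume "\<mu> \<in> P" "\<mu>' \<in> P"
    then show "coef x \<mu> \<mu>' * \<omega> (E \<mu> \<mu>') = (if \<mu>' = \<mu> then coef x \<mu> \<mu> * \<omega> (E \<mu> \<mu>) else 0)"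
      using off[of \<mu> \<mu>'] coef_unrelated[of \<mu> \<mu>' x] by (cases "r \<mu> = r \<mu>'") auto
  qed
  finally show ?thesis using finite_P by (simp add: sum.delta)
qed

end

section \<open>Geodesic paths in a Bratteli diagram\<close>

lemma path_range_conv: "path_range G v \<mu> = (if \<mu> = [] then v else head G (last \<mu>))"
  by (simp add: pre_digraph.awalk_verts_conv)

lemma path_range_Nil: "path_range G v [] = v"
  and path_range_snoc: "path_range G v (\<mu> @ [a]) = head G a"
  by (simp_all add: path_range_conv)

lemma (in wf_digraph) paths_0: "v \<in> verts G \<Longrightarrow> paths G v 0 = {[]}"
  by (auto simp: paths_def awalk_Nil_iff)

lemma (in wf_digraph) snoc_in_paths_iff:
  "\<mu> @ [a] \<in> paths G v (Suc n) \<longleftrightarrow> \<mu> \<in> paths G v n \<and> a \<in> out_arcs G (path_range G v \<mu>)"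
  by (auto simp: paths_def awalk_append_iff awalk_simps intro: arg_cong[where f = "tail G"])

lemma (in wf_digraph) paths_SucE:
  assumes "\<mu> \<in> paths G v (Suc n)"
  obtains \<nu> a where "\<mu> = \<nu> @ [a]" "\<nu> \<in> paths G v n" "a \<in> out_arcs G (path_range G v \<nu>)"
proof (cases \<mu> rule: rev_cases)
  case (snoc \<nu> a)
  then show ?thesis using assms snoc_in_paths_iff that by metis
qed (use assms in \<open>auto simp: paths_def\<close>)

lemma length_path: "\<mu> \<in> paths G v n \<Longrightarrow> length \<mu> = n"
  by (simp add: paths_def)

lemma initial_path_0: "initial_path p 0 = []"
  and initial_path_Suc: "initial_path p (Suc n) = initial_path p n @ [p n]"
  and length_initial_path [simp]: "length (initial_path p n) = n"
  by (simp_all add: initial_path_def)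

lemma path_potential_snoc: "path_potential F (\<mu> @ [a]) = path_potential F \<mu> + F a"
  by (simp add: path_potential_def)

context bratteli_diagram
begin

lemma v0_in_verts: "v0 \<in> verts Br"
  using level_0 verts_eq by auto

lemmas paths_0' = paths_0[OF v0_in_verts]

lemma path_range_in_level: "\<mu> \<in> paths Br v0 n \<Longrightarrow> path_range Br v0 \<mu> \<in> lvl n"
proof (induction n arbitrary: \<mu>)
  case 0
  then show ?case by (simp add: paths_0' level_0)
next
  case (Suc n)
  from Suc.prems obtain \<nu> a where "\<mu> = \<nu> @ [a]" "\<nu> \<in> paths Br v0 n"
    "a \<in> out_arcs Br (path_range Br v0 \<nu>)" by (rule paths_SucE)
  then show ?case using level_Suc Suc.IH by (auto simp: path_range_snoc)
qed

lemma path_range_in_verts: "\<mu> \<in> paths Br v0 n \<Longrightarrow> path_range Br v0 \<mu> \<in> verts Br"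
  using path_range_in_level verts_eq by blast

lemma level_unique: "v \<in> lvl m \<Longrightarrow> v \<in> lvl n \<Longrightarrow> m = n"
  using disjoint_levels by (auto simp: disjoint_family_on_def)

lemma finite_paths: "finite (paths Br v0 n)"
proof (induction n)
  case (Suc n)
  have "paths Br v0 (Suc n) \<subseteq>
      (\<Union>\<nu>\<in>paths Br v0 n. (\<lambda>a. \<nu> @ [a]) ` out_arcs Br (path_range Br v0 \<nu>))"
    by (auto elim!: paths_SucE)
  moreover have "finite (out_arcs Br (path_range Br v0 \<nu>))" if "\<nu> \<in> paths Br v0 n" for \<nu>
    using emits path_range_in_verts[OF that] by blast
  ultimately show ?case using Suc.IH by (auto intro: finite_subset)
qed (simp add: paths_0')

lemma paths_nonempty: "paths Br v0 n \<noteq> {}"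
proof (induction n)
  case (Suc n)
  then obtain \<nu> where \<nu>: "\<nu> \<in> paths Br v0 n" by blast
  then obtain a where "a \<in> out_arcs Br (path_range Br v0 \<nu>)"
    using emits path_range_in_verts by blast
  with \<nu> have "\<nu> @ [a] \<in> paths Br v0 (Suc n)" by (simp add: snoc_in_paths_iff)
  then show ?case by blast
qed (simp add: paths_0')

lemma infinite_paths_iff:
  "p \<in> infinite_paths Br v0 \<longleftrightarrow> (\<forall>n. initial_path p n \<in> paths Br v0 n)"
proof
  assume p: "p \<in> infinite_paths Br v0"
  have "initial_path p n \<in> paths Br v0 n" for n
  proof (induction n)
    case (Suc n)
    have "tail Br (p n) = path_range Br v0 (initial_path p n)"
      using p by (cases n) (auto simp: infinite_paths_def initial_path_0 initial_path_Suc
          path_range_Nil path_range_snoc)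
    moreover have "p n \<in> arcs Br" using p by (auto simp: infinite_paths_def)
    ultimately show ?case using Suc.IH by (simp add: initial_path_Suc snoc_in_paths_iff)
  qed (simp add: initial_path_0 paths_0')
  then show "\<forall>n. initial_path p n \<in> paths Br v0 n" by blast
next
  assume *: "\<forall>n. initial_path p n \<in> paths Br v0 n"
  then have **: "p n \<in> out_arcs Br (path_range Br v0 (initial_path p n))" for n
    using snoc_in_paths_iff[of "initial_path p n" "p n"] by (metis initial_path_Suc)
  have "tail Br (p 0) = v0" using **[of 0] by (simp add: initial_path_0 path_range_Nil)
  moreover have "head Br (p i) = tail Br (p (Suc i))" for i
    using **[of "Suc i"] by (simp add: initial_path_Suc path_range_snoc)
  moreover have "range p \<subseteq> arcs Br" using ** by auto
  ultimately show "p \<in> infinite_paths Br v0" by (auto simp: infinite_paths_def)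
qed

end

locale bratteli_potential = bratteli_diagram Br lvl v0
  for Br :: "('v, 'e) pre_digraph" and lvl :: "nat \<Rightarrow> 'v set" and v0 :: 'v +
  fixes F :: "'e \<Rightarrow> real"
begin

abbreviation geod :: "(nat \<Rightarrow> 'e) set" where "geod \<equiv> geodesics Br v0 F"

abbreviation subdiag :: "('v, 'e) pre_digraph" where "subdiag \<equiv> geodesic_subdiagram Br v0 F"

text \<open>
  Geodesics are the infinite paths all of whose initial segments are minimal.
\<close>

definition minimal :: "'e list \<Rightarrow> bool" where
  "minimal \<mu> \<longleftrightarrow> \<mu> \<in> paths Br v0 (length \<mu>) \<and>
     (\<forall>\<mu>'\<in>paths Br v0 (length \<mu>). path_range Br v0 \<mu>' = path_range Br v0 \<mu> \<longrightarrow>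
        path_potential F \<mu> \<le> path_potential F \<mu>')"

text \<open>
  A competitor of the shorter path becomes a competitor of the longer one when it is prolonged by the
  same arrow.
\<close>

lemma minimal_snocD: "minimal (\<mu> @ [a]) \<Longrightarrow> minimal \<mu>"
proof -
  assume min: "minimal (\<mu> @ [a])"
  then have \<mu>: "\<mu> \<in> paths Br v0 (length \<mu>)" "a \<in> out_arcs Br (path_range Br v0 \<mu>)"
    by (auto simp: minimal_def snoc_in_paths_iff)
  have "path_potential F \<mu> \<le> path_potential F \<mu>'"
    if \<mu>': "\<mu>' \<in> paths Br v0 (length \<mu>)" "path_range Br v0 \<mu>' = path_range Br v0 \<mu>" for \<mu>'
  proof -
    have "\<mu>' @ [a] \<in> paths Br v0 (length (\<mu> @ [a]))"
      using \<mu>' \<mu> by (simp add: snoc_in_paths_iff)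
    then have "path_potential F (\<mu> @ [a]) \<le> path_potential F (\<mu>' @ [a])"
      using min by (simp add: minimal_def path_range_snoc)
    then show ?thesis by (simp add: path_potential_snoc)
  qed
  with \<mu>(1) show ?thesis by (auto simp: minimal_def)
qed

lemma minimal_appendD: "minimal (\<mu> @ \<nu>) \<Longrightarrow> minimal \<mu>"
proof (induction \<nu> rule: rev_induct)
  case (snoc a \<nu>)
  then show ?case using minimal_snocD[of "\<mu> @ \<nu>" a] by simp
qed simp

lemma minimal_exists: "\<exists>\<mu>. length \<mu> = n \<and> minimal \<mu>"
proof -
  obtain \<nu> where \<nu>: "\<nu> \<in> paths Br v0 n" using paths_nonempty by blast
  let ?S = "{\<mu> \<in> paths Br v0 n. path_range Br v0 \<mu> = path_range Br v0 \<nu>}"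
  have S: "finite ?S" "?S \<noteq> {}" using finite_paths \<nu> by auto
  define \<mu> where "\<mu> = arg_min_on (path_potential F) ?S"
  have "\<mu> \<in> ?S" unfolding \<mu>_def by (rule arg_min_if_finite(1)[OF S])
  moreover have "path_potential F \<mu> \<le> path_potential F \<mu>'" if "\<mu>' \<in> ?S" for \<mu>'
    unfolding \<mu>_def by (rule arg_min_least[OF S that])
  ultimately have "minimal \<mu>" "length \<mu> = n" by (auto simp: minimal_def length_path)
  then show ?thesis by blast
qed

lemma geodesics_iff: "p \<in> geod \<longleftrightarrow> (\<forall>n. minimal (initial_path p n))"
proof
  assume p: "p \<in> geod"
  then have path: "initial_path p n \<in> paths Br v0 n" for n
    using infinite_paths_iff by (auto simp: geodesics_def)
  have "minimal (initial_path p n)" for n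
  proof (cases n)
    case 0
    then show ?thesis by (simp add: minimal_def initial_path_0 paths_0')
  next
    case (Suc m)
    have "path_range Br v0 (initial_path p n) = head Br (p (n - 1))"
      using Suc by (simp add: initial_path_Suc path_range_snoc)
    then show ?thesis using p path[of n] Suc by (auto simp: minimal_def geodesics_def)
  qed
  then show "\<forall>n. minimal (initial_path p n)" by blast
next
  assume *: "\<forall>n. minimal (initial_path p n)"
  then have "p \<in> infinite_paths Br v0"
    unfolding infinite_paths_iff minimal_def by (metis length_initial_path)
  moreover have "path_potential F (initial_path p n) \<le> path_potential F \<mu>"
    if "n \<ge> 1" "\<mu> \<in> paths Br v0 n" "path_range Br v0 \<mu> = head Br (p (n - 1))" for n \<mu>
  proof -
    have "path_range Br v0 (initial_path p n) = head Br (p (n - 1))"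
      using that(1) initial_path_Suc[of p "n - 1"] by (simp add: path_range_snoc)
    then show ?thesis using * that by (auto simp: minimal_def)
  qed
  ultimately show "p \<in> geod" by (auto simp: geodesics_def)
qed

text \<open>
  The initial segment of a geodesic may be exchanged for any path to the same vertex that is not
  longer with respect to the potential: the exchange does not increase the potential of the later
  initial segments, so they remain minimal.
\<close>

lemma geodesic_splice:
  assumes p: "p \<in> geod" and \<nu>: "\<nu> \<in> paths Br v0 n"
    and range: "path_range Br v0 \<nu> = path_range Br v0 (initial_path p n)"
    and le: "path_potential F \<nu> \<le> path_potential F (initial_path p n)"
  obtains p' where "p' \<in> geod" "initial_path p' n = \<nu>" "p' n = p n"
proof -
  define p' where "p' i = (if i < n then \<nu> ! i else p i)" for i
  have len: "length \<nu> = n" using \<nu> by (rule length_path)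
  have init: "initial_path p' n = \<nu>"
    by (rule nth_equalityI) (auto simp: initial_path_def p'_def len)
  have min: "minimal (initial_path p k)" for k using p geodesics_iff by blast
  then have arc: "p k \<in> out_arcs Br (path_range Br v0 (initial_path p k))" for k
    using snoc_in_paths_iff[of "initial_path p k" "p k" v0 k]
    by (metis initial_path_Suc length_initial_path minimal_def)
  have *: "initial_path p' (n + m) \<in> paths Br v0 (n + m) \<and>
      path_range Br v0 (initial_path p' (n + m)) = path_range Br v0 (initial_path p (n + m)) \<and>
      path_potential F (initial_path p' (n + m)) \<le> path_potential F (initial_path p (n + m))" for m
  proof (induction m)
    case 0
    then show ?case using init \<nu> range le by simp
  next
    case (Suc m)
    then show ?case
      using arc[of "n + m"]
      by (simp add: initial_path_Suc snoc_in_paths_iff path_range_snoc path_potential_snoc p'_def)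
  qed
  have "minimal (initial_path p' (n + m))" for m
    unfolding minimal_def
  proof (intro conjI ballI impI)
    fix \<mu>' assume "\<mu>' \<in> paths Br v0 (length (initial_path p' (n + m)))"
      "path_range Br v0 \<mu>' = path_range Br v0 (initial_path p' (n + m))"
    then have "path_potential F (initial_path p (n + m)) \<le> path_potential F \<mu>'"
      using min[of "n + m"] *[of m] by (simp add: minimal_def)
    then show "path_potential F (initial_path p' (n + m)) \<le> path_potential F \<mu>'"
      using *[of m] by linarith
  qed (use * in simp)
  moreover have "minimal (initial_path p' k)" if "k \<le> n" for k
  proof -
    have "initial_path p' n = initial_path p' k @ map p' [k..<n]"
      using that upt_add_eq_append[of 0 k "n - k"] by (simp add: initial_path_def)
    then show ?thesis using minimal_appendD \<open>minimal (initial_path p' (n + 0))\<close> by simp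
  qed
  ultimately have "minimal (initial_path p' k)" for k
    by (metis le_add_diff_inverse nat_le_linear)
  then have "p' \<in> geod" by (simp add: geodesics_iff)
  then show ?thesis using that init by (simp add: p'_def)
qed

text \<open>
  Koenig's lemma for the tree of minimal paths. Vertices emit finitely many arrows, so a path with
  minimal prolongations of every length can be continued by one arrow to another such path;
  continuing forever gives a geodesic, because the prefixes of minimal paths are minimal.
\<close>

lemma koenig:
  assumes "\<And>m. \<exists>\<nu>. length \<nu> = m \<and> minimal (\<mu> @ \<nu>)"
  shows "\<exists>p\<in>geod. initial_path p (length \<mu>) = \<mu>"
proof -
  define good where "good \<mu> \<longleftrightarrow> (\<forall>m. \<exists>\<nu>. length \<nu> = m \<and> minimal (\<mu> @ \<nu>))" for \<mu>
  have step: "\<exists>a. good (\<mu> @ [a])" if \<mu>: "good \<mu>" for \<mu>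
  proof (rule ccontr)
    assume "\<nexists>a. good (\<mu> @ [a])"
    then obtain m where m: "\<And>a \<nu>. length \<nu> = m a \<Longrightarrow> \<not> minimal (\<mu> @ [a] @ \<nu>)"
      unfolding good_def by (metis append.assoc)
    let ?A = "out_arcs Br (path_range Br v0 \<mu>)"
    have "minimal \<mu>" using \<mu> minimal_appendD good_def by blast
    then have "finite ?A" using emits path_range_in_verts by (auto simp: minimal_def)
    define M where "M = Max (insert 0 (m ` ?A))"
    obtain \<nu> where \<nu>: "length \<nu> = Suc M" "minimal (\<mu> @ \<nu>)" using \<mu> good_def by blast
    then obtain a \<nu>' where \<nu>': "\<nu> = a # \<nu>'" "length \<nu>' = M" by (cases \<nu>) auto
    have "minimal (\<mu> @ [a])" using \<nu>(2) \<nu>'(1) minimal_appendD[of "\<mu> @ [a]" \<nu>'] by simp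
    then have "a \<in> ?A" by (simp add: minimal_def snoc_in_paths_iff)
    then have "m a \<le> M" using \<open>finite ?A\<close> by (simp add: M_def)
    then have "minimal (\<mu> @ [a] @ take (m a) \<nu>')"
      using \<nu>(2) \<nu>'(1) minimal_appendD[of "\<mu> @ [a] @ take (m a) \<nu>'" "drop (m a) \<nu>'"] by simp
    then show False using m \<open>m a \<le> M\<close> \<nu>'(2) by simp
  qed
  have "\<exists>g. \<forall>k. (good (g k) \<and> (k = 0 \<longrightarrow> g k = \<mu>)) \<and> (\<exists>a. g (Suc k) = g k @ [a])"
  proof (rule dependent_nat_choice)
    show "\<exists>x. good x \<and> (0 = 0 \<longrightarrow> x = \<mu>)" using assms by (auto simp: good_def)
    show "\<exists>y. (good y \<and> (Suc k = 0 \<longrightarrow> y = \<mu>)) \<and> (\<exists>a. y = x @ [a])"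
      if "good x \<and> (k = 0 \<longrightarrow> x = \<mu>)" for x k
      using step that by blast
  qed
  then obtain g where g: "\<And>k. good (g k)" "g 0 = \<mu>" "\<And>k. \<exists>a. g (Suc k) = g k @ [a]" by blast
  have len: "length (g k) = length \<mu> + k" for k
  proof (induction k)
    case (Suc k)
    then show ?case using g(3)[of k] by auto
  qed (simp add: g)
  have ext: "i < length (g k) \<Longrightarrow> g (k + j) ! i = g k ! i" for i k j
  proof (induction j)
    case (Suc j)
    then show ?case using g(3)[of "k + j"] len by (auto simp: nth_append)
  qed simp
  define p where "p i = g (Suc i) ! i" for i
  have init: "initial_path p n = take n (g n)" for n
  proof (rule nth_equalityI)
    fix i assume i: "i < length (initial_path p n)"
    then show "initial_path p n ! i = take n (g n) ! i"
      using ext[of i "Suc i" "n - Suc i"] len by (simp add: initial_path_def p_def)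
  qed (simp add: len)
  have "minimal (initial_path p n)" for n
    using minimal_appendD[of "take n (g n)" "drop n (g n)"] minimal_appendD[of "g n"] g(1)[of n]
    by (auto simp: init good_def)
  then have "p \<in> geod" by (simp add: geodesics_iff)
  moreover have "initial_path p (length \<mu>) = \<mu>"
  proof (rule nth_equalityI)
    fix i assume "i < length (initial_path p (length \<mu>))"
    then show "initial_path p (length \<mu>) ! i = \<mu> ! i"
      using ext[of i 0 "length \<mu>"] len by (simp add: init g(2))
  qed simp
  ultimately show ?thesis by blast
qed

lemma geodesic_exists: "geod \<noteq> {}"
  using koenig[of "[]"] minimal_exists by auto

lemma subdiag_simps: "tail subdiag = tail Br" "head subdiag = head Br"
  "arcs subdiag = {a \<in> arcs Br. \<exists>p\<in>geod. \<exists>i. a = p i}"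
  "verts subdiag = (\<Union>n. geodesic_level Br v0 F n)"
  by (simp_all add: geodesic_subdiagram_def)

lemma subdiag_path_range: "path_range subdiag v0 \<mu> = path_range Br v0 \<mu>"
  by (simp add: path_range_conv subdiag_simps)

lemma geodesic_arc:
  assumes "p \<in> geod"
  shows "p i \<in> out_arcs Br (path_range Br v0 (initial_path p i))"
proof -
  have "initial_path p i @ [p i] \<in> paths Br v0 (Suc i)"
    using assms infinite_paths_iff[of p] by (auto simp: geodesics_def initial_path_Suc[symmetric])
  then show ?thesis by (simp add: snoc_in_paths_iff)
qed

lemma geodesic_range_in_verts:
  assumes "p \<in> geod"
  shows "path_range Br v0 (initial_path p n) \<in> verts subdiag"
proof -
  have "path_range Br v0 (initial_path p n) \<in> geodesic_level Br v0 F n"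
    using assms by (cases "n = 0")
      (auto simp: geodesic_level_def initial_path_0 path_range_Nil simp del: path_range_conv)
  then show ?thesis by (auto simp: subdiag_simps)
qed

sublocale sub: wf_digraph subdiag
proof
  fix a assume "a \<in> arcs subdiag"
  then obtain p i where p: "p \<in> geod" "a = p i" by (auto simp: subdiag_simps)
  have "tail Br (p i) = path_range Br v0 (initial_path p i)" using geodesic_arc[OF p(1)] by simp
  then show "tail subdiag a \<in> verts subdiag"
    using geodesic_range_in_verts[OF p(1), of i] p(2) by (simp add: subdiag_simps(1))
  have "head Br (p i) = path_range Br v0 (initial_path p (Suc i))"
    by (simp add: initial_path_Suc path_range_snoc)
  then show "head subdiag a \<in> verts subdiag"
    using geodesic_range_in_verts[OF p(1), of "Suc i"] p(2) by (simp add: subdiag_simps(2))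
qed

lemma v0_in_sub: "v0 \<in> verts subdiag"
proof -
  have "v0 \<in> geodesic_level Br v0 F 0" by (simp add: geodesic_level_def)
  then show ?thesis unfolding subdiag_simps by blast
qed

text \<open>
  By induction on the length: the last arrow of a path of the subdiagram lies on some geodesic, at the
  level given by its source. The initial segment of this geodesic can be exchanged for the rest of
  the path, since both are minimal.
\<close>

lemma sub_paths_iff: "\<mu> \<in> paths subdiag v0 n \<longleftrightarrow> (\<exists>p\<in>geod. initial_path p n = \<mu>)"
proof (induction n arbitrary: \<mu>)
  case 0
  then show ?case using geodesic_exists by (auto simp: sub.paths_0[OF v0_in_sub] initial_path_0)
next
  case (Suc n)
  show ?case
  proof
    assume "\<mu> \<in> paths subdiag v0 (Suc n)"
    then obtain \<nu> a where \<mu>: "\<mu> = \<nu> @ [a]" "\<nu> \<in> paths subdiag v0 n"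
      "a \<in> out_arcs subdiag (path_range subdiag v0 \<nu>)" by (rule sub.paths_SucE)
    then obtain p where p: "p \<in> geod" "initial_path p n = \<nu>" using Suc.IH by blast
    obtain p' i where p': "p' \<in> geod" "a = p' i" using \<mu>(3) by (auto simp: subdiag_simps)
    have \<nu>: "\<nu> \<in> paths Br v0 n" "minimal \<nu>"
      using p geodesics_iff by (auto simp: minimal_def)
    have "tail Br a = path_range Br v0 \<nu>" using \<mu>(3) by (simp add: subdiag_simps subdiag_path_range)
    moreover have tail: "tail Br a = path_range Br v0 (initial_path p' i)"
      using geodesic_arc[OF p'(1), of i] p'(2) by simp
    moreover have min': "minimal (initial_path p' i)" using p' geodesics_iff by blast
    ultimately have "i = n"
      using path_range_in_level[OF \<nu>(1)] path_range_in_level[of "initial_path p' i" i]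
      by (metis level_unique minimal_def length_initial_path)
    then have "path_potential F \<nu> \<le> path_potential F (initial_path p' n)"
      using \<nu>(2) min' tail \<open>tail Br a = path_range Br v0 \<nu>\<close> length_path[OF \<nu>(1)]
      by (simp add: minimal_def)
    then obtain p'' where "p'' \<in> geod" "initial_path p'' n = \<nu>" "p'' n = p' n"
      using geodesic_splice[OF p'(1) \<nu>(1)] tail \<open>tail Br a = path_range Br v0 \<nu>\<close> \<open>i = n\<close> by metis
    then show "\<exists>p\<in>geod. initial_path p (Suc n) = \<mu>"
      using \<mu>(1) p'(2) \<open>i = n\<close> by (auto simp: initial_path_Suc intro!: bexI[of _ p''])
  next
    assume "\<exists>p\<in>geod. initial_path p (Suc n) = \<mu>"
    then obtain p where p: "p \<in> geod" "\<mu> = initial_path p n @ [p n]" by (auto simp: initial_path_Suc)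
    then have "p n \<in> out_arcs subdiag (path_range subdiag v0 (initial_path p n))"
      using geodesic_arc[OF p(1), of n] by (auto simp: subdiag_simps subdiag_path_range)
    then show "\<mu> \<in> paths subdiag v0 (Suc n)"
      using p Suc.IH by (auto simp: sub.snoc_in_paths_iff)
  qed
qed

lemma sub_path_minimal: "\<mu> \<in> paths subdiag v0 n \<Longrightarrow> minimal \<mu>"
  using sub_paths_iff geodesics_iff by auto

lemma sub_paths_subset: "paths subdiag v0 n \<subseteq> paths Br v0 n"
proof
  fix \<mu> assume \<mu>: "\<mu> \<in> paths subdiag v0 n"
  then show "\<mu> \<in> paths Br v0 n"
    using sub_path_minimal[OF \<mu>] length_path[OF \<mu>] by (simp add: minimal_def)
qed

lemma finite_sub_paths: "finite (paths subdiag v0 n)"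
  using finite_subset[OF sub_paths_subset finite_paths] .

lemma sub_path_exchange:
  assumes "\<mu> \<in> paths subdiag v0 n" "\<mu>' \<in> paths Br v0 n" "path_range Br v0 \<mu> = path_range Br v0 \<mu>'"
    and "path_potential F \<mu>' \<le> path_potential F \<mu>"
  shows "\<mu>' \<in> paths subdiag v0 n"
proof -
  obtain p where p: "p \<in> geod" "initial_path p n = \<mu>" using assms(1) sub_paths_iff by blast
  obtain p' where "p' \<in> geod" "initial_path p' n = \<mu>'"
    by (rule geodesic_splice[OF p(1) assms(2)]) (use assms(3,4) p(2) in auto)
  then show ?thesis unfolding sub_paths_iff by blast
qed

lemma not_sub_path:
  assumes "\<mu> \<in> paths Br v0 n" "\<mu> \<notin> paths subdiag v0 n"
  obtains m where "\<And>\<nu>. length \<nu> = m \<Longrightarrow> \<not> minimal (\<mu> @ \<nu>)"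
  using koenig[of \<mu>] assms sub_paths_iff length_path by metis

end

section \<open>The flow of a potential on an AF algebra\<close>

text \<open>
  Stated for digraphs with finitely many paths of each length, because it applies both to a Bratteli
  diagram and to its geodesic subdiagram.
\<close>

locale af_system = wf_digraph G + AF_algebra G v0 E
  for G :: "('v, 'e) pre_digraph" and v0 :: 'v
    and E :: "nat \<Rightarrow> 'e list \<Rightarrow> 'e list \<Rightarrow> 'a::cstar_algebra" +
  assumes finite_paths: "finite (paths G v0 n)"
begin

abbreviation "rng \<equiv> path_range G v0"

lemma path_pairs_conv:
  "path_pairs G v0 n = {(\<mu>, \<mu>'). \<mu> \<in> paths G v0 n \<and> \<mu>' \<in> paths G v0 n \<and> rng \<mu> = rng \<mu>'}"
  by (simp add: path_pairs_def)

sublocale mu: matrix_units "paths G v0 n" rng "E n" for n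
proof
  show "E n \<mu> \<mu> \<noteq> 0" if "\<mu> \<in> paths G v0 n" for \<mu>
  proof
    assume "E n \<mu> \<mu> = 0"
    then have "0 \<in> (\<lambda>(\<mu>, \<mu>'). E n \<mu> \<mu>') ` path_pairs G v0 n"
      using that by (force simp: path_pairs_def)
    then show False using independent_E complex_vector.dependent_zero by blast
  qed
qed (auto simp: finite_paths mult_E star_E sum_E path_pairs_conv)

lemma AF_alg_eq: "AF_alg G v0 E n = mu.alg n"
  unfolding AF_alg_def path_pairs_conv by (rule mu.cspan_eq_alg)

lemma refine:
  assumes "\<mu> \<in> paths G v0 n" "\<mu>' \<in> paths G v0 n" "rng \<mu> = rng \<mu>'"
  shows "E n \<mu> \<mu>' = (\<Sum>a\<in>out_arcs G (rng \<mu>). E (Suc n) (\<mu> @ [a]) (\<mu>' @ [a]))"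
  using refine_E assms by (simp add: path_pairs_def)

lemma alg_Suc: "mu.alg n \<subseteq> mu.alg (Suc n)"
proof
  fix x assume "x \<in> mu.alg n"
  then show "x \<in> mu.alg (Suc n)"
  proof (induction rule: mu.alg_induct)
    case (unit \<mu> \<mu>')
    then show ?case
      unfolding refine[OF unit]
      by (intro mu.sum_in_alg mu.E_in_alg) (auto simp: snoc_in_paths_iff path_range_snoc)
  qed (auto intro: mu.add_in_alg mu.scaleC_in_alg)
qed

lemma alg_mono: "m \<le> n \<Longrightarrow> mu.alg m \<subseteq> mu.alg n"
  using lift_Suc_mono_le[of mu.alg] alg_Suc by blast

definition AF_union :: "'a set" where "AF_union = (\<Union>n. mu.alg n)"

lemma AF_union_dense: "closure AF_union = UNIV"
  using dense by (simp add: AF_union_def AF_alg_eq)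

lemma AF_union_approx: obtains x where "\<And>k::nat. x k \<in> AF_union" "x \<longlonglongrightarrow> a"
  using AF_union_dense closure_sequential[of a AF_union] by auto

lemma AF_union_pair:
  assumes "a \<in> AF_union" "b \<in> AF_union"
  obtains n where "a \<in> mu.alg n" "b \<in> mu.alg n"
proof -
  obtain m k where "a \<in> mu.alg m" "b \<in> mu.alg k" using assms by (auto simp: AF_union_def)
  then have "a \<in> mu.alg (max m k)" "b \<in> mu.alg (max m k)"
    using alg_mono[of m "max m k"] alg_mono[of k "max m k"] by auto
  then show ?thesis by (rule that)
qed

lemma AF_union_closed:
  "a \<in> AF_union \<Longrightarrow> b \<in> AF_union \<Longrightarrow> a + b \<in> AF_union"
  "a \<in> AF_union \<Longrightarrow> b \<in> AF_union \<Longrightarrow> a * b \<in> AF_union"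
  "a \<in> AF_union \<Longrightarrow> c *\<^sub>C a \<in> AF_union"
  "a \<in> AF_union \<Longrightarrow> star a \<in> AF_union"
proof -
  show "a + b \<in> AF_union" "a * b \<in> AF_union" if ab: "a \<in> AF_union" "b \<in> AF_union"
    by (rule AF_union_pair[OF ab]; auto simp: AF_union_def intro: mu.add_in_alg mu.mult_in_alg)+
  show "c *\<^sub>C a \<in> AF_union" "star a \<in> AF_union" if "a \<in> AF_union"
    using that by (auto simp: AF_union_def intro: mu.scaleC_in_alg mu.star_in_alg)
qed

end

locale af_flow = af_system G v0 E
  for G :: "('v, 'e) pre_digraph" and v0 :: 'v
    and E :: "nat \<Rightarrow> 'e list \<Rightarrow> 'e list \<Rightarrow> 'a::cstar_algebra" +
  fixes F :: "'e \<Rightarrow> real"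
begin

abbreviation "Fp \<equiv> path_potential F"

text \<open>
  On each finite-dimensional stage the flow is inner: it is conjugation by the unitary with diagonal
  entries \<open>exp (i t F(\<mu>))\<close>, and in particular isometric.
\<close>

definition unitary :: "nat \<Rightarrow> real \<Rightarrow> 'a" where
  "unitary n t = (\<Sum>\<mu>\<in>paths G v0 n. cis (t * Fp \<mu>) *\<^sub>C E n \<mu> \<mu>)"

lemma unitary_mult_E:
  assumes "\<mu> \<in> paths G v0 n" "\<mu>' \<in> paths G v0 n" "rng \<mu> = rng \<mu>'"
  shows "unitary n t * E n \<mu> \<mu>' = cis (t * Fp \<mu>) *\<^sub>C E n \<mu> \<mu>'"
proof -
  have "unitary n t * E n \<mu> \<mu>' =
      (\<Sum>\<nu>\<in>paths G v0 n. if \<nu> = \<mu> then cis (t * Fp \<mu>) *\<^sub>C E n \<mu> \<mu>' else 0)"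
    unfolding unitary_def sum_distrib_right
    by (rule sum.cong) (use assms in \<open>auto simp: mult_scaleC_left mu.mult_E\<close>)
  then show ?thesis using assms finite_paths by (simp add: sum.delta)
qed

lemma star_unitary: "star (unitary n t) = unitary n (- t)"
  unfolding unitary_def star_sum
  by (rule sum.cong) (auto simp: star_scaleC mu.star_E cis_cnj)

lemma E_mult_unitary:
  assumes "\<mu> \<in> paths G v0 n" "\<mu>' \<in> paths G v0 n" "rng \<mu> = rng \<mu>'"
  shows "E n \<mu> \<mu>' * unitary n t = cis (t * Fp \<mu>') *\<^sub>C E n \<mu> \<mu>'"
proof -
  have "star (unitary n (- t) * E n \<mu>' \<mu>) = star (cis (- t * Fp \<mu>') *\<^sub>C E n \<mu>' \<mu>)"
    using assms by (simp add: unitary_mult_E)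
  then show ?thesis using assms by (simp add: star_mult star_scaleC star_unitary mu.star_E cis_cnj)
qed

lemma unitary_minus: "unitary n t * unitary n (- t) = 1"
proof -
  have "unitary n t * unitary n (- t) =
      (\<Sum>\<mu>\<in>paths G v0 n. cis (- t * Fp \<mu>) *\<^sub>C (unitary n t * E n \<mu> \<mu>))"
    by (simp add: unitary_def[of n "- t"] sum_distrib_left mult_scaleC_right)
  also have "\<dots> = (\<Sum>\<mu>\<in>paths G v0 n. E n \<mu> \<mu>)"
    by (rule sum.cong) (simp_all add: unitary_mult_E scaleC_scaleC cis_mult)
  finally show ?thesis by (simp add: mu.sum_E)
qed

definition conj_flow :: "nat \<Rightarrow> real \<Rightarrow> 'a \<Rightarrow> 'a" where
  "conj_flow n t x = unitary n t * x * unitary n (- t)"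

lemma conj_flow_E:
  assumes "\<mu> \<in> paths G v0 n" "\<mu>' \<in> paths G v0 n" "rng \<mu> = rng \<mu>'"
  shows "conj_flow n t (E n \<mu> \<mu>') = cis (t * (Fp \<mu> - Fp \<mu>')) *\<^sub>C E n \<mu> \<mu>'"
  using assms by (simp add: conj_flow_def unitary_mult_E E_mult_unitary mult_scaleC_left
      scaleC_scaleC cis_mult algebra_simps)

lemma conj_flow_add: "conj_flow n t (x + y) = conj_flow n t x + conj_flow n t y"
  and conj_flow_scaleC: "conj_flow n t (c *\<^sub>C x) = c *\<^sub>C conj_flow n t x"
  and conj_flow_diff: "conj_flow n t (x - y) = conj_flow n t x - conj_flow n t y"
  and conj_flow_star: "conj_flow n t (star x) = star (conj_flow n t x)"
  by (simp_all add: conj_flow_def algebra_simps mult_scaleC_left mult_scaleC_right star_mult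
      star_unitary)

lemma conj_flow_mult: "conj_flow n t (x * y) = conj_flow n t x * conj_flow n t y"
proof -
  have "conj_flow n t x * conj_flow n t y =
      unitary n t * x * (unitary n (- t) * unitary n (- (- t))) * y * unitary n (- t)"
    by (simp add: conj_flow_def mult.assoc)
  then show ?thesis unfolding unitary_minus by (simp add: conj_flow_def mult.assoc)
qed

lemma norm_conj_flow_le: "norm (conj_flow n t x) \<le> norm x"
proof -
  have u: "norm (unitary n s) = 1" for s
    using unitary_minus[of n "- s"] by (intro norm_unitary) (simp add: star_unitary)
  have "norm (conj_flow n t x) \<le> norm (unitary n t) * norm x * norm (unitary n (- t))"
    unfolding conj_flow_def by (meson norm_mult_ineq mult_right_mono norm_ge_zero order_trans)
  then show ?thesis by (simp add: u)
qed

lemma conj_flow_Suc: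
  assumes "x \<in> mu.alg n"
  shows "conj_flow (Suc n) t x = conj_flow n t x"
  using assms
proof (rule mu.hom_on_algI[rotated -1])
  fix \<mu> \<mu>' assume \<mu>: "\<mu> \<in> paths G v0 n" "\<mu>' \<in> paths G v0 n" "rng \<mu> = rng \<mu>'"
  have sum: "conj_flow (Suc n) t (sum f I) = (\<Sum>i\<in>I. conj_flow (Suc n) t (f i))"
    for f and I :: "'e set"
    by (simp add: conj_flow_def sum_distrib_left sum_distrib_right)
  have "conj_flow (Suc n) t (E n \<mu> \<mu>') =
      (\<Sum>a\<in>out_arcs G (rng \<mu>). cis (t * (Fp \<mu> - Fp \<mu>')) *\<^sub>C E (Suc n) (\<mu> @ [a]) (\<mu>' @ [a]))"
    unfolding refine[OF \<mu>] sum
    by (rule sum.cong) (use \<mu> in \<open>auto simp: conj_flow_E snoc_in_paths_iff path_range_snoc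
        path_potential_snoc\<close>)
  also have "\<dots> = conj_flow n t (E n \<mu> \<mu>')"
    using conj_flow_E[OF \<mu>, of t] refine[OF \<mu>] by (simp flip: scaleC.sum_right)
  finally show "conj_flow (Suc n) t (E n \<mu> \<mu>') = conj_flow n t (E n \<mu> \<mu>')" .
qed (simp_all add: conj_flow_add conj_flow_scaleC)

definition flow_spec :: "(real \<Rightarrow> 'a \<Rightarrow> 'a) \<Rightarrow> bool" where
  "flow_spec \<alpha> \<longleftrightarrow> flow \<alpha> \<and>
     (\<forall>n. \<forall>(\<mu>, \<mu>')\<in>path_pairs G v0 n. \<forall>t.
        \<alpha> t (E n \<mu> \<mu>') =
          exp (\<i> * complex_of_real (t * (Fp \<mu> - Fp \<mu>'))) *\<^sub>C E n \<mu> \<mu>')"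

lemma flow_continuous: "flow \<alpha> \<Longrightarrow> continuous_on UNIV (\<alpha> t)"
  using star_hom_continuous_on[OF cstar_subalgebra_UNIV] by (auto simp: flow_def)

lemma flow_spec_conj:
  assumes "flow_spec \<alpha>" "x \<in> mu.alg n"
  shows "\<alpha> t x = conj_flow n t x"
proof (rule mu.hom_on_algI[OF _ _ _ _ _ assms(2)])
  show "\<alpha> t (E n \<mu> \<mu>') = conj_flow n t (E n \<mu> \<mu>')"
    if "\<mu> \<in> paths G v0 n" "\<mu>' \<in> paths G v0 n" "rng \<mu> = rng \<mu>'" for \<mu> \<mu>'
    using assms(1) that by (auto simp: flow_spec_def path_pairs_conv conj_flow_E cis_conv_exp)
qed (use assms(1) in \<open>auto simp: flow_spec_def flow_def star_hom_on_def conj_flow_add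
    conj_flow_scaleC\<close>)

lemma flow_spec_unique:
  assumes "flow_spec \<alpha>" "flow_spec \<alpha>'"
  shows "\<alpha> = \<alpha>'"
proof
  fix t show "\<alpha> t = \<alpha>' t"
  proof (rule continuous_eq_on_dense[OF AF_union_dense])
    show "continuous_on UNIV (\<alpha> t)" "continuous_on UNIV (\<alpha>' t)"
      using assms by (auto simp: flow_spec_def intro: flow_continuous)
    show "\<alpha> t x = \<alpha>' t x" if "x \<in> AF_union" for x
      using that flow_spec_conj[OF assms(1)] flow_spec_conj[OF assms(2)]
      by (auto simp: AF_union_def)
  qed
qed

text \<open>
  The conjugations extend to the whole algebra. The orbit maps of the extensions are continuous as
  uniform limits of those of elements of the stages.
\<close>

lemma flow_spec_exists: "\<exists>\<alpha>. flow_spec \<alpha>"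
proof -
  have "\<exists>g. continuous_on UNIV g \<and> (\<forall>n. \<forall>x\<in>mu.alg n. g x = conj_flow n t x)" for t
  proof -
    obtain g where "continuous_on (closure (\<Union>n. mu.alg n)) g" "\<And>n x. x \<in> mu.alg n \<Longrightarrow> g x = conj_flow n t x"
      by (rule extend_from_chain[of "\<lambda>n. mu.alg n" "\<lambda>n. conj_flow n t"])
        (use alg_Suc conj_flow_Suc norm_conj_flow_le in \<open>auto simp flip: conj_flow_diff\<close>)
    then show ?thesis using AF_union_dense by (auto simp: AF_union_def)
  qed
  then obtain \<alpha> where cont: "\<And>t. continuous_on UNIV (\<alpha> t)"
    and \<alpha>: "\<And>t n x. x \<in> mu.alg n \<Longrightarrow> \<alpha> t x = conj_flow n t x" by metis
  have hom: "star_hom_on UNIV (\<alpha> t)" for t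
  proof -
    have "star_hom_on AF_union (\<alpha> t)"
      unfolding star_hom_on_def
    proof (intro conjI ballI allI)
      fix a b assume "a \<in> AF_union" "b \<in> AF_union"
      then obtain n where "a \<in> mu.alg n" "b \<in> mu.alg n" by (rule AF_union_pair)
      then show "\<alpha> t (a + b) = \<alpha> t a + \<alpha> t b" "\<alpha> t (a * b) = \<alpha> t a * \<alpha> t b"
        using \<alpha>[OF mu.add_in_alg] \<alpha>[OF mu.mult_in_alg] by (simp_all add: \<alpha> conj_flow_add conj_flow_mult)
    next
      fix a c assume "a \<in> AF_union"
      then obtain n where "a \<in> mu.alg n" by (auto simp: AF_union_def)
      then show "\<alpha> t (c *\<^sub>C a) = c *\<^sub>C \<alpha> t a" "\<alpha> t (star a) = star (\<alpha> t a)"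
        using \<alpha>[OF mu.scaleC_in_alg] \<alpha>[OF mu.star_in_alg]
        by (simp_all add: \<alpha> conj_flow_scaleC conj_flow_star)
    qed
    then show ?thesis
      using star_hom_on_closure[of AF_union "\<alpha> t"] cont AF_union_closed AF_union_dense by simp
  qed
  have E: "\<alpha> t (E n \<mu> \<mu>') = cis (t * (Fp \<mu> - Fp \<mu>')) *\<^sub>C E n \<mu> \<mu>'"
    if "\<mu> \<in> paths G v0 n" "\<mu>' \<in> paths G v0 n" "rng \<mu> = rng \<mu>'" for n t \<mu> \<mu>'
    using that by (simp add: \<alpha>[OF mu.E_in_alg] conj_flow_E)
  have lin: "\<alpha> t (x + y) = \<alpha> t x + \<alpha> t y" "\<alpha> t (c *\<^sub>C x) = c *\<^sub>C \<alpha> t x" for t x y c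
    using hom by (auto simp: star_hom_on_def)
  have comp: "\<alpha> (s + t) = \<alpha> s \<circ> \<alpha> t" for s t
  proof (rule continuous_eq_on_dense[OF AF_union_dense cont])
    show "continuous_on UNIV (\<alpha> s \<circ> \<alpha> t)"
      by (intro continuous_on_compose cont continuous_on_subset[OF cont]) auto
    fix x assume "x \<in> AF_union"
    then obtain n where "x \<in> mu.alg n" by (auto simp: AF_union_def)
    then show "\<alpha> (s + t) x = (\<alpha> s \<circ> \<alpha> t) x"
      by (induction rule: mu.alg_induct)
        (simp_all add: E lin scaleC_scaleC cis_mult algebra_simps)
  qed
  have id: "\<alpha> 0 = id"
  proof (rule continuous_eq_on_dense[OF AF_union_dense cont])
    fix x assume "x \<in> AF_union"
    then obtain n where "x \<in> mu.alg n" by (auto simp: AF_union_def)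
    then show "\<alpha> 0 x = id x"
      by (induction rule: mu.alg_induct) (simp_all add: E lin)
  qed simp
  have bij: "bij (\<alpha> t)" for t
    using comp[of t "- t"] comp[of "- t" t] id by (intro o_bij[of "\<alpha> (- t)"]) auto
  have orbit: "continuous_on UNIV (\<lambda>t. \<alpha> t a)" for a
  proof -
    obtain x where x: "\<And>k. x k \<in> AF_union" "x \<longlonglongrightarrow> a" by (rule AF_union_approx[of a]) blast
    have "continuous_on UNIV (\<lambda>t. \<alpha> t y)" if "y \<in> mu.alg n" for y n
      using that
    proof (induction rule: mu.alg_induct)
      case (unit \<mu> \<mu>')
      then show ?case
        unfolding E[OF unit] cis_conv_exp
        by (intro scaleC.continuous_on continuous_intros)
    next
      case (add x y)
      then show ?case by (simp add: lin continuous_on_add)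
    next
      case (scale c x)
      then show ?case by (simp add: lin) (intro scaleC.continuous_on continuous_on_const)
    qed
    moreover have "\<exists>n. x k \<in> mu.alg n" for k using x(1)[of k] by (simp add: AF_union_def)
    ultimately have "continuous_on UNIV (\<lambda>t. \<alpha> t (x k))" for k by blast
    then have "\<forall>\<^sub>F k in sequentially. continuous_on UNIV (\<lambda>t. \<alpha> t (x k))" by simp
    moreover have "uniform_limit UNIV (\<lambda>k t. \<alpha> t (x k)) (\<lambda>t. \<alpha> t a) sequentially"
    proof (rule uniform_limitI)
      fix e :: real assume "e > 0"
      then have "\<forall>\<^sub>F k in sequentially. dist (x k) a < e" by (rule tendstoD[OF x(2)])
      then show "\<forall>\<^sub>F k in sequentially. \<forall>t\<in>UNIV. dist (\<alpha> t (x k)) (\<alpha> t a) < e"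
      proof (rule eventually_mono)
        fix k assume k: "dist (x k) a < e"
        have "norm (\<alpha> t (x k) - \<alpha> t a) \<le> norm (x k - a)" for t
          using star_hom_contractive[OF cstar_subalgebra_UNIV hom, of "x k - a" t]
            star_hom_diff[OF cstar_subalgebra_UNIV hom, of "x k" a t] by simp
        with k show "\<forall>t\<in>UNIV. dist (\<alpha> t (x k)) (\<alpha> t a) < e"
          unfolding dist_norm using le_less_trans by blast
      qed
    qed
    ultimately show ?thesis by (rule uniform_limit_theorem) simp
  qed
  have "flow_spec \<alpha>"
    unfolding flow_spec_def flow_def using bij hom comp orbit E
    by (auto simp: path_pairs_conv cis_conv_exp)
  then show ?thesis by blast
qed

abbreviation "\<alpha> \<equiv> AF_flow G v0 E F"

lemma flow_spec_AF_flow: "flow_spec \<alpha>"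
proof -
  have "\<exists>!\<alpha>. flow_spec \<alpha>" using flow_spec_exists flow_spec_unique by blast
  moreover have "\<alpha> = (THE \<alpha>. flow_spec \<alpha>)" by (simp add: AF_flow_def flow_spec_def)
  ultimately show ?thesis by (metis theI')
qed

lemma flow_AF_flow: "flow \<alpha>"
  using flow_spec_AF_flow by (simp add: flow_spec_def)

lemma AF_flow_E:
  assumes "\<mu> \<in> paths G v0 n" "\<mu>' \<in> paths G v0 n" "rng \<mu> = rng \<mu>'"
  shows "\<alpha> t (E n \<mu> \<mu>') = cis (t * (Fp \<mu> - Fp \<mu>')) *\<^sub>C E n \<mu> \<mu>'"
  using flow_spec_conj[OF flow_spec_AF_flow mu.E_in_alg[OF assms]] conj_flow_E[OF assms] by simp

lemma AF_flow_hom: "star_hom_on UNIV (\<alpha> t)"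
  using flow_AF_flow by (simp add: flow_def)

lemma AF_flow_add: "\<alpha> t (a + b) = \<alpha> t a + \<alpha> t b"
  and AF_flow_mult: "\<alpha> t (a * b) = \<alpha> t a * \<alpha> t b"
  and AF_flow_scaleC: "\<alpha> t (c *\<^sub>C a) = c *\<^sub>C \<alpha> t a"
  and AF_flow_star: "\<alpha> t (star a) = star (\<alpha> t a)"
  using AF_flow_hom by (auto simp: star_hom_on_def)

lemma norm_AF_flow_le: "norm (\<alpha> t a) \<le> norm a"
  using star_hom_contractive[OF cstar_subalgebra_UNIV AF_flow_hom] by simp

lemma AF_flow_one: "\<alpha> t 1 = 1"
  using flow_spec_conj[OF flow_spec_AF_flow mu.one_in_alg, of t 0]
  by (simp add: conj_flow_def unitary_minus)

lemma AF_flow_continuous: "continuous_on S (\<lambda>t. \<alpha> t a)"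
  using flow_AF_flow continuous_on_subset by (fastforce simp: flow_def)

section \<open>The expectation onto the fixed point algebra\<close>

definition avg :: "real \<Rightarrow> 'a \<Rightarrow> 'a" where
  "avg T a = (1 / T) *\<^sub>R integral {0..T} (\<lambda>t. \<alpha> t a)"

abbreviation "R \<equiv> fixed_point_expectation \<alpha>"

abbreviation "Fix \<equiv> fixed_point_algebra \<alpha>"

lemma orbit_integrable: "(\<lambda>t. \<alpha> t a) integrable_on {0..T}"
  by (intro integrable_continuous_interval AF_flow_continuous)

lemma avg_add: "avg T (a + b) = avg T a + avg T b"
  by (simp add: avg_def AF_flow_add integral_add orbit_integrable scaleR_add_right)

lemma avg_scaleC: "avg T (c *\<^sub>C a) = c *\<^sub>C avg T a"
proof -
  have "integral {0..T} (\<lambda>t. c *\<^sub>C \<alpha> t a) = c *\<^sub>C integral {0..T} (\<lambda>t. \<alpha> t a)"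
    using integral_linear[OF orbit_integrable scaleC.bounded_linear_right] by (simp add: o_def)
  then show ?thesis by (simp add: avg_def AF_flow_scaleC scaleC.scaleR_right)
qed

lemma norm_avg_le:
  assumes "T > 0"
  shows "norm (avg T a) \<le> norm a"
proof -
  have "norm (integral {0..T} (\<lambda>t. \<alpha> t a)) \<le> norm a * (T - 0)"
    using assms by (intro integral_bound AF_flow_continuous norm_AF_flow_le) auto
  then show ?thesis using assms by (simp add: avg_def field_simps)
qed

lemma avg_E:
  assumes \<mu>: "\<mu> \<in> paths G v0 n" "\<mu>' \<in> paths G v0 n" "rng \<mu> = rng \<mu>'"
  shows "((\<lambda>T. avg T (E n \<mu> \<mu>')) \<longlongrightarrow> (if Fp \<mu> = Fp \<mu>' then E n \<mu> \<mu>' else 0)) at_top"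
proof (cases "Fp \<mu> = Fp \<mu>'")
  case True
  have "\<forall>\<^sub>F T in at_top. avg T (E n \<mu> \<mu>') = E n \<mu> \<mu>'"
    using eventually_gt_at_top[of 0]
    by eventually_elim (simp add: avg_def AF_flow_E[OF \<mu>] True)
  then show ?thesis using True by (simp add: tendsto_eventually)
next
  case False
  define \<theta> where "\<theta> = Fp \<mu> - Fp \<mu>'"
  have \<theta>: "\<theta> \<noteq> 0" using False by (simp add: \<theta>_def)
  (* The integral of a non-trivial character over [0, T] is bounded independently of T. *)
  have bound: "norm (avg T (E n \<mu> \<mu>')) \<le> (2 / \<bar>\<theta>\<bar>) / T" if T: "T > 0" for T
  proof -
    have "((\<lambda>t. exp (\<i> * \<theta> * complex_of_real t) / (\<i> * \<theta>)) has_vector_derivative exp (\<i> * \<theta> * complex_of_real t))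
        (at t within {0..T})" for t
      by (rule has_vector_derivative_real_field) (use \<theta> in \<open>auto intro!: derivative_eq_intros\<close>)
    then have "((\<lambda>t. exp (\<i> * \<theta> * complex_of_real t)) has_integral
        exp (\<i> * \<theta> * complex_of_real T) / (\<i> * \<theta>) - exp (\<i> * \<theta> * complex_of_real 0) / (\<i> * \<theta>)) {0..T}"
      using T by (intro fundamental_theorem_of_calculus) auto
    then have "((\<lambda>t. cis (t * \<theta>)) has_integral (cis (T * \<theta>) - 1) / (\<i> * \<theta>)) {0..T}"
      by (simp add: cis_conv_exp diff_divide_distrib mult_ac)
    from has_integral_linear[OF this scaleC.bounded_linear_left[of "E n \<mu> \<mu>'"]]
    have "integral {0..T} (\<lambda>t. \<alpha> t (E n \<mu> \<mu>')) = ((cis (T * \<theta>) - 1) / (\<i> * \<theta>)) *\<^sub>C E n \<mu> \<mu>'"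
      by (simp add: o_def AF_flow_E[OF \<mu>] \<theta>_def integral_unique)
    then have "norm (avg T (E n \<mu> \<mu>')) = cmod (cis (T * \<theta>) - 1) / \<bar>\<theta>\<bar> / T"
      using T by (simp add: avg_def norm_scaleC mu.norm_E[OF \<mu>] norm_divide norm_mult)
    moreover have "cmod (cis (T * \<theta>) - 1) \<le> 2"
      using norm_triangle_ineq4[of "cis (T * \<theta>)" 1] by simp
    ultimately show ?thesis using T by (simp add: divide_right_mono)
  qed
  have "((\<lambda>T::real. (2 / \<bar>\<theta>\<bar>) / T) \<longlongrightarrow> 0) at_top"
    by (intro tendsto_divide_0[OF tendsto_const] filterlim_at_top_imp_at_infinity filterlim_ident)
  then have "((\<lambda>T. avg T (E n \<mu> \<mu>')) \<longlongrightarrow> 0) at_top"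
  proof (rule Lim_null_comparison[rotated])
    show "\<forall>\<^sub>F T in at_top. norm (avg T (E n \<mu> \<mu>')) \<le> (2 / \<bar>\<theta>\<bar>) / T"
      using eventually_gt_at_top[of 0] by eventually_elim (rule bound)
  qed
  then show ?thesis using False by simp
qed

text \<open>
  The averages converge on the dense union of the stages and are contractive, so they converge
  everywhere.
\<close>

lemma avg_converges: "\<exists>l. ((\<lambda>T. avg T a) \<longlongrightarrow> l) at_top"
proof -
  have alg: "\<exists>l. ((\<lambda>T. avg T x) \<longlongrightarrow> l) at_top" if "x \<in> AF_union" for x
  proof -
    obtain n where "x \<in> mu.alg n" using \<open>x \<in> AF_union\<close> by (auto simp: AF_union_def)
    then show ?thesis
    proof (induction rule: mu.alg_induct)
      case (unit \<mu> \<mu>')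
      then show ?case using avg_E by blast
    next
      case (add x y)
      then show ?case unfolding avg_add using tendsto_add by blast
    next
      case (scale c x)
      then show ?case unfolding avg_scaleC using scaleC.tendsto[OF tendsto_const] by blast
    qed
  qed
  obtain x where x: "\<And>k. x k \<in> AF_union" "x \<longlonglongrightarrow> a" by (rule AF_union_approx[of a]) blast
  have "\<forall>k. \<exists>l. ((\<lambda>T. avg T (x k)) \<longlongrightarrow> l) at_top" using alg[OF x(1)] by blast
  then obtain l where l: "\<And>k. ((\<lambda>T. avg T (x k)) \<longlongrightarrow> l k) at_top" unfolding choice_iff by blast
  have diff: "avg T (b - c) = avg T b - avg T c" for T b c
    using avg_add[of T "b - c" c] by simp
  have "norm (l j - l k) \<le> norm (x j - x k)" for j k
  proof (rule tendsto_upperbound)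
    show "((\<lambda>T. norm (avg T (x j - x k))) \<longlongrightarrow> norm (l j - l k)) at_top"
      unfolding diff by (intro tendsto_intros l)
    show "\<forall>\<^sub>F T in at_top. norm (avg T (x j - x k)) \<le> norm (x j - x k)"
      using eventually_gt_at_top[of 0] by eventually_elim (rule norm_avg_le)
  qed simp
  moreover have "Cauchy x" using x(2) by (rule LIMSEQ_imp_Cauchy)
  ultimately have "Cauchy l"
    unfolding Cauchy_def dist_norm by (meson le_less_trans)
  then obtain m where m: "l \<longlonglongrightarrow> m" using Cauchy_convergent convergent_def by blast
  have "((\<lambda>T. avg T a) \<longlongrightarrow> m) at_top"
  proof (rule tendstoI)
    fix e :: real assume "e > 0"
    then have e: "e / 3 > 0" by simp
    have "\<forall>\<^sub>F k in sequentially. dist (x k) a < e / 3 \<and> dist (l k) m < e / 3"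
      using tendstoD[OF x(2) e] tendstoD[OF m e] by (rule eventually_conj)
    then obtain k where k: "norm (x k - a) < e / 3" "norm (l k - m) < e / 3"
      by (auto simp: eventually_sequentially dist_norm)
    show "\<forall>\<^sub>F T in at_top. dist (avg T a) m < e"
      using tendstoD[OF l[of k] e] eventually_gt_at_top[of 0]
    proof eventually_elim
      case (elim T)
      have "norm (avg T a - avg T (x k)) \<le> norm (x k - a)"
        using norm_avg_le[OF elim(2), of "a - x k"] by (simp add: diff norm_minus_commute)
      then show ?case
        using elim(1) k norm_triangle_ineq[of "avg T a - avg T (x k)" "avg T (x k) - m"]
          norm_triangle_ineq[of "avg T (x k) - l k" "l k - m"]
        by (simp add: dist_norm)
    qed
  qed
  then show ?thesis by blast
qed

lemma avg_tendsto: "((\<lambda>T. avg T a) \<longlongrightarrow> R a) at_top"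
proof -
  obtain l where l: "((\<lambda>T. avg T a) \<longlongrightarrow> l) at_top" using avg_converges by blast
  have "R a = Lim at_top (\<lambda>T. avg T a)" by (simp add: fixed_point_expectation_def avg_def)
  also have "\<dots> = l" by (rule tendsto_Lim[OF _ l]) simp
  finally show ?thesis using l by simp
qed

lemma R_eqI: "((\<lambda>T. avg T a) \<longlongrightarrow> l) at_top \<Longrightarrow> R a = l"
  using tendsto_unique[OF _ avg_tendsto] by (metis trivial_limit_at_top_linorder)

lemma R_E:
  assumes "\<mu> \<in> paths G v0 n" "\<mu>' \<in> paths G v0 n" "rng \<mu> = rng \<mu>'"
  shows "R (E n \<mu> \<mu>') = (if Fp \<mu> = Fp \<mu>' then E n \<mu> \<mu>' else 0)"
  by (rule R_eqI[OF avg_E[OF assms]])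

lemma R_add: "R (a + b) = R a + R b"
  by (rule R_eqI) (unfold avg_add, intro tendsto_add avg_tendsto)

lemma R_scaleC: "R (c *\<^sub>C a) = c *\<^sub>C R a"
  by (rule R_eqI) (unfold avg_scaleC, intro scaleC.tendsto tendsto_const avg_tendsto)

lemma R_diff: "R (a - b) = R a - R b"
  using R_add[of "a - b" b] by simp

lemma norm_R_le: "norm (R a) \<le> norm a"
proof (rule tendsto_upperbound[OF tendsto_norm[OF avg_tendsto]])
  show "\<forall>\<^sub>F T in at_top. norm (avg T a) \<le> norm a"
    using eventually_gt_at_top[of 0] by eventually_elim (rule norm_avg_le)
qed simp

lemma R_continuous: "continuous_on UNIV R"
  by (rule contraction_continuous_on) (metis norm_R_le R_diff)

lemma R_Fix: "a \<in> Fix \<Longrightarrow> R a = a"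
proof (rule R_eqI)
  assume "a \<in> Fix"
  then have "avg T a = a" if "T > 0" for T
    using that by (simp add: avg_def fixed_point_algebra_def)
  then have "\<forall>\<^sub>F T in at_top. avg T a = a"
    using eventually_gt_at_top[of 0] by (rule eventually_mono[rotated])
  then show "((\<lambda>T. avg T a) \<longlongrightarrow> a) at_top" by (rule tendsto_eventually)
qed

lemma cstar_subalgebra_Fix: "cstar_subalgebra Fix"
proof -
  have "closed {a. \<alpha> t a = a}" for t
    by (intro closed_Collect_eq flow_continuous flow_AF_flow continuous_on_id)
  then have "closed (\<Inter>t. {a. \<alpha> t a = a})" by blast
  moreover have "(\<Inter>t. {a. \<alpha> t a = a}) = Fix" by (auto simp: fixed_point_algebra_def)
  ultimately show ?thesis
    by (auto simp: cstar_subalgebra_def fixed_point_algebra_def AF_flow_add AF_flow_mult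
        AF_flow_scaleC AF_flow_star AF_flow_one)
qed

lemma
  assumes "x \<in> mu.alg n"
  shows R_in_alg: "R x \<in> mu.alg n" and R_alg_in_Fix: "R x \<in> Fix"
    and coef_R: "\<mu> \<in> paths G v0 n \<Longrightarrow> \<mu>' \<in> paths G v0 n \<Longrightarrow>
      mu.coef n (R x) \<mu> \<mu>' = (if Fp \<mu> = Fp \<mu>' then mu.coef n x \<mu> \<mu>' else 0)"
proof -
  note Fix = cstar_subalgebraD[OF cstar_subalgebra_Fix]
  have "R x \<in> mu.alg n \<and> R x \<in> Fix \<and> (\<forall>\<mu>\<in>paths G v0 n. \<forall>\<mu>'\<in>paths G v0 n.
      mu.coef n (R x) \<mu> \<mu>' = (if Fp \<mu> = Fp \<mu>' then mu.coef n x \<mu> \<mu>' else 0))"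
    using assms
  proof (induction rule: mu.alg_induct)
    case (unit \<mu> \<mu>')
    have "mu.coef n 0 \<nu> \<nu>' = 0" if "\<nu> \<in> paths G v0 n" "\<nu>' \<in> paths G v0 n" for \<nu> \<nu>'
      using mu.coef_scaleC[OF mu.zero_in_alg that, of 0] by simp
    moreover have "E n \<mu> \<mu>' \<in> Fix" if "Fp \<mu> = Fp \<mu>'"
      using that by (simp add: fixed_point_algebra_def AF_flow_E[OF unit])
    ultimately show ?case
      using unit by (auto simp: R_E mu.E_in_alg mu.zero_in_alg mu.coef_E Fix)
  next
    case (add x y)
    then show ?case by (auto simp: R_add mu.add_in_alg mu.coef_add intro: Fix)
  next
    case (scale c x)
    then show ?case by (auto simp: R_scaleC mu.scaleC_in_alg mu.coef_scaleC intro: Fix)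
  qed
  then show "R x \<in> mu.alg n" "R x \<in> Fix" "\<mu> \<in> paths G v0 n \<Longrightarrow> \<mu>' \<in> paths G v0 n \<Longrightarrow>
      mu.coef n (R x) \<mu> \<mu>' = (if Fp \<mu> = Fp \<mu>' then mu.coef n x \<mu> \<mu>' else 0)"
    by blast+
qed

lemma R_in_Fix: "R a \<in> Fix"
proof -
  obtain x where x: "\<And>k. x k \<in> AF_union" "x \<longlonglongrightarrow> a" by (rule AF_union_approx[of a]) blast
  show ?thesis
  proof (rule closed_sequentially[OF cstar_subalgebraD(1)[OF cstar_subalgebra_Fix]])
    show "(\<lambda>k. R (x k)) \<longlonglongrightarrow> R a"
      using continuous_on_tendsto_compose[OF R_continuous x(2)] by simp
    show "R (x k) \<in> Fix" for k using x(1)[of k] R_alg_in_Fix by (auto simp: AF_union_def)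
  qed
qed

lemma coef_Fix:
  assumes "x \<in> mu.alg n" "x \<in> Fix" "\<mu> \<in> paths G v0 n" "\<mu>' \<in> paths G v0 n" "Fp \<mu> \<noteq> Fp \<mu>'"
  shows "mu.coef n x \<mu> \<mu>' = 0"
  using coef_R[OF assms(1,3,4)] assms(5) by (simp add: R_Fix[OF assms(2)])

lemma cstar_subalgebra_stage: "cstar_subalgebra (mu.alg n \<inter> Fix)"
  using mu.cstar_subalgebra_alg[of n] cstar_subalgebra_Fix
  by (auto simp: cstar_subalgebra_def)

lemma stages_dense_in_Fix: "closure (\<Union>n. mu.alg n \<inter> Fix) = Fix"
proof
  show "closure (\<Union>n. mu.alg n \<inter> Fix) \<subseteq> Fix"
    by (rule closure_minimal) (auto intro: cstar_subalgebraD(1)[OF cstar_subalgebra_Fix])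
  show "Fix \<subseteq> closure (\<Union>n. mu.alg n \<inter> Fix)"
  proof
    fix a assume a: "a \<in> Fix"
    obtain x where x: "\<And>k. x k \<in> AF_union" "x \<longlonglongrightarrow> a" by (rule AF_union_approx[of a]) blast
    have lim: "(\<lambda>k. R (x k)) \<longlonglongrightarrow> R a"
      using continuous_on_tendsto_compose[OF R_continuous x(2)] by simp
    have "R (x k) \<in> (\<Union>n. mu.alg n \<inter> Fix)" for k
    proof -
      obtain n where "x k \<in> mu.alg n" using x(1)[of k] by (auto simp: AF_union_def)
      then show ?thesis using R_alg_in_Fix R_in_alg by blast
    qed
    with lim show "a \<in> closure (\<Union>n. mu.alg n \<inter> Fix)"
      unfolding closure_sequential by (intro exI[of _ "\<lambda>k. R (x k)"]) (simp add: R_Fix[OF a])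
  qed
qed

end

section \<open>The quotient map onto the algebra of the geodesic subdiagram\<close>

locale geodesic_AF = bratteli_potential Br lvl v0 F
  for Br :: "('v, 'e) pre_digraph" and lvl :: "nat \<Rightarrow> 'v set" and v0 :: 'v and F :: "'e \<Rightarrow> real" +
  fixes E :: "nat \<Rightarrow> 'e list \<Rightarrow> 'e list \<Rightarrow> 'a::cstar_algebra"
    and E' :: "nat \<Rightarrow> 'e list \<Rightarrow> 'e list \<Rightarrow> 'b::cstar_algebra"
  assumes AF: "AF_algebra Br v0 E"
    and AF': "AF_algebra (geodesic_subdiagram Br v0 F) v0 E'"
begin

sublocale A: af_flow Br v0 E F
  by (intro af_flow.intro af_system.intro af_system_axioms.intro wf_digraph_axioms AF finite_paths)

sublocale B: af_system subdiag v0 E'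
  by (intro af_system.intro af_system_axioms.intro sub.wf_digraph_axioms AF' finite_sub_paths)

abbreviation "P n \<equiv> paths Br v0 n"

abbreviation "G n \<equiv> paths subdiag v0 n"

abbreviation "rng \<equiv> path_range Br v0"

abbreviation "Fp \<equiv> path_potential F"

lemma sub_coef_unrelated: "rng \<mu> \<noteq> rng \<mu>' \<Longrightarrow> B.mu.coef n y \<mu> \<mu>' = 0"
  by (rule B.mu.coef_unrelated) (simp only: subdiag_path_range not_False_eq_True)

lemma
  assumes "\<mu> \<in> G n" "\<mu>' \<in> G n" "rng \<mu> = rng \<mu>'"
  shows sub_E_in_alg: "E' n \<mu> \<mu>' \<in> B.mu.alg n"
    and sub_coef_E: "\<nu> \<in> G n \<Longrightarrow> \<nu>' \<in> G n \<Longrightarrow>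
      B.mu.coef n (E' n \<mu> \<mu>') \<nu> \<nu>' = (if \<nu> = \<mu> \<and> \<nu>' = \<mu>' then 1 else 0)"
proof -
  have rng: "B.rng \<mu> = B.rng \<mu>'" using assms(3) by (simp add: subdiag_path_range)
  show "E' n \<mu> \<mu>' \<in> B.mu.alg n" by (rule B.mu.E_in_alg[OF assms(1,2) rng])
  show "\<nu> \<in> G n \<Longrightarrow> \<nu>' \<in> G n \<Longrightarrow>
      B.mu.coef n (E' n \<mu> \<mu>') \<nu> \<nu>' = (if \<nu> = \<mu> \<and> \<nu>' = \<mu>' then 1 else 0)"
    by (rule B.mu.coef_E[OF assms(1,2) rng])
qed

lemma G_P: "\<mu> \<in> G n \<Longrightarrow> \<mu> \<in> P n"
  using sub_paths_subset by blast

lemma G_exchange: "\<lbrakk>\<mu> \<in> G n; \<mu>' \<in> P n; rng \<mu> = rng \<mu>'; Fp \<mu> = Fp \<mu>'\<rbrakk> \<Longrightarrow> \<mu>' \<in> G n"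
  using sub_path_exchange by simp

lemma G_potential_eq:
  assumes "\<mu> \<in> G n" "\<mu>' \<in> G n" "rng \<mu> = rng \<mu>'"
  shows "Fp \<mu> = Fp \<mu>'"
  using sub_path_minimal[OF assms(1)] sub_path_minimal[OF assms(2)] assms G_P length_path
  unfolding minimal_def by (metis order_antisym)

lemma snoc_in_G_iff:
  "\<mu> @ [a] \<in> G (Suc n) \<longleftrightarrow> \<mu> \<in> G n \<and> a \<in> out_arcs subdiag (rng \<mu>)"
  using sub.snoc_in_paths_iff[of \<mu> a v0 n] by (simp only: subdiag_path_range)

lemma out_arcs_sub: "out_arcs subdiag v \<subseteq> out_arcs Br v"
  by (auto simp: subdiag_simps)

text \<open>
  The compression to the corner of the geodesic paths, with values in the algebra of the subdiagram.
  It is linear and compatible with the inclusions of the stages, and it is multiplicative on the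
  fixed points of the flow: a matrix entry of a fixed point can only link two paths with the same
  range and the same potential, and if one of them belongs to the subdiagram, so does the other.
\<close>

definition corner :: "nat \<Rightarrow> 'a \<Rightarrow> 'b" where
  "corner n x = (\<Sum>\<mu>\<in>G n. \<Sum>\<mu>'\<in>G n. A.mu.coef n x \<mu> \<mu>' *\<^sub>C E' n \<mu> \<mu>')"

lemma corner_in_alg: "corner n x \<in> B.mu.alg n"
  unfolding corner_def
  by (rule B.mu.combination_in_alg) (simp add: subdiag_path_range A.mu.coef_unrelated)

lemma coef_corner: "\<lbrakk>\<mu> \<in> G n; \<mu>' \<in> G n\<rbrakk> \<Longrightarrow> B.mu.coef n (corner n x) \<mu> \<mu>' = A.mu.coef n x \<mu> \<mu>'"
  unfolding corner_def
  by (rule B.mu.coef_combination) (simp_all add: subdiag_path_range A.mu.coef_unrelated)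

lemma corner_add:
  "x \<in> A.mu.alg n \<Longrightarrow> y \<in> A.mu.alg n \<Longrightarrow> corner n (x + y) = corner n x + corner n y"
  by (rule B.mu.alg_eqI[where n = n])
    (auto simp: corner_in_alg B.mu.add_in_alg B.mu.coef_add coef_corner A.mu.coef_add G_P)

lemma corner_scaleC: "x \<in> A.mu.alg n \<Longrightarrow> corner n (c *\<^sub>C x) = c *\<^sub>C corner n x"
  by (rule B.mu.alg_eqI[where n = n])
    (auto simp: corner_in_alg B.mu.scaleC_in_alg B.mu.coef_scaleC coef_corner A.mu.coef_scaleC G_P)

lemma corner_star: "x \<in> A.mu.alg n \<Longrightarrow> corner n (star x) = star (corner n x)"
  by (rule B.mu.alg_eqI[where n = n])
    (auto simp: corner_in_alg B.mu.star_in_alg B.mu.coef_star coef_corner A.mu.coef_star G_P)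

lemma corner_one: "corner n 1 = 1"
  by (rule B.mu.alg_eqI[where n = n])
    (auto simp: corner_in_alg B.mu.one_in_alg B.mu.coef_one coef_corner A.mu.coef_one G_P)

lemma corner_mult:
  assumes x: "x \<in> A.mu.alg n" "x \<in> A.Fix" and y: "y \<in> A.mu.alg n"
  shows "corner n (x * y) = corner n x * corner n y"
proof (rule B.mu.alg_eqI[where n = n])
  fix \<mu> \<mu>' assume \<mu>: "\<mu> \<in> G n" "\<mu>' \<in> G n"
  have "A.mu.coef n x \<mu> \<nu> = 0" if "\<nu> \<in> P n - G n" for \<nu>
    using A.coef_Fix[OF x, of \<mu> \<nu>] A.mu.coef_unrelated[of \<mu> \<nu>] G_exchange[OF \<mu>(1)] G_P[OF \<mu>(1)] that
    by blast
  then have "(\<Sum>\<nu>\<in>P n. A.mu.coef n x \<mu> \<nu> * A.mu.coef n y \<nu> \<mu>') =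
      (\<Sum>\<nu>\<in>G n. A.mu.coef n x \<mu> \<nu> * A.mu.coef n y \<nu> \<mu>')"
    by (intro sum.mono_neutral_right finite_paths sub_paths_subset) auto
  then show "B.mu.coef n (corner n (x * y)) \<mu> \<mu>' = B.mu.coef n (corner n x * corner n y) \<mu> \<mu>'"
    using \<mu> by (simp add: coef_corner A.mu.coef_mult x y G_P B.mu.coef_mult corner_in_alg)
qed (auto intro: corner_in_alg B.mu.mult_in_alg)

lemma corner_E:
  assumes "\<mu> \<in> P n" "\<mu>' \<in> P n" "rng \<mu> = rng \<mu>'"
  shows "corner n (E n \<mu> \<mu>') = (if \<mu> \<in> G n \<and> \<mu>' \<in> G n then E' n \<mu> \<mu>' else 0)"
proof (rule B.mu.alg_eqI[where n = n])
  show "(if \<mu> \<in> G n \<and> \<mu>' \<in> G n then E' n \<mu> \<mu>' else 0) \<in> B.mu.alg n"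
    using assms by (auto intro: sub_E_in_alg B.mu.zero_in_alg)
  fix \<nu> \<nu>' assume \<nu>: "\<nu> \<in> G n" "\<nu>' \<in> G n"
  have 0: "B.mu.coef n 0 \<nu> \<nu>' = 0" using B.mu.coef_scaleC[OF B.mu.zero_in_alg \<nu>, of 0] by simp
  show "B.mu.coef n (corner n (E n \<mu> \<mu>')) \<nu> \<nu>' =
      B.mu.coef n (if \<mu> \<in> G n \<and> \<mu>' \<in> G n then E' n \<mu> \<mu>' else 0) \<nu> \<nu>'"
    using \<nu> assms by (auto simp: coef_corner A.mu.coef_E sub_coef_E 0 G_P)
qed (rule corner_in_alg)

lemma corner_sum:
  "(\<And>i. i \<in> I \<Longrightarrow> f i \<in> A.mu.alg n) \<Longrightarrow> corner n (sum f I) = (\<Sum>i\<in>I. corner n (f i))"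
proof (induction I rule: infinite_finite_induct)
  case (insert i I)
  then show ?case by (simp add: corner_add A.mu.sum_in_alg)
qed (use corner_scaleC[OF A.mu.zero_in_alg, of n 0] in simp_all)

lemma corner_Suc:
  assumes "x \<in> A.mu.alg n"
  shows "corner (Suc n) x = corner n x"
  using assms
proof (rule A.mu.hom_on_algI[rotated -1])
  fix \<mu> \<mu>' assume \<mu>: "\<mu> \<in> P n" "\<mu>' \<in> P n" "rng \<mu> = rng \<mu>'"
  let ?O = "out_arcs Br (rng \<mu>)" and ?O' = "out_arcs subdiag (rng \<mu>)"
  have fin: "finite ?O" using emits path_range_in_verts[OF \<mu>(1)] by blast
  have snoc: "\<mu> @ [a] \<in> P (Suc n)" "\<mu>' @ [a] \<in> P (Suc n)" if "a \<in> ?O" for a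
    using that \<mu> by (simp_all add: snoc_in_paths_iff)
  have "corner (Suc n) (E n \<mu> \<mu>') = (\<Sum>a\<in>?O. corner (Suc n) (E (Suc n) (\<mu> @ [a]) (\<mu>' @ [a])))"
    unfolding A.refine[OF \<mu>] by (rule corner_sum) (auto intro!: A.mu.E_in_alg snoc simp: path_range_snoc)
  also have "\<dots> = (\<Sum>a\<in>?O. if \<mu> \<in> G n \<and> \<mu>' \<in> G n \<and> a \<in> ?O'
      then E' (Suc n) (\<mu> @ [a]) (\<mu>' @ [a]) else 0)"
    by (rule sum.cong[OF refl], subst corner_E)
      (use \<mu> snoc snoc_in_G_iff in \<open>auto simp: path_range_snoc\<close>)
  also have "\<dots> = (if \<mu> \<in> G n \<and> \<mu>' \<in> G n then \<Sum>a\<in>?O'. E' (Suc n) (\<mu> @ [a]) (\<mu>' @ [a]) else 0)"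
  proof (cases "\<mu> \<in> G n \<and> \<mu>' \<in> G n")
    case True
    have "?O \<inter> ?O' = ?O'" using out_arcs_sub by blast
    with True show ?thesis
      using sum.inter_restrict[OF fin, of "\<lambda>a. E' (Suc n) (\<mu> @ [a]) (\<mu>' @ [a])" ?O']
      by (simp del: in_out_arcs_conv)
  qed auto
  also have "\<dots> = corner n (E n \<mu> \<mu>')"
    using B.refine[of \<mu> n \<mu>'] \<mu> by (simp add: corner_E subdiag_path_range)
  finally show "corner (Suc n) (E n \<mu> \<mu>') = corner n (E n \<mu> \<mu>')" .
qed (use A.alg_Suc in \<open>auto intro: corner_add corner_scaleC\<close>)

text \<open>
  The embedding of the stages of the subdiagram as corners splits the compression without increasing
  norms. This gives the surjectivity of the quotient map in the limit.
\<close>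

definition lift :: "nat \<Rightarrow> 'b \<Rightarrow> 'a" where
  "lift n y = (\<Sum>\<mu>\<in>P n. \<Sum>\<mu>'\<in>P n.
     (if \<mu> \<in> G n \<and> \<mu>' \<in> G n then B.mu.coef n y \<mu> \<mu>' else 0) *\<^sub>C E n \<mu> \<mu>')"

lemma lift_in_alg: "lift n y \<in> A.mu.alg n"
  unfolding lift_def
  by (rule A.mu.combination_in_alg) (simp add: sub_coef_unrelated)

lemma coef_lift: "\<lbrakk>\<mu> \<in> P n; \<mu>' \<in> P n\<rbrakk> \<Longrightarrow>
    A.mu.coef n (lift n y) \<mu> \<mu>' = (if \<mu> \<in> G n \<and> \<mu>' \<in> G n then B.mu.coef n y \<mu> \<mu>' else 0)"
  unfolding lift_def
  by (rule A.mu.coef_combination) (simp_all add: sub_coef_unrelated)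

lemma lift_in_Fix: "lift n y \<in> A.Fix"
proof -
  have "A.R (lift n y) = lift n y"
  proof (rule A.mu.alg_eqI[where n = n])
    fix \<mu> \<mu>' assume "\<mu> \<in> P n" "\<mu>' \<in> P n" "rng \<mu> = rng \<mu>'"
    then show "A.mu.coef n (A.R (lift n y)) \<mu> \<mu>' = A.mu.coef n (lift n y) \<mu> \<mu>'"
      using G_potential_eq by (auto simp: A.coef_R[OF lift_in_alg] coef_lift)
  qed (auto intro: lift_in_alg A.R_in_alg)
  then show ?thesis using A.R_in_Fix[of "lift n y"] by simp
qed

lemma corner_lift: "y \<in> B.mu.alg n \<Longrightarrow> corner n (lift n y) = y"
  by (rule B.mu.alg_eqI[where n = n]) (auto simp: corner_in_alg coef_corner coef_lift G_P)

lemma norm_lift_le: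
  assumes "y \<in> B.mu.alg n"
  shows "norm (lift n y) \<le> norm y"
proof (rule star_hom_contractive[OF B.mu.cstar_subalgebra_alg _ assms])
  show "star_hom_on (B.mu.alg n) (lift n)"
    unfolding star_hom_on_def
  proof (intro conjI ballI allI)
    fix x y assume xy: "x \<in> B.mu.alg n" "y \<in> B.mu.alg n"
    show "lift n (x + y) = lift n x + lift n y"
      by (rule A.mu.alg_eqI[where n = n]) (auto simp: lift_in_alg A.mu.add_in_alg A.mu.coef_add coef_lift
          B.mu.coef_add xy)
    show "lift n (x * y) = lift n x * lift n y"
    proof (rule A.mu.alg_eqI[where n = n])
      fix \<mu> \<mu>' assume \<mu>: "\<mu> \<in> P n" "\<mu>' \<in> P n"
      have "(\<Sum>\<nu>\<in>P n. A.mu.coef n (lift n x) \<mu> \<nu> * A.mu.coef n (lift n y) \<nu> \<mu>') =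
          (\<Sum>\<nu>\<in>G n. A.mu.coef n (lift n x) \<mu> \<nu> * A.mu.coef n (lift n y) \<nu> \<mu>')"
        by (intro sum.mono_neutral_right finite_paths sub_paths_subset) (auto simp: coef_lift \<mu>)
      also have "\<dots> = (\<Sum>\<nu>\<in>G n. if \<mu> \<in> G n \<and> \<mu>' \<in> G n
          then B.mu.coef n x \<mu> \<nu> * B.mu.coef n y \<nu> \<mu>' else 0)"
        by (rule sum.cong) (auto simp: coef_lift \<mu> G_P)
      finally show "A.mu.coef n (lift n (x * y)) \<mu> \<mu>' = A.mu.coef n (lift n x * lift n y) \<mu> \<mu>'"
        using \<mu> by (auto simp: A.mu.coef_mult lift_in_alg coef_lift[of \<mu> n \<mu>' "x * y"]
            B.mu.coef_mult xy)
    qed (auto intro: lift_in_alg A.mu.mult_in_alg)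
  next
    fix c x assume x: "x \<in> B.mu.alg n"
    show "lift n (c *\<^sub>C x) = c *\<^sub>C lift n x"
      by (rule A.mu.alg_eqI[where n = n]) (auto simp: lift_in_alg A.mu.scaleC_in_alg A.mu.coef_scaleC coef_lift
          B.mu.coef_scaleC x)
    show "lift n (star x) = star (lift n x)"
      by (rule A.mu.alg_eqI[where n = n]) (auto simp: lift_in_alg A.mu.star_in_alg A.mu.coef_star coef_lift
          B.mu.coef_star x)
  qed
qed

text \<open>
  The defining property of the quotient map, and its reformulation by which the identification of
  corners prescribes the values on the fixed points of each stage.
\<close>

definition is_quotient :: "('a \<Rightarrow> 'b) \<Rightarrow> bool" where
  "is_quotient q \<longleftrightarrow> star_hom_on A.Fix q \<and> q 1 = 1 \<and> q ` A.Fix = UNIV \<and>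
     (\<forall>n. \<forall>a \<in> AF_alg Br v0 E n \<inter> A.Fix.
        corner_identified Br v0 E E' F n
          (geodesic_projection Br v0 E F n * a * geodesic_projection Br v0 E F n) (q a))"

lemma sum_sub_pairs:
  assumes "\<And>\<mu> \<mu>'. rng \<mu> \<noteq> rng \<mu>' \<Longrightarrow> f \<mu> \<mu>' = 0"
  shows "(\<Sum>(\<mu>, \<mu>')\<in>path_pairs subdiag v0 n. f \<mu> \<mu>') = (\<Sum>\<mu>\<in>G n. \<Sum>\<mu>'\<in>G n. f \<mu> \<mu>')"
proof -
  have "(\<Sum>(\<mu>, \<mu>')\<in>path_pairs subdiag v0 n. f \<mu> \<mu>') = (\<Sum>(\<mu>, \<mu>')\<in>G n \<times> G n. f \<mu> \<mu>')"
    by (rule sum.mono_neutral_left)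
      (use assms finite_sub_paths in \<open>auto simp: path_pairs_def subdiag_path_range\<close>)
  then show ?thesis by (simp add: sum.cartesian_product)
qed

lemma projection_corner:
  assumes "a \<in> A.mu.alg n"
  shows "geodesic_projection Br v0 E F n * a * geodesic_projection Br v0 E F n =
    (\<Sum>(\<mu>, \<mu>')\<in>path_pairs subdiag v0 n. A.mu.coef n a \<mu> \<mu>' *\<^sub>C E n \<mu> \<mu>')"
proof -
  have "geodesic_projection Br v0 E F n * a * geodesic_projection Br v0 E F n =
      (\<Sum>\<mu>\<in>G n. \<Sum>\<mu>'\<in>G n. E n \<mu> \<mu> * a * E n \<mu>' \<mu>')"
    unfolding geodesic_projection_def sum_distrib_right unfolding sum_distrib_left ..
  also have "\<dots> = (\<Sum>\<mu>\<in>G n. \<Sum>\<mu>'\<in>G n. A.mu.coef n a \<mu> \<mu>' *\<^sub>C E n \<mu> \<mu>')"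
    by (intro sum.cong refl A.mu.corner_eq assms G_P)
  also have "\<dots> = (\<Sum>(\<mu>, \<mu>')\<in>path_pairs subdiag v0 n. A.mu.coef n a \<mu> \<mu>' *\<^sub>C E n \<mu> \<mu>')"
    by (rule sum_sub_pairs[symmetric]) (simp add: A.mu.coef_unrelated)
  finally show ?thesis .
qed

lemma coef_sub_pairs:
  assumes \<mu>: "\<mu> \<in> G n" "\<mu>' \<in> G n" "rng \<mu> = rng \<mu>'"
  shows "A.mu.coef n (\<Sum>(\<mu>, \<mu>')\<in>path_pairs subdiag v0 n. c \<mu> \<mu>' *\<^sub>C E n \<mu> \<mu>') \<mu> \<mu>' = c \<mu> \<mu>'"
proof (rule A.mu.coefI)
  have fin: "finite (path_pairs subdiag v0 n)"
    by (rule finite_subset[of _ "G n \<times> G n"]) (auto simp: path_pairs_def finite_sub_paths)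
  have "E n \<mu> \<mu> * (\<Sum>(\<nu>, \<nu>')\<in>path_pairs subdiag v0 n. c \<nu> \<nu>' *\<^sub>C E n \<nu> \<nu>') * E n \<mu>' \<mu>' =
      (\<Sum>p\<in>path_pairs subdiag v0 n. if p = (\<mu>, \<mu>') then c \<mu> \<mu>' *\<^sub>C E n \<mu> \<mu>' else 0)"
    unfolding sum_distrib_left sum_distrib_right
  proof (rule sum.cong[OF refl])
    fix p assume "p \<in> path_pairs subdiag v0 n"
    then obtain \<nu> \<nu>' where p: "p = (\<nu>, \<nu>')" "\<nu> \<in> P n" "\<nu>' \<in> P n" "rng \<nu> = rng \<nu>'"
      using G_P by (auto simp: path_pairs_def subdiag_path_range)
    show "E n \<mu> \<mu> * (case p of (\<nu>, \<nu>') \<Rightarrow> c \<nu> \<nu>' *\<^sub>C E n \<nu> \<nu>') * E n \<mu>' \<mu>' =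
        (if p = (\<mu>, \<mu>') then c \<mu> \<mu>' *\<^sub>C E n \<mu> \<mu>' else 0)"
      using A.mu.corner_E[OF p(2-4) G_P[OF \<mu>(1)] G_P[OF \<mu>(2)]]
      by (auto simp: p(1) mult_scaleC_left mult_scaleC_right)
  qed
  also have "\<dots> = c \<mu> \<mu>' *\<^sub>C E n \<mu> \<mu>'"
    using fin \<mu> by (simp add: sum.delta path_pairs_def subdiag_path_range)
  finally show "E n \<mu> \<mu> * (\<Sum>(\<mu>, \<mu>')\<in>path_pairs subdiag v0 n. c \<mu> \<mu>' *\<^sub>C E n \<mu> \<mu>') * E n \<mu>' \<mu>' =
      c \<mu> \<mu>' *\<^sub>C E n \<mu> \<mu>'" .
qed (use \<mu> G_P in auto)

lemma corner_identified_iff: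
  assumes "a \<in> A.mu.alg n"
  shows "corner_identified Br v0 E E' F n
    (geodesic_projection Br v0 E F n * a * geodesic_projection Br v0 E F n) y \<longleftrightarrow> y = corner n a"
proof
  assume "corner_identified Br v0 E E' F n
    (geodesic_projection Br v0 E F n * a * geodesic_projection Br v0 E F n) y"
  then obtain c where c: "(\<Sum>(\<mu>, \<mu>')\<in>path_pairs subdiag v0 n. A.mu.coef n a \<mu> \<mu>' *\<^sub>C E n \<mu> \<mu>') =
      (\<Sum>(\<mu>, \<mu>')\<in>path_pairs subdiag v0 n. c \<mu> \<mu>' *\<^sub>C E n \<mu> \<mu>')"
    "y = (\<Sum>(\<mu>, \<mu>')\<in>path_pairs subdiag v0 n. c \<mu> \<mu>' *\<^sub>C E' n \<mu> \<mu>')"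
    unfolding corner_identified_def projection_corner[OF assms] by blast
  have "c \<mu> \<mu>' = A.mu.coef n a \<mu> \<mu>'" if "(\<mu>, \<mu>') \<in> path_pairs subdiag v0 n" for \<mu> \<mu>'
    using that coef_sub_pairs[of \<mu> n \<mu>' c] coef_sub_pairs[of \<mu> n \<mu>' "A.mu.coef n a"] c(1)
    by (simp add: path_pairs_def subdiag_path_range)
  then have "y = (\<Sum>(\<mu>, \<mu>')\<in>path_pairs subdiag v0 n. A.mu.coef n a \<mu> \<mu>' *\<^sub>C E' n \<mu> \<mu>')"
    unfolding c(2) by (intro sum.cong) auto
  also have "\<dots> = corner n a"
    unfolding corner_def by (rule sum_sub_pairs) (simp add: A.mu.coef_unrelated)
  finally show "y = corner n a" .
next
  assume "y = corner n a"
  then have "y = (\<Sum>(\<mu>, \<mu>')\<in>path_pairs subdiag v0 n. A.mu.coef n a \<mu> \<mu>' *\<^sub>C E' n \<mu> \<mu>')"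
    by (subst sum_sub_pairs) (simp_all add: A.mu.coef_unrelated corner_def)
  then show "corner_identified Br v0 E E' F n
    (geodesic_projection Br v0 E F n * a * geodesic_projection Br v0 E F n) y"
    unfolding corner_identified_def projection_corner[OF assms] by blast
qed

lemma is_quotient_iff: "is_quotient q \<longleftrightarrow> star_hom_on A.Fix q \<and> q 1 = 1 \<and> q ` A.Fix = UNIV \<and>
    (\<forall>n. \<forall>a \<in> A.mu.alg n \<inter> A.Fix. q a = corner n a)"
  unfolding is_quotient_def A.AF_alg_eq using corner_identified_iff by blast

text \<open>
  The compressions of the stages extend to the fixed point algebra. For the surjectivity, an element
  is written as a series of elements of the stages with geometrically decreasing norms, and this
  series is lifted.
\<close>

lemma quotient_exists: "\<exists>q. is_quotient q"
proof -
  define S where "S n = A.mu.alg n \<inter> A.Fix" for n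
  note SD = cstar_subalgebraD[OF A.cstar_subalgebra_stage, folded S_def]
  have hom: "star_hom_on (S n) (corner n)" for n
    by (auto simp: star_hom_on_def S_def corner_add corner_mult corner_scaleC corner_star)
  have S_mono: "S n \<subseteq> S (Suc n)" for n using A.alg_Suc by (auto simp: S_def)
  obtain q where cont: "continuous_on (closure (\<Union>n. S n)) q"
    and q: "\<And>n x. x \<in> S n \<Longrightarrow> q x = corner n x"
  proof (rule extend_from_chain[of S corner])
    show "corner (Suc n) x = corner n x" if "x \<in> S n" for n x
      using that by (intro corner_Suc) (simp add: S_def)
    fix n x y assume xy: "x \<in> S n" "y \<in> S n"
    then have "corner n x - corner n y = corner n (x - y)"
      using star_hom_diff[OF A.cstar_subalgebra_stage hom[unfolded S_def]] by (simp add: S_def)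
    then show "norm (corner n x - corner n y) \<le> norm (x - y)"
      using star_hom_contractive[OF A.cstar_subalgebra_stage[folded S_def] hom SD(8)[OF xy]] by simp
  qed (use S_mono in auto)
  have dense: "closure (\<Union>n. S n) = A.Fix" unfolding S_def by (rule A.stages_dense_in_Fix)
  have "star_hom_on (closure (\<Union>n. S n)) q"
  proof (rule star_hom_on_closure[OF cont])
    have pair: "\<exists>n. a \<in> S n \<and> b \<in> S n" if ab: "a \<in> (\<Union>n. S n)" "b \<in> (\<Union>n. S n)" for a b
    proof -
      have "a \<in> A.AF_union" "b \<in> A.AF_union" using ab by (auto simp: S_def A.AF_union_def)
      then obtain n where "a \<in> A.mu.alg n" "b \<in> A.mu.alg n" by (rule A.AF_union_pair)
      with ab show ?thesis by (auto simp: S_def)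
    qed
    have two: "a + b \<in> (\<Union>n. S n) \<and> a * b \<in> (\<Union>n. S n) \<and> q (a + b) = q a + q b \<and> q (a * b) = q a * q b"
      if ab: "a \<in> (\<Union>n. S n)" "b \<in> (\<Union>n. S n)" for a b
    proof -
      obtain n where n: "a \<in> S n" "b \<in> S n" using pair[OF ab] by blast
      then show ?thesis
        using hom[of n] SD(3)[OF n] SD(4)[OF n] by (auto simp: q star_hom_on_def)
    qed
    have one: "c *\<^sub>C a \<in> (\<Union>n. S n) \<and> star a \<in> (\<Union>n. S n) \<and> q (c *\<^sub>C a) = c *\<^sub>C q a \<and> q (star a) = star (q a)"
      if "a \<in> (\<Union>n. S n)" for a c
    proof -
      obtain n where n: "a \<in> S n" using \<open>a \<in> (\<Union>n. S n)\<close> by blast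
      then show ?thesis
        using hom[of n] SD(5)[OF n, of c] SD(6)[OF n] by (auto simp: q star_hom_on_def)
    qed
    show "star_hom_on (\<Union>n. S n) q" unfolding star_hom_on_def using one two by blast
    show "a + b \<in> (\<Union>n. S n) \<and> a * b \<in> (\<Union>n. S n)" if "a \<in> (\<Union>n. S n)" "b \<in> (\<Union>n. S n)" for a b
      using two[OF that] by blast
    show "c *\<^sub>C a \<in> (\<Union>n. S n)" "star a \<in> (\<Union>n. S n)" if "a \<in> (\<Union>n. S n)" for a c
      using one[OF that] by blast+
  qed
  then have qhom: "star_hom_on A.Fix q" by (simp only: dense)
  have q1: "q 1 = 1" using q[of 1 0] SD(2)[of 0] by (simp add: corner_one)
  have "y \<in> q ` A.Fix" for y
  proof -
    have "\<exists>z\<in>B.AF_union. norm (y - z) < (1/2) ^ k" for k :: nat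
    proof -
      have "y \<in> closure B.AF_union" by (simp add: B.AF_union_dense)
      then have "\<exists>z\<in>B.AF_union. dist z y < (1/2) ^ k" by (simp add: closure_approachable)
      then show ?thesis by (simp add: dist_norm norm_minus_commute)
    qed
    then obtain z where z: "\<And>k. z k \<in> B.AF_union" "\<And>k. norm (y - z k) < (1/2) ^ k" by metis
    \<comment> \<open>The limit \<open>y\<close> is the sum of the increments \<open>d k\<close>, which lie in the stages and decay
      geometrically; so do their lifts.\<close>
    define d where "d k = (case k of 0 \<Rightarrow> z 0 | Suc j \<Rightarrow> z (Suc j) - z j)" for k
    have dsum: "(\<Sum>i\<le>k. d i) = z k" for k by (induction k) (simp_all add: d_def)
    have "\<exists>x\<in>A.Fix. q x = d k \<and> norm x \<le> norm (d k)" for k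
    proof -
      have "d k \<in> B.AF_union"
      proof (cases k)
        case (Suc j)
        have "z (Suc j) + (-1) *\<^sub>C z j \<in> B.AF_union" by (intro B.AF_union_closed z)
        then show ?thesis by (simp add: Suc d_def scaleC.minus_left)
      qed (simp add: d_def z)
      then obtain n where n: "d k \<in> B.mu.alg n" by (auto simp: B.AF_union_def)
      have "lift n (d k) \<in> S n" by (simp add: S_def lift_in_alg lift_in_Fix)
      then show ?thesis
        using n q corner_lift norm_lift_le lift_in_Fix by (intro bexI[of _ "lift n (d k)"]) auto
    qed
    then obtain x where x: "\<And>k. x k \<in> A.Fix" "\<And>k. q (x k) = d k" "\<And>k. norm (x k) \<le> norm (d k)"
      by metis
    have d_le: "norm (d (Suc j)) \<le> 2 * (1/2) ^ j" for j
    proof -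
      have "norm (d (Suc j)) = norm ((y - z j) - (y - z (Suc j)))" by (simp add: d_def)
      also have "\<dots> \<le> norm (y - z j) + norm (y - z (Suc j))" by (rule norm_triangle_ineq4)
      also have "\<dots> \<le> 2 * (1/2) ^ j"
        using z(2)[of j] z(2)[of "Suc j"] norm_ge_zero[of "y - z (Suc j)"]
        by (simp only: power_Suc)
      finally show ?thesis .
    qed
    have x_le: "norm (norm (x (Suc j))) \<le> 2 * (1/2) ^ j" for j
      using order_trans[OF x(3) d_le] by simp
    have "summable (\<lambda>j. 2 * (1/2::real) ^ j)"
      by (intro summable_mult summable_geometric) simp
    then have "summable (\<lambda>j. norm (x (Suc j)))"
      by (rule summable_comparison_test'[where N = 0]) (rule x_le)
    then have "summable (\<lambda>j. norm (x j))"
      using summable_Suc_iff[of "\<lambda>j. norm (x j)"] by blast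
    then have "summable x" by (rule summable_norm_cancel)
    then have lim: "(\<lambda>k. \<Sum>i\<le>k. x i) \<longlonglongrightarrow> suminf x" by (rule summable_LIMSEQ')
    note FD = cstar_subalgebraD[OF A.cstar_subalgebra_Fix]
    have part: "(\<Sum>i\<le>k. x i) \<in> A.Fix \<and> q (\<Sum>i\<le>k. x i) = z k" for k
    proof -
      have "(\<Sum>i\<le>k. x i) \<in> A.Fix \<and> q (\<Sum>i\<le>k. x i) = (\<Sum>i\<le>k. d i)"
      proof (induction k)
        case (Suc k)
        then show ?case using qhom x FD(3) by (auto simp: star_hom_on_def)
      qed (simp add: x)
      then show ?thesis by (simp add: dsum)
    qed
    have xin: "suminf x \<in> A.Fix"
      by (rule closed_sequentially[OF FD(1) _ lim]) (use part in blast)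
    have "(\<lambda>k. q (\<Sum>i\<le>k. x i)) \<longlonglongrightarrow> q (suminf x)"
      by (rule continuous_on_tendsto_compose[OF cont lim]) (use part xin dense in auto)
    then have "z \<longlonglongrightarrow> q (suminf x)" using part by simp
    moreover have "z \<longlonglongrightarrow> y"
    proof (rule LIM_zero_cancel, rule Lim_null_comparison)
      show "\<forall>\<^sub>F k in sequentially. norm (z k - y) \<le> (1/2) ^ k"
        using z(2) by (auto simp: norm_minus_commute intro!: always_eventually less_imp_le)
      show "(\<lambda>k. (1/2::real) ^ k) \<longlonglongrightarrow> 0" by (rule LIMSEQ_power_zero) simp
    qed
    ultimately have "y = q (suminf x)" by (metis LIMSEQ_unique)
    with xin show ?thesis by blast
  qed
  then have "q ` A.Fix = UNIV" by blast
  with qhom q1 q have "is_quotient q" unfolding is_quotient_iff S_def by blast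
  then show ?thesis by blast
qed

abbreviation "q \<equiv> geodesic_quotient Br v0 E E' F"

lemma is_quotient_q: "is_quotient q"
proof -
  have "q = (SOME q. is_quotient q)" by (simp add: geodesic_quotient_def is_quotient_def)
  then show ?thesis using someI_ex[OF quotient_exists] by simp
qed

lemma q_hom: "star_hom_on A.Fix q"
  and q_one: "q 1 = 1"
  and q_surj: "q ` A.Fix = UNIV"
  and q_corner: "a \<in> A.mu.alg n \<Longrightarrow> a \<in> A.Fix \<Longrightarrow> q a = corner n a"
  using is_quotient_q unfolding is_quotient_iff by blast+

end

section \<open>Analytic elements of the stages\<close>

context af_flow
begin

lemma E_analytic_extension:
  assumes "\<mu> \<in> paths G v0 n" "\<mu>' \<in> paths G v0 n" "rng \<mu> = rng \<mu>'"
  shows "analytic_extension (mu.alg n) \<alpha> (E n \<mu> \<mu>')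
    (\<lambda>z. exp (\<i> * z * complex_of_real (Fp \<mu> - Fp \<mu>')) *\<^sub>C E n \<mu> \<mu>')"
  unfolding analytic_extension_def entire_def
proof (intro conjI allI)
  let ?d = "complex_of_real (Fp \<mu> - Fp \<mu>')"
  show "range (\<lambda>z. exp (\<i> * z * ?d) *\<^sub>C E n \<mu> \<mu>') \<subseteq> mu.alg n"
    using assms by (auto intro: mu.scaleC_in_alg mu.E_in_alg)
  show "exp (\<i> * complex_of_real t * ?d) *\<^sub>C E n \<mu> \<mu>' = \<alpha> t (E n \<mu> \<mu>')" for t
    by (simp add: AF_flow_E[OF assms] cis_conv_exp mult_ac)
  fix z
  have "((\<lambda>z. exp (\<i> * z * ?d)) has_field_derivative exp (\<i> * z * ?d) * (\<i> * ?d)) (at z)"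
    by (auto intro!: derivative_eq_intros)
  then have "((\<lambda>z. exp (\<i> * z * ?d)) has_derivative (\<lambda>h. exp (\<i> * z * ?d) * (\<i> * ?d) * h)) (at z)"
    by (simp add: has_field_derivative_def)
  from bounded_linear.has_derivative[OF scaleC.bounded_linear_left[of "E n \<mu> \<mu>'"] this]
  show "\<exists>d. ((\<lambda>z. exp (\<i> * z * ?d) *\<^sub>C E n \<mu> \<mu>') has_derivative (\<lambda>h. h *\<^sub>C d)) (at z)"
    by (intro exI[of _ "(exp (\<i> * z * ?d) * (\<i> * ?d)) *\<^sub>C E n \<mu> \<mu>'"])
      (simp add: mult_ac)
qed

lemma coef_AF_flow:
  assumes "x \<in> mu.alg n" and \<mu>: "\<mu> \<in> paths G v0 n" "\<mu>' \<in> paths G v0 n"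
  shows "\<alpha> t x \<in> mu.alg n \<and>
    mu.coef n (\<alpha> t x) \<mu> \<mu>' = cis (t * (Fp \<mu> - Fp \<mu>')) * mu.coef n x \<mu> \<mu>'"
  using assms(1)
proof (induction rule: mu.alg_induct)
  case (unit \<nu> \<nu>')
  then show ?case
    using \<mu> by (auto simp: AF_flow_E mu.coef_scaleC mu.E_in_alg mu.scaleC_in_alg mu.coef_E)
qed (simp_all add: AF_flow_add AF_flow_scaleC mu.add_in_alg mu.scaleC_in_alg mu.coef_add
    mu.coef_scaleC \<mu> distrib_left)

lemma coef_diff:
  assumes "x \<in> mu.alg n" "y \<in> mu.alg n" "\<mu> \<in> paths G v0 n" "\<mu>' \<in> paths G v0 n"
  shows "mu.coef n (x - y) \<mu> \<mu>' = mu.coef n x \<mu> \<mu>' - mu.coef n y \<mu> \<mu>'"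
proof -
  have "x - y \<in> mu.alg n" using cstar_subalgebraD(8)[OF mu.cstar_subalgebra_alg] assms by blast
  then show ?thesis using mu.coef_add[of "x - y" n y] assms by simp
qed

text \<open>
  The matrix entries of an entire function with values in a stage are entire, because they depend
  linearly and boundedly on the element; the stage is closed, so it contains the derivatives. By the
  identity theorem the entries of \<open>\<alpha>\<^sub>z(a)\<close> are therefore known from their values at real \<open>z\<close>.
\<close>

lemma analytic_extension_coef:
  assumes a: "a \<in> mu.alg n" and f: "analytic_extension (mu.alg n) \<alpha> a f"
    and \<mu>: "\<mu> \<in> paths G v0 n" "\<mu>' \<in> paths G v0 n"
  shows "mu.coef n (f z) \<mu> \<mu>' = exp (\<i> * z * complex_of_real (Fp \<mu> - Fp \<mu>')) * mu.coef n a \<mu> \<mu>'"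
proof -
  note sub = cstar_subalgebraD[OF mu.cstar_subalgebra_alg[of n]]
  define g where "g z = mu.coef n (f z) \<mu> \<mu>'" for z
  have fin: "f z \<in> mu.alg n" for z using f by (auto simp: analytic_extension_def)
  have "\<exists>c. (g has_field_derivative c) (at z)" for z
  proof -
    obtain d where d: "(f has_derivative (\<lambda>h. h *\<^sub>C d)) (at z)"
      using f unfolding analytic_extension_def entire_def by blast
    have alt: "\<exists>\<delta>>0. \<forall>y. norm (y - z) < \<delta> \<longrightarrow>
        norm (f y - f z - (y - z) *\<^sub>C d) \<le> e * norm (y - z)" if "e > 0" for e
      using d that unfolding has_derivative_at_alt by blast
    have "d \<in> closure (mu.alg n)"
      unfolding closure_approachable
    proof (intro allI impI)
      fix e :: real assume "e > 0"
      then obtain \<delta> where \<delta>: "\<delta> > 0" "\<And>y. norm (y - z) < \<delta> \<Longrightarrow>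
          norm (f y - f z - (y - z) *\<^sub>C d) \<le> e / 2 * norm (y - z)"
        using alt[of "e / 2"] by auto
      define h where "h = complex_of_real (\<delta> / 2)"
      have h: "h \<noteq> 0" "norm h = \<delta> / 2" using \<delta>(1) by (simp_all add: h_def)
      define y where "y = (1 / h) *\<^sub>C (f (z + h) - f z)"
      have "y - d = (1 / h) *\<^sub>C (f (z + h) - f z - h *\<^sub>C d)"
        using h by (simp add: y_def scaleC.diff_right)
      then have "norm (y - d) = norm (f (z + h) - f z - h *\<^sub>C d) / norm h"
        by (simp add: norm_scaleC norm_divide)
      also have "\<dots> \<le> e / 2"
      proof -
        have "norm (z + h - z) < \<delta>" using h(2) \<delta>(1) by simp
        from \<delta>(2)[OF this] have "norm (f (z + h) - f z - h *\<^sub>C d) \<le> e / 2 * norm h" by simp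
        moreover have "norm h > 0" using h(1) by simp
        ultimately show ?thesis by (simp add: pos_divide_le_eq)
      qed
      finally have "dist y d < e" using \<open>e > 0\<close> by (simp add: dist_norm)
      moreover have "y \<in> mu.alg n" unfolding y_def by (intro sub fin)
      ultimately show "\<exists>y\<in>mu.alg n. dist y d < e" by blast
    qed
    then have dn: "d \<in> mu.alg n" using sub(1) by simp
    have "(g has_derivative (\<lambda>h. mu.coef n d \<mu> \<mu>' * h)) (at z)"
      unfolding has_derivative_at_alt
    proof (intro conjI allI impI)
      fix e :: real assume "e > 0"
      then obtain \<delta> where \<delta>: "\<delta> > 0" "\<And>y. norm (y - z) < \<delta> \<Longrightarrow>
          norm (f y - f z - (y - z) *\<^sub>C d) \<le> e * norm (y - z)"
        using alt by blast
      have "norm (g y - g z - mu.coef n d \<mu> \<mu>' * (y - z)) \<le> e * norm (y - z)"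
        if "norm (y - z) < \<delta>" for y
      proof -
        have "g y - g z - mu.coef n d \<mu> \<mu>' * (y - z) = mu.coef n (f y - f z - (y - z) *\<^sub>C d) \<mu> \<mu>'"
          by (simp add: g_def coef_diff mu.coef_scaleC mu.scaleC_in_alg sub(8) fin dn \<mu> mult.commute)
        then show ?thesis
          using \<delta>(2)[OF that] mu.norm_coef_le[OF _ \<mu>, of "f y - f z - (y - z) *\<^sub>C d"]
          by (simp add: mu.scaleC_in_alg sub(8) fin dn)
      qed
      with \<delta>(1) show "\<exists>\<delta>>0. \<forall>y. norm (y - z) < \<delta> \<longrightarrow>
          norm (g y - g z - mu.coef n d \<mu> \<mu>' * (y - z)) \<le> e * norm (y - z)" by blast
    qed (rule bounded_linear_mult_right)
    then show ?thesis unfolding has_field_derivative_def by blast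
  qed
  then have hol: "g holomorphic_on UNIV"
    by (auto simp: holomorphic_on_def field_differentiable_def)
  define k where "k z = exp (\<i> * z * complex_of_real (Fp \<mu> - Fp \<mu>')) * mu.coef n a \<mu> \<mu>'" for z
  have "k holomorphic_on UNIV" unfolding k_def by (intro holomorphic_intros)
  with hol have diff: "(\<lambda>z. g z - k z) holomorphic_on UNIV" by (rule holomorphic_on_diff)
  have real: "g z - k z = 0" if z: "z \<in> \<real>" for z
  proof -
    obtain t where "z = complex_of_real t" using z by (auto simp: Reals_def)
    moreover have "f (complex_of_real t) = \<alpha> t a" using f by (simp add: analytic_extension_def)
    ultimately show ?thesis
      using coef_AF_flow[OF a \<mu>] by (simp add: g_def k_def cis_conv_exp mult_ac)
  qed
  have lim: "(0::complex) islimpt \<real>"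
    unfolding islimpt_approachable
  proof (intro allI impI)
    fix e :: real assume "e > 0"
    then show "\<exists>x\<in>\<real>. x \<noteq> 0 \<and> dist x (0::complex) < e"
      by (intro bexI[of _ "complex_of_real (e / 2)"]) auto
  qed
  have "g z - k z = 0"
    by (rule analytic_continuation[OF diff open_UNIV connected_UNIV subset_UNIV UNIV_I lim real UNIV_I])
  then show ?thesis by (simp add: g_def k_def)
qed

end

section \<open>Local ground states as states concentrated on geodesics\<close>

lemma exp_minus_nat_tendsto:
  assumes "0 \<le> (d::real)"
  shows "(\<lambda>k. exp (- (real k * d))) \<longlonglongrightarrow> (if d = 0 then 1 else 0)"
proof (cases "d = 0")
  case False
  with assms have "exp (- d) < 1" by simp
  then have "(\<lambda>k. exp (- d) ^ k) \<longlonglongrightarrow> 0" by (intro LIMSEQ_power_zero) simp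
  then show ?thesis using False by (simp flip: exp_of_nat_mult)
qed simp

lemma continuous_on_precompose: "continuous_on S (\<lambda>f :: 'c \<Rightarrow> complex. f \<circ> g)"
proof (rule continuous_on_coordinatewise_then_product)
  show "continuous_on S (\<lambda>f :: 'c \<Rightarrow> complex. (f \<circ> g) i)" for i
    unfolding o_apply by (rule continuous_on_subset[OF continuous_on_product_coordinates subset_UNIV])
qed

context geodesic_AF
begin

text \<open>
  The states that both sides of the correspondence reduce to: diagonal in the matrix units, uniform
  on the geodesic paths to a given vertex and zero on all other paths.
\<close>

definition geodesic_state :: "('a \<Rightarrow> complex) \<Rightarrow> bool" where
  "geodesic_state \<omega> \<longleftrightarrow> state_on UNIV \<omega> \<and>
     (\<forall>n. \<forall>\<mu>\<in>P n. \<forall>\<mu>'\<in>P n. rng \<mu> = rng \<mu>' \<longrightarrow> \<mu> \<noteq> \<mu>' \<longrightarrow> \<omega> (E n \<mu> \<mu>') = 0) \<and>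
     (\<forall>n. \<forall>\<mu>\<in>P n - G n. \<omega> (E n \<mu> \<mu>) = 0) \<and>
     (\<forall>n. \<forall>\<mu>\<in>G n. \<forall>\<mu>'\<in>G n. rng \<mu> = rng \<mu>' \<longrightarrow> \<omega> (E n \<mu> \<mu>) = \<omega> (E n \<mu>' \<mu>'))"

lemma KMS_state_E:
  fixes \<psi> :: "'a \<Rightarrow> complex"
  assumes KMS: "KMS_state_on (A.mu.alg n) A.\<alpha> \<beta> \<psi>"
    and \<mu>: "\<mu> \<in> P n" "\<mu>' \<in> P n" "rng \<mu> = rng \<mu>'"
    and \<nu>: "\<nu> \<in> P n" "\<nu>' \<in> P n" "rng \<nu> = rng \<nu>'"
  shows "\<psi> (E n \<mu> \<mu>' * E n \<nu> \<nu>') =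
    complex_of_real (exp (- \<beta> * (Fp \<mu> - Fp \<mu>'))) * \<psi> (E n \<nu> \<nu>' * E n \<mu> \<mu>')"
proof -
  have an: "E n \<kappa> \<kappa>' \<in> analytic_elements (A.mu.alg n) A.\<alpha>"
    if "\<kappa> \<in> P n" "\<kappa>' \<in> P n" "rng \<kappa> = rng \<kappa>'" for \<kappa> \<kappa>'
    using A.E_analytic_extension[OF that] A.mu.E_in_alg[OF that] by (auto simp: analytic_elements_def)
  have "\<psi> (E n \<mu> \<mu>' * E n \<nu> \<nu>') = \<psi> (E n \<nu> \<nu>' *
      (exp (\<i> * (\<i> * complex_of_real \<beta>) * complex_of_real (Fp \<mu> - Fp \<mu>')) *\<^sub>C E n \<mu> \<mu>'))"
    using KMS an[OF \<mu>] an[OF \<nu>] A.E_analytic_extension[OF \<mu>] unfolding KMS_state_on_def by blast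
  also have "\<dots> = exp (\<i> * (\<i> * complex_of_real \<beta>) * complex_of_real (Fp \<mu> - Fp \<mu>')) *
      \<psi> (E n \<nu> \<nu>' * E n \<mu> \<mu>')"
    using KMS A.mu.mult_in_alg[OF A.mu.E_in_alg[OF \<nu>] A.mu.E_in_alg[OF \<mu>]]
    by (simp add: KMS_state_on_def state_on_def mult_scaleC_right)
  also have "exp (\<i> * (\<i> * complex_of_real \<beta>) * complex_of_real (Fp \<mu> - Fp \<mu>')) =
      complex_of_real (exp (- \<beta> * (Fp \<mu> - Fp \<mu>')))"
    by (simp flip: mult.assoc exp_of_real)
  finally show ?thesis by simp
qed

lemma
  assumes \<omega>: "KMS_infinity_state_on (A.mu.alg n) A.\<alpha> \<omega>"
    and \<mu>: "\<mu> \<in> P n" "\<mu>' \<in> P n" "rng \<mu> = rng \<mu>'"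
  shows KMS_infinity_off_diagonal: "\<mu> \<noteq> \<mu>' \<Longrightarrow> \<omega> (E n \<mu> \<mu>') = 0"
    and KMS_infinity_equal: "Fp \<mu> = Fp \<mu>' \<Longrightarrow> \<omega> (E n \<mu> \<mu>) = \<omega> (E n \<mu>' \<mu>')"
    and KMS_infinity_not_minimal: "Fp \<mu>' < Fp \<mu> \<Longrightarrow> \<omega> (E n \<mu> \<mu>) = 0"
proof -
  obtain \<beta> \<psi> where \<beta>: "filterlim \<beta> at_top sequentially"
    and KMS: "\<And>k::nat. KMS_state_on (A.mu.alg n) A.\<alpha> (\<beta> k) (\<psi> k)"
    and lim: "\<And>a. a \<in> A.mu.alg n \<Longrightarrow> (\<lambda>k. \<psi> k a) \<longlonglongrightarrow> \<omega> a"
    using \<omega> unfolding KMS_infinity_state_on_def by blast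
  note \<mu>sym = \<mu>(2) \<mu>(1) \<mu>(3)[symmetric]
  have \<psi>0: "\<psi> k 0 = 0" for k
  proof -
    have "\<psi> k (0 *\<^sub>C 0) = 0 * \<psi> k 0"
      using KMS[of k] A.mu.zero_in_alg unfolding KMS_state_on_def state_on_def by blast
    then show ?thesis by simp
  qed
  show "\<omega> (E n \<mu> \<mu>') = 0" if ne: "\<mu> \<noteq> \<mu>'"
  proof -
    have "\<psi> k (E n \<mu> \<mu>') = 0" for k
      using KMS_state_E[OF KMS \<mu>(1,1) refl \<mu>, of k] \<mu> ne by (simp add: A.mu.mult_E \<psi>0)
    then show ?thesis using lim[OF A.mu.E_in_alg[OF \<mu>]] by (simp add: LIMSEQ_const_iff)
  qed
  have diag: "\<psi> k (E n \<mu> \<mu>) = complex_of_real (exp (- \<beta> k * (Fp \<mu> - Fp \<mu>'))) *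
      \<psi> k (E n \<mu>' \<mu>')" for k
    using KMS_state_E[OF KMS \<mu> \<mu>sym, of k] \<mu> by (simp add: A.mu.mult_E)
  have lim1: "(\<lambda>k. \<psi> k (E n \<mu> \<mu>)) \<longlonglongrightarrow> \<omega> (E n \<mu> \<mu>)"
    and lim2: "(\<lambda>k. \<psi> k (E n \<mu>' \<mu>')) \<longlonglongrightarrow> \<omega> (E n \<mu>' \<mu>')"
    using \<mu> by (auto intro!: lim A.mu.E_in_alg)
  show "\<omega> (E n \<mu> \<mu>) = \<omega> (E n \<mu>' \<mu>')" if "Fp \<mu> = Fp \<mu>'"
    using lim1 lim2 that by (simp add: diag LIMSEQ_unique)
  show "\<omega> (E n \<mu> \<mu>) = 0" if "Fp \<mu>' < Fp \<mu>"
  proof -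
    have "filterlim (\<lambda>k. (Fp \<mu> - Fp \<mu>') * \<beta> k) at_top sequentially"
      using that by (intro filterlim_tendsto_pos_mult_at_top[OF tendsto_const _ \<beta>]) simp
    then have "filterlim (\<lambda>k. - ((Fp \<mu> - Fp \<mu>') * \<beta> k)) at_bot sequentially"
      by (simp add: filterlim_uminus_at_bot)
    then have "(\<lambda>k. exp (- ((Fp \<mu> - Fp \<mu>') * \<beta> k))) \<longlonglongrightarrow> 0"
      by (rule filterlim_compose[OF exp_at_bot])
    then have "(\<lambda>k. exp (- \<beta> k * (Fp \<mu> - Fp \<mu>'))) \<longlonglongrightarrow> 0" by (simp add: mult.commute)
    then have "(\<lambda>k. complex_of_real (exp (- \<beta> k * (Fp \<mu> - Fp \<mu>'))) * \<psi> k (E n \<mu>' \<mu>')) \<longlonglongrightarrow>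
        complex_of_real 0 * \<omega> (E n \<mu>' \<mu>')"
      by (intro tendsto_mult lim2 tendsto_of_real)
    then show ?thesis using lim1 LIMSEQ_unique unfolding diag by fastforce
  qed
qed

text \<open>
  A path that is not geodesic has, by Koenig's lemma, no minimal extension of some length. Its
  diagonal matrix unit is a sum over these extensions, on which a local ground state vanishes.
\<close>

lemma local_imp_geodesic_state:
  assumes "\<omega> \<in> local_KMS_infinity_states Br v0 E F"
  shows "geodesic_state \<omega>"
proof -
  have st: "state_on UNIV \<omega>" and KMS: "\<And>n. KMS_infinity_state_on (A.mu.alg n) A.\<alpha> \<omega>"
    using assms by (auto simp: local_KMS_infinity_states_def A.AF_alg_eq)
  have "\<omega> (0 *\<^sub>C 0) = 0 * \<omega> 0" using st unfolding state_on_def by blast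
  then have sum: "\<omega> (sum f I) = (\<Sum>i\<in>I. \<omega> (f i))" for f and I :: "'e set"
    using st by (induction I rule: infinite_finite_induct) (simp_all add: state_on_def)
  have zero: "\<omega> (E n \<mu> \<mu>) = 0"
    if "\<mu> \<in> P n" "\<And>\<nu>. length \<nu> = m \<Longrightarrow> \<not> minimal (\<mu> @ \<nu>)" for m n \<mu>
    using that
  proof (induction m arbitrary: n \<mu>)
    case 0
    then have "\<not> minimal \<mu>" by simp
    then obtain \<mu>' where "\<mu>' \<in> P n" "rng \<mu>' = rng \<mu>" "Fp \<mu>' < Fp \<mu>"
      using 0(1) length_path[OF 0(1)] by (auto simp: minimal_def not_le)
    then show ?case using KMS_infinity_not_minimal[OF KMS 0(1)] by metis
  next
    case (Suc m)
    have "\<omega> (E (Suc n) (\<mu> @ [a]) (\<mu> @ [a])) = 0" if "a \<in> out_arcs Br (rng \<mu>)" for a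
    proof (rule Suc.IH)
      show "\<mu> @ [a] \<in> P (Suc n)" using that Suc.prems(1) by (simp add: snoc_in_paths_iff)
      show "\<not> minimal ((\<mu> @ [a]) @ \<nu>)" if "length \<nu> = m" for \<nu>
        using Suc.prems(2)[of "a # \<nu>"] that by simp
    qed
    then show ?case unfolding A.refine[OF Suc.prems(1) Suc.prems(1) refl] sum by simp
  qed
  show ?thesis
    unfolding geodesic_state_def
  proof (intro conjI allI ballI impI st)
    fix n \<mu> \<mu>' assume "\<mu> \<in> P n" "\<mu>' \<in> P n" "rng \<mu> = rng \<mu>'" "\<mu> \<noteq> \<mu>'"
    then show "\<omega> (E n \<mu> \<mu>') = 0" by (rule KMS_infinity_off_diagonal[OF KMS])
  next
    fix n \<mu> assume \<mu>: "\<mu> \<in> P n - G n"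
    then obtain m where "\<And>\<nu>. length \<nu> = m \<Longrightarrow> \<not> minimal (\<mu> @ \<nu>)" using not_sub_path by blast
    then show "\<omega> (E n \<mu> \<mu>) = 0" using zero \<mu> by blast
  next
    fix n \<mu> \<mu>' assume \<mu>: "\<mu> \<in> G n" "\<mu>' \<in> G n" "rng \<mu> = rng \<mu>'"
    then show "\<omega> (E n \<mu> \<mu>) = \<omega> (E n \<mu>' \<mu>')"
      by (intro KMS_infinity_equal[OF KMS] G_P G_potential_eq)
  qed
qed

text \<open>
  For a diagonal functional both sides of the KMS condition expand into the same products of an entry
  of \<open>a\<close> and an entry of \<open>b\<close>. The analytic continuation of the flow to \<open>i \<beta>\<close> multiplies the entries of \<open>a\<close>
  by exactly the ratio of the two weights involved.
\<close>

lemma gibbs_KMS: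
  fixes w :: "'e list \<Rightarrow> real"
  assumes nonneg: "\<And>\<mu>. \<mu> \<in> P n \<Longrightarrow> 0 \<le> w \<mu>" and total: "(\<Sum>\<mu>\<in>P n. w \<mu>) = 1"
    and ratio: "\<And>\<mu> \<mu>'. \<mu> \<in> P n \<Longrightarrow> \<mu>' \<in> P n \<Longrightarrow> rng \<mu> = rng \<mu>' \<Longrightarrow>
      w \<mu> = exp (- \<beta> * (Fp \<mu> - Fp \<mu>')) * w \<mu>'"
  shows "KMS_state_on (A.mu.alg n) A.\<alpha> \<beta> (\<lambda>x. \<Sum>\<mu>\<in>P n. A.mu.coef n x \<mu> \<mu> * of_real (w \<mu>))"
  unfolding KMS_state_on_def
proof (intro conjI ballI allI impI)
  let ?\<psi> = "\<lambda>x. \<Sum>\<mu>\<in>P n. A.mu.coef n x \<mu> \<mu> * complex_of_real (w \<mu>)"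
  show "state_on (A.mu.alg n) ?\<psi>"
    unfolding state_on_def
  proof (intro conjI ballI allI)
    fix a assume a: "a \<in> A.mu.alg n"
    show "?\<psi> (c *\<^sub>C a) = c * ?\<psi> a" for c
      by (simp add: A.mu.coef_scaleC a sum_distrib_left mult.assoc)
    show "?\<psi> (star a * a) \<in> \<real>\<^sub>\<ge>\<^sub>0"
      by (intro sum_nonneg_Reals nonneg_Reals_mult_I A.mu.coef_star_mult_self a) (simp_all add: nonneg)
    show "?\<psi> (a + b) = ?\<psi> a + ?\<psi> b" if "b \<in> A.mu.alg n" for b
      by (simp add: A.mu.coef_add a that sum.distrib distrib_right)
  next
    have "?\<psi> 1 = complex_of_real (\<Sum>\<mu>\<in>P n. w \<mu>)" by (simp add: A.mu.coef_one)
    then show "?\<psi> 1 = 1" by (simp add: total)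
  qed
  fix a b f
  assume a': "a \<in> analytic_elements (A.mu.alg n) A.\<alpha>" and b': "b \<in> analytic_elements (A.mu.alg n) A.\<alpha>"
    and f: "analytic_extension (A.mu.alg n) A.\<alpha> a f"
  have a: "a \<in> A.mu.alg n" and b: "b \<in> A.mu.alg n" using a' b' by (auto simp: analytic_elements_def)
  let ?f = "f (\<i> * complex_of_real \<beta>)"
  have fin: "?f \<in> A.mu.alg n" using f by (auto simp: analytic_extension_def)
  have coef: "A.mu.coef n ?f \<mu> \<nu> = of_real (exp (- \<beta> * (Fp \<mu> - Fp \<nu>))) * A.mu.coef n a \<mu> \<nu>"
    if "\<mu> \<in> P n" "\<nu> \<in> P n" for \<mu> \<nu>
  proof -
    have "exp (\<i> * (\<i> * complex_of_real \<beta>) * complex_of_real (Fp \<mu> - Fp \<nu>)) =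
        complex_of_real (exp (- \<beta> * (Fp \<mu> - Fp \<nu>)))"
      by (simp flip: mult.assoc exp_of_real)
    then show ?thesis using A.analytic_extension_coef[OF a f that] by simp
  qed
  have "?\<psi> (a * b) = (\<Sum>\<mu>\<in>P n. \<Sum>\<nu>\<in>P n. A.mu.coef n a \<mu> \<nu> * A.mu.coef n b \<nu> \<mu> * of_real (w \<mu>))"
    by (simp add: A.mu.coef_mult a b sum_distrib_right)
  also have "\<dots> = (\<Sum>\<mu>\<in>P n. \<Sum>\<nu>\<in>P n. A.mu.coef n b \<nu> \<mu> * A.mu.coef n ?f \<mu> \<nu> * of_real (w \<nu>))"
  proof (intro sum.cong refl)
    fix \<mu> \<nu> assume \<mu>: "\<mu> \<in> P n" "\<nu> \<in> P n"
    show "A.mu.coef n a \<mu> \<nu> * A.mu.coef n b \<nu> \<mu> * of_real (w \<mu>) =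
        A.mu.coef n b \<nu> \<mu> * A.mu.coef n ?f \<mu> \<nu> * of_real (w \<nu>)"
    proof (cases "rng \<mu> = rng \<nu>")
      case True
      show ?thesis unfolding coef[OF \<mu>] ratio[OF \<mu> True] by simp
    qed (simp add: coef[OF \<mu>] A.mu.coef_unrelated)
  qed
  also have "\<dots> = (\<Sum>\<nu>\<in>P n. \<Sum>\<mu>\<in>P n. A.mu.coef n b \<nu> \<mu> * A.mu.coef n ?f \<mu> \<nu> * of_real (w \<nu>))"
    by (rule sum.swap)
  also have "\<dots> = ?\<psi> (b * ?f)" by (simp add: A.mu.coef_mult fin b sum_distrib_right)
  finally show "?\<psi> (a * b) = ?\<psi> (b * ?f)" .
qed

text \<open>
  At inverse temperature \<open>k\<close>, distribute the weight that the state gives to the paths ending at a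
  vertex according to the Gibbs distribution on these paths. As \<open>k\<close> grows, the Gibbs distribution
  approaches the uniform distribution on the minimal paths. The minimal paths are the geodesic ones
  if the vertex lies on a geodesic, and otherwise the vertex has weight zero.
\<close>

lemma geodesic_state_imp_local:
  assumes \<omega>: "geodesic_state \<omega>"
  shows "\<omega> \<in> local_KMS_infinity_states Br v0 E F"
proof -
  have st: "state_on UNIV \<omega>" using \<omega> by (simp add: geodesic_state_def)
  have "KMS_infinity_state_on (A.mu.alg n) A.\<alpha> \<omega>" for n
  proof -
    define p where "p \<mu> = Re (\<omega> (E n \<mu> \<mu>))" for \<mu>
    have p: "\<omega> (E n \<mu> \<mu>) = of_real (p \<mu>)" "0 \<le> p \<mu>" if "\<mu> \<in> P n" for \<mu>
      using A.mu.state_E_nonneg[OF st that]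
      by (auto simp: p_def complex_nonneg_Reals_iff complex_eq_iff)
    have psum: "(\<Sum>\<mu>\<in>P n. p \<mu>) = 1"
    proof -
      have "complex_of_real (\<Sum>\<mu>\<in>P n. p \<mu>) = \<omega> (\<Sum>\<mu>\<in>P n. E n \<mu> \<mu>)"
        by (simp add: state_sum[OF st] p)
      then have "complex_of_real (\<Sum>\<mu>\<in>P n. p \<mu>) = of_real 1" by (simp add: A.mu.sum_E state_one[OF st])
      then show ?thesis by (simp only: of_real_eq_iff)
    qed
    define B where "B \<mu> = {\<nu> \<in> P n. rng \<nu> = rng \<mu>}" for \<mu>
    define Z where "Z k \<mu> = (\<Sum>\<nu>\<in>B \<mu>. exp (- (real k * Fp \<nu>)))" for k \<mu>
    define w where "w k \<mu> = (\<Sum>\<nu>\<in>B \<mu>. p \<nu>) * exp (- (real k * Fp \<mu>)) / Z k \<mu>" for k \<mu>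
    have finB: "finite (B \<mu>)" for \<mu> using finite_paths by (simp add: B_def)
    have B_eq: "B \<mu> = B \<nu>" if "rng \<mu> = rng \<nu>" for \<mu> \<nu> using that by (simp add: B_def)
    have Zpos: "Z k \<mu> > 0" if "\<mu> \<in> P n" for k \<mu>
      unfolding Z_def using that finB by (intro sum_pos) (auto simp: B_def)
    have w_nonneg: "0 \<le> w k \<mu>" if "\<mu> \<in> P n" for k \<mu>
      unfolding w_def using that Zpos p(2)
      by (intro divide_nonneg_pos mult_nonneg_nonneg sum_nonneg) (auto simp: B_def)
    have w_total: "(\<Sum>\<mu>\<in>P n. w k \<mu>) = 1" for k
    proof -
      have "w k \<mu> = (\<Sum>\<nu>\<in>P n. if rng \<nu> = rng \<mu> then p \<nu> * exp (- (real k * Fp \<mu>)) / Z k \<nu> else 0)"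
        if "\<mu> \<in> P n" for \<mu>
      proof -
        have "(\<Sum>\<nu>\<in>P n. if rng \<nu> = rng \<mu> then p \<nu> * exp (- (real k * Fp \<mu>)) / Z k \<nu> else 0) =
            (\<Sum>\<nu>\<in>B \<mu>. p \<nu> * exp (- (real k * Fp \<mu>)) / Z k \<nu>)"
          unfolding B_def by (rule sum.inter_filter[symmetric]) (rule finite_paths)
        also have "\<dots> = (\<Sum>\<nu>\<in>B \<mu>. p \<nu> * exp (- (real k * Fp \<mu>)) / Z k \<mu>)"
          by (intro sum.cong refl) (auto simp: B_def Z_def)
        finally show ?thesis by (simp add: w_def sum_distrib_right sum_divide_distrib)
      qed
      then have "(\<Sum>\<mu>\<in>P n. w k \<mu>) =
          (\<Sum>\<mu>\<in>P n. \<Sum>\<nu>\<in>P n. if rng \<nu> = rng \<mu> then p \<nu> * exp (- (real k * Fp \<mu>)) / Z k \<nu> else 0)"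
        by simp
      also have "\<dots> = (\<Sum>\<nu>\<in>P n. \<Sum>\<mu>\<in>P n. if rng \<mu> = rng \<nu> then p \<nu> * exp (- (real k * Fp \<mu>)) / Z k \<nu> else 0)"
        by (subst sum.swap) (simp only: eq_commute)
      also have "\<dots> = (\<Sum>\<nu>\<in>P n. \<Sum>\<mu>\<in>B \<nu>. p \<nu> * exp (- (real k * Fp \<mu>)) / Z k \<nu>)"
        unfolding B_def by (intro sum.cong refl sum.inter_filter[symmetric] finite_paths)
      also have "\<dots> = (\<Sum>\<nu>\<in>P n. p \<nu>)"
      proof (rule sum.cong[OF refl])
        fix \<nu> assume "\<nu> \<in> P n"
        have "(\<Sum>\<mu>\<in>B \<nu>. p \<nu> * exp (- (real k * Fp \<mu>)) / Z k \<nu>) = p \<nu> * Z k \<nu> / Z k \<nu>"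
          by (simp add: Z_def sum_distrib_left sum_divide_distrib)
        then show "(\<Sum>\<mu>\<in>B \<nu>. p \<nu> * exp (- (real k * Fp \<mu>)) / Z k \<nu>) = p \<nu>"
          using Zpos[OF \<open>\<nu> \<in> P n\<close>, of k] by simp
      qed
      finally show ?thesis by (simp add: psum)
    qed
    have w_ratio: "w k \<mu> = exp (- real k * (Fp \<mu> - Fp \<mu>')) * w k \<mu>'"
      if "rng \<mu> = rng \<mu>'" for k \<mu> \<mu>'
    proof -
      have "exp (- (real k * Fp \<mu>)) = exp (- real k * (Fp \<mu> - Fp \<mu>')) * exp (- (real k * Fp \<mu>'))"
        by (simp add: algebra_simps flip: exp_add)
      then show ?thesis by (simp add: w_def Z_def B_eq[OF that])
    qed
    have w_lim: "(\<lambda>k. w k \<mu>) \<longlonglongrightarrow> p \<mu>" if \<mu>: "\<mu> \<in> P n" for \<mu>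
    proof (cases "\<exists>\<nu>\<in>B \<mu>. p \<nu> \<noteq> 0")
      case False
      then have "p \<mu> = 0" "(\<Sum>\<nu>\<in>B \<mu>. p \<nu>) = 0" using \<mu> by (auto simp: B_def)
      then show ?thesis by (simp add: w_def)
    next
      case True
      then obtain \<nu> where \<nu>: "\<nu> \<in> B \<mu>" "p \<nu> \<noteq> 0" by blast
      then have \<nu>P: "\<nu> \<in> P n" "rng \<nu> = rng \<mu>" by (auto simp: B_def)
      have \<nu>G: "\<nu> \<in> G n"
      proof (rule ccontr)
        assume "\<nu> \<notin> G n"
        then have "\<omega> (E n \<nu> \<nu>) = 0" using \<omega> \<nu>P(1) unfolding geodesic_state_def by blast
        with \<nu>(2) show False by (simp add: p_def)
      qed
      have min: "Fp \<nu> \<le> Fp \<kappa>" if "\<kappa> \<in> B \<mu>" for \<kappa>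
        using sub_path_minimal[OF \<nu>G] that \<nu>P length_path[OF \<nu>P(1)] by (simp add: minimal_def B_def)
      have pval: "p \<kappa> = (if Fp \<kappa> = Fp \<nu> then p \<nu> else 0)" if \<kappa>: "\<kappa> \<in> B \<mu>" for \<kappa>
      proof (cases "\<kappa> \<in> G n")
        case True
        have "rng \<kappa> = rng \<nu>" using \<kappa> \<nu>P by (simp add: B_def)
        then have "Fp \<kappa> = Fp \<nu>" "\<omega> (E n \<kappa> \<kappa>) = \<omega> (E n \<nu> \<nu>)"
          using G_potential_eq[OF True \<nu>G] \<omega> True \<nu>G unfolding geodesic_state_def by blast+
        then show ?thesis by (simp add: p_def)
      next
        case False
        then have "Fp \<kappa> \<noteq> Fp \<nu>" using G_exchange[OF \<nu>G, of \<kappa>] \<kappa> \<nu>P by (auto simp: B_def)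
        moreover have "\<omega> (E n \<kappa> \<kappa>) = 0" using \<omega> False \<kappa> unfolding geodesic_state_def B_def by blast
        ultimately show ?thesis by (simp add: p_def)
      qed
      define M where "M = {\<kappa> \<in> B \<mu>. Fp \<kappa> = Fp \<nu>}"
      have M: "finite M" "M \<noteq> {}" using finB \<nu>(1) by (auto simp: M_def)
      have tot: "(\<Sum>\<kappa>\<in>B \<mu>. p \<kappa>) = p \<nu> * real (card M)"
        unfolding M_def by (simp add: pval sum.inter_filter[OF finB, symmetric])
      define e where "e k \<kappa> = exp (- (real k * (Fp \<kappa> - Fp \<nu>)))" for k \<kappa>
      have shift: "exp (- (real k * Fp \<kappa>)) = exp (- (real k * Fp \<nu>)) * e k \<kappa>" for k \<kappa>
        by (simp add: e_def algebra_simps flip: exp_add)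
      have w_eq: "w k \<mu> = p \<nu> * real (card M) * e k \<mu> / (\<Sum>\<kappa>\<in>B \<mu>. e k \<kappa>)" for k
      proof -
        have "Z k \<mu> = exp (- (real k * Fp \<nu>)) * (\<Sum>\<kappa>\<in>B \<mu>. e k \<kappa>)"
          unfolding Z_def sum_distrib_left by (intro sum.cong refl shift)
        then show ?thesis unfolding w_def tot shift[of k \<mu>] by simp
      qed
      have e_lim: "(\<lambda>k. e k \<kappa>) \<longlonglongrightarrow> (if Fp \<kappa> = Fp \<nu> then 1 else 0)" if "\<kappa> \<in> B \<mu>" for \<kappa>
        using exp_minus_nat_tendsto[of "Fp \<kappa> - Fp \<nu>"] min[OF that] by (simp add: e_def)
      have "(\<lambda>k. \<Sum>\<kappa>\<in>B \<mu>. e k \<kappa>) \<longlonglongrightarrow> (\<Sum>\<kappa>\<in>B \<mu>. if Fp \<kappa> = Fp \<nu> then 1 else 0)"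
        by (intro tendsto_sum e_lim)
      also have "(\<Sum>\<kappa>\<in>B \<mu>. if Fp \<kappa> = Fp \<nu> then 1 else 0) = real (card M)"
        unfolding M_def by (simp add: sum.inter_filter[OF finB, symmetric])
      finally have den: "(\<lambda>k. \<Sum>\<kappa>\<in>B \<mu>. e k \<kappa>) \<longlonglongrightarrow> real (card M)" .
      have card: "real (card M) \<noteq> 0" using M by simp
      have \<mu>B: "\<mu> \<in> B \<mu>" using \<mu> by (simp add: B_def)
      have "(\<lambda>k. w k \<mu>) \<longlonglongrightarrow> p \<nu> * real (card M) * (if Fp \<mu> = Fp \<nu> then 1 else 0) / real (card M)"
        unfolding w_eq by (intro tendsto_divide tendsto_mult tendsto_const e_lim[OF \<mu>B] den card)
      then show ?thesis using card pval[OF \<mu>B] by (auto split: if_splits)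
    qed
    define \<psi> where "\<psi> k x = (\<Sum>\<mu>\<in>P n. A.mu.coef n x \<mu> \<mu> * complex_of_real (w k \<mu>))" for k x
    have "KMS_state_on (A.mu.alg n) A.\<alpha> (real k) (\<psi> k)" for k
      unfolding \<psi>_def
    proof (rule gibbs_KMS)
      show "w k \<mu> = exp (- real k * (Fp \<mu> - Fp \<mu>')) * w k \<mu>'"
        if "\<mu> \<in> P n" "\<mu>' \<in> P n" "rng \<mu> = rng \<mu>'" for \<mu> \<mu>'
        by (rule w_ratio[OF that(3)])
    qed (use w_nonneg w_total in auto)
    moreover have "(\<lambda>k. \<psi> k a) \<longlonglongrightarrow> \<omega> a" if a: "a \<in> A.mu.alg n" for a
    proof -
      have "\<omega> a = (\<Sum>\<mu>\<in>P n. A.mu.coef n a \<mu> \<mu> * \<omega> (E n \<mu> \<mu>))"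
        by (rule A.mu.diagonal_state[OF st _ a]) (use \<omega> in \<open>auto simp: geodesic_state_def\<close>)
      also have "\<dots> = (\<Sum>\<mu>\<in>P n. A.mu.coef n a \<mu> \<mu> * complex_of_real (p \<mu>))" by (simp add: p)
      finally show ?thesis
        unfolding \<psi>_def by (auto intro!: tendsto_sum tendsto_mult tendsto_of_real w_lim)
    qed
    moreover have "filterlim real at_top sequentially" by (rule filterlim_real_sequentially)
    moreover have "state_on (A.mu.alg n) \<omega>" using st by (simp add: state_on_def)
    ultimately show ?thesis unfolding KMS_infinity_state_on_def by blast
  qed
  then show ?thesis using st by (simp add: local_KMS_infinity_states_def A.AF_alg_eq)
qed

section \<open>The compression and trace states\<close>

abbreviation "C \<equiv> geodesic_compression Br v0 E E' F"

lemma C_eq: "C a = q (A.R a)"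
  by (simp add: geodesic_compression_def)

lemma C_Fix: "a \<in> A.Fix \<Longrightarrow> C a = q a"
  by (simp add: C_eq A.R_Fix)

lemma C_add: "C (a + b) = C a + C b"
  and C_scaleC: "C (c *\<^sub>C a) = c *\<^sub>C C a"
  using q_hom A.R_in_Fix by (auto simp: C_eq A.R_add A.R_scaleC star_hom_on_def)

lemma C_diff: "C (a - b) = C a - C b"
  using C_add[of "a - b" b] by simp

lemma C_one: "C 1 = 1"
  using C_Fix[of 1] cstar_subalgebraD(2)[OF A.cstar_subalgebra_Fix] q_one by simp

lemma norm_C_le: "norm (C a) \<le> norm a"
  using star_hom_contractive[OF A.cstar_subalgebra_Fix q_hom A.R_in_Fix] A.norm_R_le order_trans
  unfolding C_eq by blast

lemma C_continuous: "continuous_on UNIV C"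
  by (rule contraction_continuous_on) (metis C_diff norm_C_le)

lemma
  assumes a: "a \<in> A.mu.alg n"
  shows C_in_alg: "C a \<in> B.mu.alg n"
    and coef_C: "\<mu> \<in> G n \<Longrightarrow> \<mu>' \<in> G n \<Longrightarrow> B.mu.coef n (C a) \<mu> \<mu>' = A.mu.coef n a \<mu> \<mu>'"
proof -
  have C: "C a = corner n (A.R a)"
    unfolding C_eq by (rule q_corner[OF A.R_in_alg[OF a] A.R_in_Fix])
  then show "C a \<in> B.mu.alg n" by (simp add: corner_in_alg)
  assume \<mu>: "\<mu> \<in> G n" "\<mu>' \<in> G n"
  show "B.mu.coef n (C a) \<mu> \<mu>' = A.mu.coef n a \<mu> \<mu>'"
  proof (cases "rng \<mu> = rng \<mu>'")
    case True
    then show ?thesis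
      using \<mu> G_potential_eq[OF \<mu>] by (simp add: C coef_corner A.coef_R[OF a] G_P)
  qed (simp add: sub_coef_unrelated A.mu.coef_unrelated)
qed

text \<open>
  The trace property makes \<open>\<tau>\<close> diagonal and uniform in each block. Positivity of \<open>\<tau> \<circ> C\<close> is checked on the
  stages, where only the diagonal entries of \<open>star a * a\<close> enter, and then carried over to limits.
\<close>

lemma trace_imp_geodesic_state:
  assumes \<tau>: "\<tau> \<in> trace_states"
  shows "geodesic_state (\<tau> \<circ> C)"
proof -
  have st: "state_on UNIV \<tau>" and tr: "\<tau> (x * y) = \<tau> (y * x)" for x y
    using \<tau> by (auto simp: trace_states_def)
  have off: "\<tau> (E' n \<mu> \<mu>') = 0" and diag: "\<tau> (E' n \<mu> \<mu>) = \<tau> (E' n \<mu>' \<mu>')"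
    if \<mu>: "\<mu> \<in> G n" "\<mu>' \<in> G n" "B.rng \<mu> = B.rng \<mu>'" and ne: "\<mu> \<noteq> \<mu>'" for n \<mu> \<mu>'
  proof -
    have "\<tau> (E' n \<mu> \<mu>') = \<tau> (E' n \<mu> \<mu> * E' n \<mu> \<mu>')" using \<mu> by (simp add: B.mu.mult_E)
    also have "\<dots> = \<tau> (E' n \<mu> \<mu>' * E' n \<mu> \<mu>)" by (rule tr)
    also have "E' n \<mu> \<mu>' * E' n \<mu> \<mu> = 0" using \<mu> ne by (simp add: B.mu.mult_E)
    finally show "\<tau> (E' n \<mu> \<mu>') = 0" by (simp add: state_zero[OF st])
    show "\<tau> (E' n \<mu> \<mu>) = \<tau> (E' n \<mu>' \<mu>')"
      using tr[of "E' n \<mu> \<mu>'" "E' n \<mu>' \<mu>"] \<mu> by (simp add: B.mu.mult_E)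
  qed
  have on_alg: "\<tau> (C a) = (\<Sum>\<mu>\<in>G n. A.mu.coef n a \<mu> \<mu> * \<tau> (E' n \<mu> \<mu>))" if a: "a \<in> A.mu.alg n" for a n
  proof -
    have "\<tau> (C a) = (\<Sum>\<mu>\<in>G n. B.mu.coef n (C a) \<mu> \<mu> * \<tau> (E' n \<mu> \<mu>))"
      by (rule B.mu.diagonal_state[OF st off C_in_alg[OF a]])
    then show ?thesis by (simp add: coef_C[OF a])
  qed
  have E: "\<tau> (C (E n \<mu> \<mu>')) = (if \<mu> = \<mu>' \<and> \<mu> \<in> G n then \<tau> (E' n \<mu> \<mu>) else 0)"
    if \<mu>: "\<mu> \<in> P n" "\<mu>' \<in> P n" "rng \<mu> = rng \<mu>'" for n \<mu> \<mu>'
  proof -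
    have "\<tau> (C (E n \<mu> \<mu>')) = (\<Sum>\<nu>\<in>G n. A.mu.coef n (E n \<mu> \<mu>') \<nu> \<nu> * \<tau> (E' n \<nu> \<nu>))"
      by (rule on_alg[OF A.mu.E_in_alg[OF \<mu>]])
    also have "\<dots> = (\<Sum>\<nu>\<in>G n. if \<nu> = \<mu> then (if \<mu> = \<mu>' then \<tau> (E' n \<mu> \<mu>) else 0) else 0)"
      by (intro sum.cong refl) (auto simp: A.mu.coef_E[OF \<mu>] G_P)
    finally show ?thesis by (auto simp: sum.delta finite_sub_paths)
  qed
  have pos: "\<tau> (C (star a * a)) \<in> \<real>\<^sub>\<ge>\<^sub>0" for a
  proof -
    obtain x where x: "\<And>k. x k \<in> A.AF_union" "x \<longlonglongrightarrow> a" by (rule A.AF_union_approx[of a]) blast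
    show ?thesis
    proof (rule closed_sequentially[OF closed_nonneg_Reals_complex])
      have "(\<lambda>k. star (x k) * x k) \<longlonglongrightarrow> star a * a" by (intro tendsto_mult tendsto_star x)
      then have "(\<lambda>k. C (star (x k) * x k)) \<longlonglongrightarrow> C (star a * a)"
        by (rule continuous_on_tendsto_compose[OF C_continuous]) auto
      then show "(\<lambda>k. \<tau> (C (star (x k) * x k))) \<longlonglongrightarrow> \<tau> (C (star a * a))"
        by (rule continuous_on_tendsto_compose[OF state_continuous[OF st, of UNIV]]) auto
      fix k
      obtain n where n: "x k \<in> A.mu.alg n" using x(1)[of k] by (auto simp: A.AF_union_def)
      show "\<tau> (C (star (x k) * x k)) \<in> \<real>\<^sub>\<ge>\<^sub>0"
        unfolding on_alg[OF A.mu.mult_in_alg[OF A.mu.star_in_alg[OF n] n]]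
        by (intro sum_nonneg_Reals nonneg_Reals_mult_I A.mu.coef_star_mult_self n G_P
            B.mu.state_E_nonneg[OF st])
    qed
  qed
  have "state_on UNIV (\<tau> \<circ> C)"
    using pos by (simp add: state_on_def C_add C_scaleC C_one state_add[OF st] state_scaleC[OF st]
        state_one[OF st])
  then show ?thesis
    unfolding geodesic_state_def
    using diag by (auto simp: E G_P subdiag_path_range)
qed

text \<open>
  A diagonal entry of \<open>a\<close> at a geodesic path is an entry of \<open>C a\<close>, hence bounded by its norm, and
  the state is a convex combination of these entries.
\<close>

lemma geodesic_state_le_norm_C:
  assumes \<omega>: "geodesic_state \<omega>"
  shows "cmod (\<omega> a) \<le> norm (C a)"
proof -
  have st: "state_on UNIV \<omega>" using \<omega> by (simp add: geodesic_state_def)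
  have alg: "cmod (\<omega> a) \<le> norm (C a)" if a: "a \<in> A.mu.alg n" for a n
  proof -
    have "\<omega> a = (\<Sum>\<mu>\<in>P n. A.mu.coef n a \<mu> \<mu> * \<omega> (E n \<mu> \<mu>))"
      by (rule A.mu.diagonal_state[OF st _ a]) (use \<omega> in \<open>auto simp: geodesic_state_def\<close>)
    also have "\<dots> = (\<Sum>\<mu>\<in>G n. A.mu.coef n a \<mu> \<mu> * \<omega> (E n \<mu> \<mu>))"
      by (intro sum.mono_neutral_right finite_paths sub_paths_subset)
        (use \<omega> in \<open>auto simp: geodesic_state_def\<close>)
    finally have "cmod (\<omega> a) \<le> (\<Sum>\<mu>\<in>G n. cmod (A.mu.coef n a \<mu> \<mu> * \<omega> (E n \<mu> \<mu>)))"
      by (simp add: norm_sum)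
    also have "\<dots> \<le> (\<Sum>\<mu>\<in>G n. norm (C a) * Re (\<omega> (E n \<mu> \<mu>)))"
    proof (rule sum_mono)
      fix \<mu> assume \<mu>: "\<mu> \<in> G n"
      have "cmod (A.mu.coef n a \<mu> \<mu>) \<le> norm (C a)"
        using B.mu.norm_coef_le[OF C_in_alg[OF a] \<mu> \<mu>] by (simp add: coef_C[OF a \<mu> \<mu>])
      moreover have "cmod (\<omega> (E n \<mu> \<mu>)) = Re (\<omega> (E n \<mu> \<mu>))"
        using A.mu.state_E_nonneg[OF st G_P[OF \<mu>]]
        by (simp add: complex_nonneg_Reals_iff cmod_eq_Re)
      ultimately show "cmod (A.mu.coef n a \<mu> \<mu> * \<omega> (E n \<mu> \<mu>)) \<le> norm (C a) * Re (\<omega> (E n \<mu> \<mu>))"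
        by (metis mult_right_mono norm_ge_zero norm_mult)
    qed
    also have "\<dots> = norm (C a) * Re (\<Sum>\<mu>\<in>G n. \<omega> (E n \<mu> \<mu>))"
      by (simp add: sum_distrib_left)
    also have "(\<Sum>\<mu>\<in>G n. \<omega> (E n \<mu> \<mu>)) = (\<Sum>\<mu>\<in>P n. \<omega> (E n \<mu> \<mu>))"
      by (intro sum.mono_neutral_left finite_paths sub_paths_subset)
        (use \<omega> in \<open>auto simp: geodesic_state_def\<close>)
    also have "\<dots> = 1" using state_sum[OF st, of "\<lambda>\<mu>. E n \<mu> \<mu>" "P n"] by (simp add: A.mu.sum_E state_one[OF st])
    finally show ?thesis by simp
  qed
  obtain x where x: "\<And>k. x k \<in> A.AF_union" "x \<longlonglongrightarrow> a" by (rule A.AF_union_approx[of a]) blast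
  show ?thesis
  proof (rule LIMSEQ_le)
    show "(\<lambda>k. cmod (\<omega> (x k))) \<longlonglongrightarrow> cmod (\<omega> a)"
      by (intro tendsto_norm continuous_on_tendsto_compose[OF state_continuous[OF st, of UNIV] x(2)]) auto
    show "(\<lambda>k. norm (C (x k))) \<longlonglongrightarrow> norm (C a)"
      by (intro tendsto_norm continuous_on_tendsto_compose[OF C_continuous x(2)]) auto
    show "\<exists>N. \<forall>k\<ge>N. cmod (\<omega> (x k)) \<le> norm (C (x k))"
      using x(1) alg by (auto simp: A.AF_union_def)
  qed
qed

lemma geodesic_state_eqI:
  assumes "geodesic_state \<omega>" "C a = C b"
  shows "\<omega> a = \<omega> b"
  using geodesic_state_le_norm_C[OF assms(1), of "a - b"] assms
  by (simp add: C_diff state_diff geodesic_state_def)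

text \<open>
  An entry of a fixed point of a stage links two paths with the same range and potential, which
  therefore are both geodesic or both not, and on which the state takes the same value.
\<close>

lemma geodesic_state_trace_on_Fix:
  assumes \<omega>: "geodesic_state \<omega>" and ab: "a \<in> A.Fix" "b \<in> A.Fix"
  shows "\<omega> (a * b) = \<omega> (b * a)"
proof -
  have st: "state_on UNIV \<omega>" using \<omega> by (simp add: geodesic_state_def)
  have alg: "\<omega> (x * y) = \<omega> (y * x)" if x: "x \<in> A.mu.alg n" "x \<in> A.Fix" and y: "y \<in> A.mu.alg n" for x y n
  proof -
    have exp: "\<omega> z = (\<Sum>\<mu>\<in>P n. A.mu.coef n z \<mu> \<mu> * \<omega> (E n \<mu> \<mu>))" if "z \<in> A.mu.alg n" for z
      by (rule A.mu.diagonal_state[OF st _ that]) (use \<omega> in \<open>auto simp: geodesic_state_def\<close>)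
    have "\<omega> (x * y) = (\<Sum>\<mu>\<in>P n. \<Sum>\<nu>\<in>P n. A.mu.coef n x \<mu> \<nu> * A.mu.coef n y \<nu> \<mu> * \<omega> (E n \<mu> \<mu>))"
      using x y by (simp add: exp A.mu.mult_in_alg A.mu.coef_mult sum_distrib_right)
    also have "\<dots> = (\<Sum>\<mu>\<in>P n. \<Sum>\<nu>\<in>P n. A.mu.coef n y \<nu> \<mu> * A.mu.coef n x \<mu> \<nu> * \<omega> (E n \<nu> \<nu>))"
    proof (intro sum.cong refl)
      fix \<mu> \<nu> assume \<mu>: "\<mu> \<in> P n" "\<nu> \<in> P n"
      show "A.mu.coef n x \<mu> \<nu> * A.mu.coef n y \<nu> \<mu> * \<omega> (E n \<mu> \<mu>) =
          A.mu.coef n y \<nu> \<mu> * A.mu.coef n x \<mu> \<nu> * \<omega> (E n \<nu> \<nu>)"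
      proof (cases "rng \<mu> = rng \<nu> \<and> Fp \<mu> = Fp \<nu>")
        case True
        then have "\<mu> \<in> G n \<longleftrightarrow> \<nu> \<in> G n" using G_exchange \<mu> by metis
        then have "\<omega> (E n \<mu> \<mu>) = \<omega> (E n \<nu> \<nu>)"
        proof (cases "\<mu> \<in> G n")
          case True
          then show ?thesis
            using \<omega> \<open>\<mu> \<in> G n \<longleftrightarrow> \<nu> \<in> G n\<close> \<open>rng \<mu> = rng \<nu> \<and> Fp \<mu> = Fp \<nu>\<close>
            unfolding geodesic_state_def by blast
        next
          case False
          then have "\<omega> (E n \<mu> \<mu>) = 0" "\<omega> (E n \<nu> \<nu>) = 0"
            using \<omega> \<mu> \<open>\<mu> \<in> G n \<longleftrightarrow> \<nu> \<in> G n\<close> unfolding geodesic_state_def by blast+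
          then show ?thesis by simp
        qed
        then show ?thesis by simp
      next
        case False
        then have "A.mu.coef n x \<mu> \<nu> = 0"
          using A.coef_Fix[OF x \<mu>] A.mu.coef_unrelated by blast
        then show ?thesis by simp
      qed
    qed
    also have "\<dots> = (\<Sum>\<nu>\<in>P n. \<Sum>\<mu>\<in>P n. A.mu.coef n y \<nu> \<mu> * A.mu.coef n x \<mu> \<nu> * \<omega> (E n \<nu> \<nu>))"
      by (rule sum.swap)
    also have "\<dots> = \<omega> (y * x)"
      using x y by (simp add: exp A.mu.mult_in_alg A.mu.coef_mult sum_distrib_right)
    finally show ?thesis .
  qed
  have "a \<in> closure (\<Union>n. A.mu.alg n \<inter> A.Fix)" "b \<in> closure (\<Union>n. A.mu.alg n \<inter> A.Fix)"
    using ab by (simp_all only: A.stages_dense_in_Fix)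
  then obtain x y where x: "\<forall>k. x k \<in> (\<Union>n. A.mu.alg n \<inter> A.Fix)" "x \<longlonglongrightarrow> a"
    and y: "\<forall>k. y k \<in> (\<Union>n. A.mu.alg n \<inter> A.Fix)" "y \<longlonglongrightarrow> b"
    unfolding closure_sequential by blast
  have "\<omega> (x k * y k) = \<omega> (y k * x k)" for k
  proof -
    have "x k \<in> A.AF_union" "y k \<in> A.AF_union" "x k \<in> A.Fix"
      using x(1)[THEN spec, of k] y(1)[THEN spec, of k] by (auto simp: A.AF_union_def)
    then obtain n where "x k \<in> A.mu.alg n" "y k \<in> A.mu.alg n" using A.AF_union_pair by blast
    then show ?thesis using alg \<open>x k \<in> A.Fix\<close> by blast
  qed
  moreover have "(\<lambda>k. \<omega> (x k * y k)) \<longlonglongrightarrow> \<omega> (a * b)" "(\<lambda>k. \<omega> (y k * x k)) \<longlonglongrightarrow> \<omega> (b * a)"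
    by (rule continuous_on_tendsto_compose[OF state_continuous[OF st, of UNIV]];
        auto intro: tendsto_mult x y)+
  ultimately show ?thesis by (simp add: LIMSEQ_unique)
qed

text \<open>
  The inverse of the correspondence is composition with this choice of preimages. A state that factors
  over the compression does not see the choice, which is why the composition is linear and positive.
\<close>

definition section_q :: "'b \<Rightarrow> 'a" where
  "section_q y = (SOME x. x \<in> A.Fix \<and> q x = y)"

lemma section_q_in_Fix: "section_q y \<in> A.Fix" and C_section_q: "C (section_q y) = y"
proof -
  have "\<exists>x. x \<in> A.Fix \<and> q x = y" using q_surj by (metis UNIV_I imageE)
  then have "section_q y \<in> A.Fix \<and> q (section_q y) = y" unfolding section_q_def by (rule someI_ex)
  then show "section_q y \<in> A.Fix" "C (section_q y) = y" by (simp_all add: C_Fix)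
qed

lemma geodesic_state_imp_trace:
  assumes \<omega>: "geodesic_state \<omega>"
  shows "\<omega> \<circ> section_q \<in> trace_states"
proof -
  have st: "state_on UNIV \<omega>" using \<omega> by (simp add: geodesic_state_def)
  note eqI = geodesic_state_eqI[OF \<omega>]
  note Fix = cstar_subalgebraD[OF A.cstar_subalgebra_Fix]
  have mult: "\<omega> (section_q (x * y)) = \<omega> (section_q x * section_q y)" for x y
  proof (rule eqI)
    have "C (section_q x * section_q y) = q (section_q x) * q (section_q y)"
      using q_hom section_q_in_Fix by (simp add: C_Fix Fix star_hom_on_def)
    then show "C (section_q (x * y)) = C (section_q x * section_q y)"
      by (simp add: C_section_q C_Fix[OF section_q_in_Fix, symmetric])
  qed
  have "\<omega> (section_q (star y * y)) = \<omega> (star (section_q y) * section_q y)" for y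
  proof (rule eqI)
    have "C (star (section_q y) * section_q y) = star (q (section_q y)) * q (section_q y)"
      using q_hom section_q_in_Fix by (simp add: C_Fix Fix star_hom_on_def)
    then show "C (section_q (star y * y)) = C (star (section_q y) * section_q y)"
      by (simp add: C_section_q C_Fix[OF section_q_in_Fix, symmetric])
  qed
  then have pos: "\<omega> (section_q (star y * y)) \<in> \<real>\<^sub>\<ge>\<^sub>0" for y using state_positive[OF st] by simp
  have "\<omega> (section_q (x + y)) = \<omega> (section_q x + section_q y)" for x y
    by (rule eqI) (simp add: C_section_q C_add)
  moreover have "\<omega> (section_q (c *\<^sub>C x)) = \<omega> (c *\<^sub>C section_q x)" for c x
    by (rule eqI) (simp add: C_section_q C_scaleC)
  moreover have "\<omega> (section_q 1) = \<omega> 1" by (rule eqI) (simp add: C_section_q C_one)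
  ultimately have "state_on UNIV (\<omega> \<circ> section_q)"
    using pos by (simp add: state_on_def state_add[OF st] state_scaleC[OF st] state_one[OF st])
  moreover have "\<omega> (section_q (x * y)) = \<omega> (section_q (y * x))" for x y
    using geodesic_state_trace_on_Fix[OF \<omega> section_q_in_Fix section_q_in_Fix] by (simp add: mult)
  ultimately show ?thesis by (simp add: trace_states_def)
qed

lemma local_iff_geodesic_state:
  "\<omega> \<in> local_KMS_infinity_states Br v0 E F \<longleftrightarrow> geodesic_state \<omega>"
  using local_imp_geodesic_state geodesic_state_imp_local by blast

lemma compression_affine_homeomorphism:
  "affine_homeomorphism (trace_states :: ('b \<Rightarrow> complex) set)
     (local_KMS_infinity_states Br v0 E F) (\<lambda>\<tau>. \<tau> \<circ> C)"
  unfolding affine_homeomorphism_def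
proof
  let ?L = "local_KMS_infinity_states Br v0 E F"
  have to: "\<tau> \<circ> C \<in> ?L" if "\<tau> \<in> trace_states" for \<tau>
    using that trace_imp_geodesic_state by (simp add: local_iff_geodesic_state)
  have trace: "\<omega> \<circ> section_q \<in> trace_states" if "\<omega> \<in> ?L" for \<omega>
    using that geodesic_state_imp_trace by (simp add: local_iff_geodesic_state)
  have "homeomorphic_maps (top_of_set trace_states) (top_of_set ?L) (\<lambda>\<tau>. \<tau> \<circ> C) (\<lambda>\<omega>. \<omega> \<circ> section_q)"
    unfolding homeomorphic_maps_def
  proof (intro conjI ballI)
    show "continuous_map (top_of_set trace_states) (top_of_set ?L) (\<lambda>\<tau>. \<tau> \<circ> C)"
      using to by (auto intro: continuous_on_precompose)
    show "continuous_map (top_of_set ?L) (top_of_set trace_states) (\<lambda>\<omega>. \<omega> \<circ> section_q)"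
      using trace by (auto intro: continuous_on_precompose)
    show "(\<tau> \<circ> C) \<circ> section_q = \<tau>" for \<tau> :: "'b \<Rightarrow> complex"
      by (simp add: fun_eq_iff C_section_q)
    fix \<omega> assume "\<omega> \<in> topspace (top_of_set ?L)"
    then have "geodesic_state \<omega>" by (simp add: local_iff_geodesic_state)
    then have "\<omega> (section_q (C a)) = \<omega> a" for a
      by (rule geodesic_state_eqI) (simp add: C_section_q)
    then show "(\<omega> \<circ> section_q) \<circ> C = \<omega>" by (simp add: fun_eq_iff)
  qed
  then show "homeomorphic_map (top_of_set trace_states) (top_of_set ?L) (\<lambda>\<tau>. \<tau> \<circ> C)"
    using homeomorphic_map_maps by blast
qed (simp add: fun_eq_iff)

end

theorem theorem4p4:
  fixes Br :: "('v, 'e) pre_digraph" and lvl :: "nat \<Rightarrow> 'v set" and v0 :: 'v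
    and F :: "'e \<Rightarrow> real"
    and E :: "nat \<Rightarrow> 'e list \<Rightarrow> 'e list \<Rightarrow> 'a::cstar_algebra"
    and E' :: "nat \<Rightarrow> 'e list \<Rightarrow> 'e list \<Rightarrow> 'b::cstar_algebra"
  assumes "bratteli_diagram Br lvl v0"
    and "AF_algebra Br v0 E"
    and "AF_algebra (geodesic_subdiagram Br v0 F) v0 E'"
  shows "affine_homeomorphism
           (trace_states :: ('b \<Rightarrow> complex) set)
           (local_KMS_infinity_states Br v0 E F)
           (\<lambda>\<tau>. \<tau> \<circ> geodesic_compression Br v0 E E' F)"
proof -
  interpret geodesic_AF Br lvl v0 F E E'
    by (intro geodesic_AF.intro geodesic_AF_axioms.intro bratteli_potential.intro assms)
  show ?thesis by (rule compression_affine_homeomorphism)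
qed

end
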